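(* The function $V$ is continuous on $\mathcal{D}$.
   Context: Setting (swing contract with strict constraints). Let $T>0$, $r\ge0$, $K>0$, $\bar u>0$, $m,M\ge0$ with $m<M$. Let $(\Omega,\mathcal{F}_T,\{\mathcal{F}_s\}_{s\in[0,T]},\mathbb{P})$ be a filtered probability space with a real $\{\mathcal{F}_s\}_s$-adapted Brownian motion $W$ (Brownian with respect to the filtration). Let $f,\sigma\in C([0,T]\times\mathbb{R};\mathbb{R})$ be Lipschitz continuous in the second variable uniformly in the first. For $(t,p)\in[0,T]\times\mathbb{R}$ let $P^{t,p}$ be the unique strong solution of $dP^{t,p}(s)=f(s,P^{t,p}(s))ds+\sigma(s,P^{t,p}(s))dW(s)$, $s\in[t,T]$, $P^{t,p}(t)=p$. Let $\mathcal{A}_t$ be the set of $[0,\bar u]$-valued progressively measurable processes $u=\{u(s)\}_{s\in[t,T]}$; for $z\in\mathbb{R}$ put $Z^{t,z;u}(s)=z+\int_t^s u(\tau)d\tau$ and $\mathcal{A}_{tz}^{\mathrm{adm}}=\{u\in\mathcal{A}_t:Z^{t,z;u}(T)\in[m,M]\ \mathbb{P}\text{-a.s.}\}$. Let $\mathcal{D}=\{(t,p,z)\in[0,T]\times\mathbb{R}^2: m-\bar u(T-t)\le z\le M\}$ and, for $(t,p,z)\in\mathcal{D}$, $$V(t,p,z)=\sup_{u\in\mathcal{A}_{tz}^{\mathrm{adm}}}\mathbb{E}\Big[\int_t^T e^{-r(s-t)}(P^{t,p}(s)-K)u(s)\,ds\Big].$$ *)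

theory Defs
  imports "HOL-Probability.Probability"
begin

text \<open>
  Processes are functions \<open>real \<Rightarrow> 'a \<Rightarrow> real\<close> (time first).  The filtration and all processes
  matter only on the time interval named in the respective definition; their values elsewhere are
  irrelevant.  The usual conditions (completeness, right-continuity) are not imposed on the
  filtration; path continuity is therefore required only almost surely.
\<close>

definition filtered_prob_space :: "'a measure \<Rightarrow> (real \<Rightarrow> 'a measure) \<Rightarrow> real \<Rightarrow> bool" where
  "filtered_prob_space \<Omega> F T \<longleftrightarrow>
     prob_space \<Omega> \<and>
     (\<forall>s\<in>{0..T}. subalgebra \<Omega> (F s)) \<and>
     (\<forall>s\<in>{0..T}. \<forall>s'\<in>{s..T}. sets (F s) \<subseteq> sets (F s')) \<and>
     sets (F T) = sets \<Omega>"

definition progressive :: "(real \<Rightarrow> 'a measure) \<Rightarrow> real \<Rightarrow> real \<Rightarrow> (real \<Rightarrow> 'a \<Rightarrow> real) \<Rightarrow> bool" where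
  "progressive F t T X \<longleftrightarrow>
     (\<forall>s\<in>{t..T}. (\<lambda>(\<tau>, \<omega>). X \<tau> \<omega>) \<in> borel_measurable (restrict_space borel {t..s} \<Otimes>\<^sub>M F s))"

definition brownian_motion ::
    "'a measure \<Rightarrow> (real \<Rightarrow> 'a measure) \<Rightarrow> real \<Rightarrow> (real \<Rightarrow> 'a \<Rightarrow> real) \<Rightarrow> bool" where
  "brownian_motion \<Omega> F T W \<longleftrightarrow>
     (\<forall>s\<in>{0..T}. W s \<in> borel_measurable (F s)) \<and>
     (AE \<omega> in \<Omega>. W 0 \<omega> = 0) \<and>
     (AE \<omega> in \<Omega>. continuous_on {0..T} (\<lambda>s. W s \<omega>)) \<and>
     (\<forall>s s'. 0 \<le> s \<and> s < s' \<and> s' \<le> T \<longrightarrow>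
        distributed \<Omega> lborel (\<lambda>\<omega>. W s' \<omega> - W s \<omega>) (normal_density 0 (sqrt (s' - s))) \<and>
        prob_space.indep_set \<Omega> (sets (F s))
          (sets (vimage_algebra (space \<Omega>) (\<lambda>\<omega>. W s' \<omega> - W s \<omega>) borel)))"

definition tendsto_in_probability :: "'a measure \<Rightarrow> (nat \<Rightarrow> 'a \<Rightarrow> real) \<Rightarrow> ('a \<Rightarrow> real) \<Rightarrow> bool" where
  "tendsto_in_probability \<Omega> X Y \<longleftrightarrow>
     (\<forall>\<epsilon>>0. (\<lambda>k. measure \<Omega> {\<omega>\<in>space \<Omega>. \<epsilon> < \<bar>X k \<omega> - Y \<omega>\<bar>}) \<longlonglongrightarrow> 0)"

text \<open>
  A simple integrand on \<open>[t, T]\<close> is given by partition points \<open>x 0 < \<dots> < x n\<close> in \<open>[t, T]\<close> and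
  bounded coefficients, \<open>\<xi> i\<close> being known at time \<open>x i\<close> and used on \<open>(x i, x (i + 1)]\<close>.
\<close>

definition simple_integrand ::
    "'a measure \<Rightarrow> (real \<Rightarrow> 'a measure) \<Rightarrow> real \<Rightarrow> real \<Rightarrow>
      nat \<Rightarrow> (nat \<Rightarrow> real) \<Rightarrow> (nat \<Rightarrow> 'a \<Rightarrow> real) \<Rightarrow> bool" where
  "simple_integrand \<Omega> F t T n x \<xi> \<longleftrightarrow>
     (\<forall>i\<le>n. x i \<in> {t..T}) \<and>
     (\<forall>i<n. x i < x (Suc i)) \<and>
     (\<forall>i<n. \<xi> i \<in> borel_measurable (F (x i)) \<and> (\<exists>C. \<forall>\<omega>\<in>space \<Omega>. \<bar>\<xi> i \<omega>\<bar> \<le> C))"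

definition simple_process ::
    "nat \<Rightarrow> (nat \<Rightarrow> real) \<Rightarrow> (nat \<Rightarrow> 'a \<Rightarrow> real) \<Rightarrow> real \<Rightarrow> 'a \<Rightarrow> real" where
  "simple_process n x \<xi> s \<omega> = (\<Sum>i<n. \<xi> i \<omega> * indicator {x i<..x (Suc i)} s)"

definition simple_integral ::
    "(real \<Rightarrow> 'a \<Rightarrow> real) \<Rightarrow> nat \<Rightarrow> (nat \<Rightarrow> real) \<Rightarrow> (nat \<Rightarrow> 'a \<Rightarrow> real) \<Rightarrow> real \<Rightarrow> 'a \<Rightarrow> real" where
  "simple_integral W n x \<xi> s \<omega> =
     (\<Sum>i<n. \<xi> i \<omega> * (W (min s (x (Suc i))) \<omega> - W (min s (x i)) \<omega>))"

text \<open>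
  \<open>ito_integral \<Omega> F W t T H I\<close> says that the almost surely continuous process \<open>I\<close> is (a version
  of) the Ito integral \<open>I s = \<integral>\<^sub>t\<^sup>s H dW\<close>, \<open>t \<le> s \<le> T\<close>, of the progressively measurable process
  \<open>H\<close>, whose square is almost surely integrable in time: simple integrands converge to \<open>H\<close>, in
  that the time integral of the squared difference vanishes in probability, and their elementary
  integrals converge in probability to \<open>I\<close>.  Up to indistinguishability, \<open>I\<close> does not depend on
  the approximating sequence.
\<close>

definition ito_integral ::
    "'a measure \<Rightarrow> (real \<Rightarrow> 'a measure) \<Rightarrow> (real \<Rightarrow> 'a \<Rightarrow> real) \<Rightarrow> real \<Rightarrow> real \<Rightarrow>
      (real \<Rightarrow> 'a \<Rightarrow> real) \<Rightarrow> (real \<Rightarrow> 'a \<Rightarrow> real) \<Rightarrow> bool" where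
  "ito_integral \<Omega> F W t T H I \<longleftrightarrow>
     progressive F t T H \<and>
     (AE \<omega> in \<Omega>. set_integrable lborel {t..T} (\<lambda>s. (H s \<omega>)\<^sup>2)) \<and>
     progressive F t T I \<and>
     (AE \<omega> in \<Omega>. continuous_on {t..T} (\<lambda>s. I s \<omega>)) \<and>
     (\<exists>n x \<xi>.
        (\<forall>k. simple_integrand \<Omega> F t T (n k) (x k) (\<xi> k)) \<and>
        tendsto_in_probability \<Omega>
          (\<lambda>k \<omega>. LBINT s:{t..T}. (simple_process (n k) (x k) (\<xi> k) s \<omega> - H s \<omega>)\<^sup>2) (\<lambda>_. 0) \<and>
        (\<forall>s\<in>{t..T}. tendsto_in_probability \<Omega>
          (\<lambda>k. simple_integral W (n k) (x k) (\<xi> k) s) (I s)))"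

text \<open>
  \<open>X\<close> solves \<open>dX(s) = f(s, X(s)) ds + \<sigma>(s, X(s)) dW(s)\<close> on \<open>[t, T]\<close> with \<open>X(t) = p\<close>, on the given
  probability space and for the given Brownian motion.
\<close>

definition strong_solution ::
    "'a measure \<Rightarrow> (real \<Rightarrow> 'a measure) \<Rightarrow> (real \<Rightarrow> 'a \<Rightarrow> real) \<Rightarrow>
      (real \<Rightarrow> real \<Rightarrow> real) \<Rightarrow> (real \<Rightarrow> real \<Rightarrow> real) \<Rightarrow> real \<Rightarrow> real \<Rightarrow> real \<Rightarrow>
      (real \<Rightarrow> 'a \<Rightarrow> real) \<Rightarrow> bool" where
  "strong_solution \<Omega> F W f \<sigma> t T p X \<longleftrightarrow>
     progressive F t T X \<and>
     (AE \<omega> in \<Omega>. continuous_on {t..T} (\<lambda>s. X s \<omega>)) \<and>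
     (AE \<omega> in \<Omega>. X t \<omega> = p) \<and>
     (AE \<omega> in \<Omega>. set_integrable lborel {t..T} (\<lambda>s. f s (X s \<omega>))) \<and>
     (\<exists>I. ito_integral \<Omega> F W t T (\<lambda>s \<omega>. \<sigma> s (X s \<omega>)) I \<and>
        (AE \<omega> in \<Omega>. \<forall>s\<in>{t..T}. X s \<omega> = p + (LBINT \<tau>:{t..s}. f \<tau> (X \<tau> \<omega>)) + I s \<omega>))"

definition controls ::
    "'a measure \<Rightarrow> (real \<Rightarrow> 'a measure) \<Rightarrow> real \<Rightarrow> real \<Rightarrow> real \<Rightarrow> (real \<Rightarrow> 'a \<Rightarrow> real) set" where
  "controls \<Omega> F T ubar t =
     {u. progressive F t T u \<and> (\<forall>s\<in>{t..T}. \<forall>\<omega>\<in>space \<Omega>. u s \<omega> \<in> {0..ubar})}"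

definition usage :: "real \<Rightarrow> real \<Rightarrow> (real \<Rightarrow> 'a \<Rightarrow> real) \<Rightarrow> real \<Rightarrow> 'a \<Rightarrow> real" where
  "usage t z u s \<omega> = z + (LBINT \<tau>:{t..s}. u \<tau> \<omega>)"

definition admissible ::
    "'a measure \<Rightarrow> (real \<Rightarrow> 'a measure) \<Rightarrow> real \<Rightarrow> real \<Rightarrow> real \<Rightarrow> real \<Rightarrow> real \<Rightarrow> real \<Rightarrow>
      (real \<Rightarrow> 'a \<Rightarrow> real) set" where
  "admissible \<Omega> F T ubar m M t z =
     {u \<in> controls \<Omega> F T ubar t. AE \<omega> in \<Omega>. usage t z u T \<omega> \<in> {m..M}}"

definition swing_domain :: "real \<Rightarrow> real \<Rightarrow> real \<Rightarrow> real \<Rightarrow> (real \<times> real \<times> real) set" where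
  "swing_domain T ubar m M =
     {(t, p, z). t \<in> {0..T} \<and> m - ubar * (T - t) \<le> z \<and> z \<le> M}"

text \<open>
  Here \<open>P t p\<close> is the price process started at time \<open>t\<close> from \<open>p\<close>.  On the domain above the
  supremum is over a nonempty set of reals which is bounded for Lipschitz coefficients, so that
  the real-valued supremum is the intended one.
\<close>

definition swing_value ::
    "'a measure \<Rightarrow> (real \<Rightarrow> 'a measure) \<Rightarrow> (real \<Rightarrow> real \<Rightarrow> real \<Rightarrow> 'a \<Rightarrow> real) \<Rightarrow>
      real \<Rightarrow> real \<Rightarrow> real \<Rightarrow> real \<Rightarrow> real \<Rightarrow> real \<Rightarrow> real \<Rightarrow> real \<Rightarrow> real \<Rightarrow> real" where
  "swing_value \<Omega> F P T r K ubar m M t p z =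
     (SUP u \<in> admissible \<Omega> F T ubar m M t z.
        prob_space.expectation \<Omega>
          (\<lambda>\<omega>. LBINT s:{t..T}. exp (- r * (s - t)) * (P t p s \<omega> - K) * u s \<omega>))"

end

theory Submission
  imports Defs
begin

text \<open>
The value at a state \<open>(t\<^sub>1, p\<^sub>1, z\<^sub>1)\<close> is compared with the value at \<open>(t\<^sub>2, p\<^sub>2, z\<^sub>2)\<close> by turning every
control that is admissible for the first state into one that is admissible for the second and
produces almost the same payoff.  Two independent facts make this possible.

The control is transported as follows.  It is extended by zero (or restricted) to \<open>[t\<^sub>2, T]\<close>, which
changes the final volume by at most \<open>\<delta> = \<bar>z\<^sub>1 - z\<^sub>2\<bar> + ubar \<bar>t\<^sub>1 - t\<^sub>2\<bar>\<close>.  Then it is switched off once the volume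
\<open>M\<close> is reached, and dually its complement \<open>ubar - u\<close> is switched off once any further saving would make
the volume \<open>m\<close> unreachable.  Both rules look only at the volume used so far, hence preserve
progressive measurability; together they truncate the final volume to \<open>[m, M]\<close> exactly, whatever
the control was, and they alter it by at most \<open>\<delta>\<close> in \<open>L\<^sup>1\<close> of time (\<open>admissible_transfer\<close>).

The price depends continuously on its initial data in mean square (\<open>solution_stability\<close>,
\<open>solution_increment\<close>).  Besides linearity and restriction to subintervals, this rests on one property
of the Ito integral, the inequality \<open>E (\<integral> H dW)\<^sup>2 \<le> E \<integral> H\<^sup>2\<close> and its truncated form: on the event \<open>\<integral> H\<^sup>2 \<le> R\<close> the square of the integral has
expectation at most \<open>E min R (\<integral> H\<^sup>2)\<close> (\<open>truncated_ito_inequality\<close>).  It is proved for simple integrands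
by dropping each coefficient that would push the accumulated square beyond \<open>R\<close>, and passes to the
limit by Fatou's lemma.  Since \<open>min R (\<integral>\<^sub>a\<^sup>s H\<^sup>2)\<close> is the integral of \<open>H\<^sup>2\<close> up to the time at which the clock
\<open>\<integral>\<^sub>a H\<^sup>2\<close> reaches \<open>R\<close>, this replaces localisation by stopping times: restricted to the
event that the clock is still below \<open>R\<close>, second moments are finite and Gronwall's lemma applies, both to a
solution and to the difference of two solutions (\<open>moment_bound\<close>).

Finally, products of a price error with a control, and of a price with a control error, are split
by the arithmetic-geometric mean inequality with a free weight \<open>\<eta>\<close>, which gives a modulus of
continuity for the value that is at most a multiple of \<open>\<eta>\<close> in the limit (\<open>payoff_difference\<close>, \<open>value_le\<close>).
\<close>

section \<open>Simple integrands and their isometry\<close>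

abbreviation energy :: "real \<Rightarrow> real \<Rightarrow> (real \<Rightarrow> real) \<Rightarrow> ennreal" where
  "energy a b g \<equiv> (\<integral>\<^sup>+s\<in>{a..b}. ennreal ((g s)\<^sup>2) \<partial>lborel)"

lemma simple_integrandD:
  assumes "simple_integrand \<Omega> F a b n x \<xi>"
  shows "i \<le> n \<Longrightarrow> a \<le> x i" "i \<le> n \<Longrightarrow> x i \<le> b" "i < n \<Longrightarrow> x i < x (Suc i)"
    and "i < n \<Longrightarrow> \<xi> i \<in> borel_measurable (F (x i))"
    and "i < n \<Longrightarrow> \<exists>C. \<forall>\<omega>\<in>space \<Omega>. \<bar>\<xi> i \<omega>\<bar> \<le> C"
  using assms unfolding simple_integrand_def by simp_all

locale brownian_basis = prob_space \<Omega> for \<Omega> :: "'a measure" +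
  fixes F :: "real \<Rightarrow> 'a measure" and W :: "real \<Rightarrow> 'a \<Rightarrow> real" and T :: real
  assumes basis: "filtered_prob_space \<Omega> F T"
    and bm: "brownian_motion \<Omega> F T W"
begin

abbreviation nn_expectation :: "('a \<Rightarrow> ennreal) \<Rightarrow> ennreal" (binder "\<EE>" 10) where
  "nn_expectation X \<equiv> integral\<^sup>N \<Omega> X"

abbreviation jointly_measurable :: "(real \<Rightarrow> 'a \<Rightarrow> 'b :: topological_space) \<Rightarrow> bool" where
  "jointly_measurable X \<equiv> (\<lambda>(s, \<omega>). X s \<omega>) \<in> borel_measurable (borel \<Otimes>\<^sub>M \<Omega>)"

lemma space_F: "s \<in> {0..T} \<Longrightarrow> space (F s) = space \<Omega>"
  using basis by (auto simp: filtered_prob_space_def subalgebra_def)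

lemma sets_F_T: "sets (F T) = sets \<Omega>"
  using basis by (auto simp: filtered_prob_space_def)

lemma measurable_F_mono:
  assumes "X \<in> borel_measurable (F s)" "0 \<le> s" "s \<le> s'" "s' \<le> T"
  shows "X \<in> borel_measurable (F s')"
  using basis assms
  by (intro measurable_from_subalg[OF _ assms(1)]) (auto simp: subalgebra_def space_F filtered_prob_space_def)

lemma measurable_F:
  assumes "X \<in> borel_measurable (F s)" "s \<in> {0..T}"
  shows "X \<in> borel_measurable \<Omega>"
  using basis assms
  by (intro measurable_from_subalg[OF _ assms(1)]) (auto simp: filtered_prob_space_def)

lemma measurable_W_F: "s \<in> {0..T} \<Longrightarrow> W s \<in> borel_measurable (F s)"
  using bm by (auto simp: brownian_motion_def)

lemma measurable_W: "s \<in> {0..T} \<Longrightarrow> W s \<in> borel_measurable \<Omega>"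
  using measurable_W_F measurable_F by blast

lemma increment_moments:
  assumes "0 \<le> s" "s \<le> s'" "s' \<le> T"
  shows "integrable \<Omega> (\<lambda>\<omega>. W s' \<omega> - W s \<omega>)" "expectation (\<lambda>\<omega>. W s' \<omega> - W s \<omega>) = 0"
    and "integrable \<Omega> (\<lambda>\<omega>. (W s' \<omega> - W s \<omega>)\<^sup>2)"
    and "expectation (\<lambda>\<omega>. (W s' \<omega> - W s \<omega>)\<^sup>2) = s' - s"
proof -
  have D: "distributed \<Omega> lborel (\<lambda>\<omega>. W s' \<omega> - W s \<omega>) (normal_density 0 (sqrt (s' - s)))" if "s < s'"
    using bm assms that by (auto simp: brownian_motion_def)
  have "integrable \<Omega> (\<lambda>\<omega>. W s' \<omega> - W s \<omega>) \<and> expectation (\<lambda>\<omega>. W s' \<omega> - W s \<omega>) = 0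
    \<and> integrable \<Omega> (\<lambda>\<omega>. (W s' \<omega> - W s \<omega>)\<^sup>2) \<and> expectation (\<lambda>\<omega>. (W s' \<omega> - W s \<omega>)\<^sup>2) = s' - s"
  proof (cases "s = s'")
    case False
    then have ss: "s < s'" using assms by simp
    then have pos: "0 < sqrt (s' - s)" by simp
    have *: "distributed \<Omega> lborel (\<lambda>\<omega>. W s' \<omega> - W s \<omega>) (\<lambda>x. ennreal (normal_density 0 (sqrt (s' - s)) x))"
      using D[OF ss] .
    have m1: "has_bochner_integral lborel (\<lambda>x. normal_density 0 (sqrt (s' - s)) x * x) 0"
      using normal_moment_nz_1[OF pos, of 0] .
    have m2: "has_bochner_integral lborel (\<lambda>x. normal_density 0 (sqrt (s' - s)) x * x\<^sup>2) (s' - s)"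
      using normal_moment_even[OF pos, of 0 1] ss by (simp add: diff_divide_distrib)
    show ?thesis
      using distributed_integrable[OF *, of "\<lambda>x. x"] distributed_integral[OF *, of "\<lambda>x. x"]
        distributed_integrable[OF *, of "\<lambda>x. x\<^sup>2"] distributed_integral[OF *, of "\<lambda>x. x\<^sup>2"] m1 m2
      by (auto simp: has_bochner_integral_iff)
  qed simp
  then show "integrable \<Omega> (\<lambda>\<omega>. W s' \<omega> - W s \<omega>)" "expectation (\<lambda>\<omega>. W s' \<omega> - W s \<omega>) = 0"
    and "integrable \<Omega> (\<lambda>\<omega>. (W s' \<omega> - W s \<omega>)\<^sup>2)"
    and "expectation (\<lambda>\<omega>. (W s' \<omega> - W s \<omega>)\<^sup>2) = s' - s" by auto
qed

lemma increment_indep: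
  assumes "X \<in> borel_measurable (F s)" "0 \<le> s" "s < s'" "s' \<le> T"
  shows "indep_var borel X borel (\<lambda>\<omega>. W s' \<omega> - W s \<omega>)"
proof -
  have X: "X \<in> borel_measurable \<Omega>" using assms measurable_F[OF assms(1)] by simp
  have ind: "indep_set (sets (F s)) (sets (vimage_algebra (space \<Omega>) (\<lambda>\<omega>. W s' \<omega> - W s \<omega>) borel))"
    using bm assms by (auto simp: brownian_motion_def)
  have "sigma_sets (space \<Omega>) {X -` A \<inter> space \<Omega> |A. A \<in> sets borel} \<subseteq> sets (F s)"
  proof -
    have sp: "space \<Omega> = space (F s)" using space_F[of s] assms by simp
    show ?thesis unfolding sp
      by (rule sets.sigma_sets_subset) (use assms(1) in \<open>auto simp: measurable_sets\<close>)
  qed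
  then show ?thesis
    using ind measurable_W[of s] measurable_W[of s'] X assms
    by (simp add: indep_var_eq sets_vimage_algebra indep_sets2_eq) blast
qed

text \<open>The mixed terms vanish because each increment of \<open>W\<close> is centred and independent of everything known
at the left end point.\<close>

lemma simple_isometry:
  assumes simple: "simple_integrand \<Omega> F a b n x \<xi>" and ab: "0 \<le> a" "b \<le> T"
    and "m \<le> n"
  defines "S \<equiv> \<lambda>m \<omega>. \<Sum>i<m. \<xi> i \<omega> * (W (x (Suc i)) \<omega> - W (x i) \<omega>)"
  shows "S m \<in> borel_measurable (F (x m))" "integrable \<Omega> (\<lambda>\<omega>. (S m \<omega>)\<^sup>2)"
    and "expectation (\<lambda>\<omega>. (S m \<omega>)\<^sup>2) = expectation (\<lambda>\<omega>. \<Sum>i<m. (\<xi> i \<omega>)\<^sup>2 * (x (Suc i) - x i))"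
proof -
  have x: "0 \<le> x i" "x i \<le> T" if "i \<le> n" for i
    using simple_integrandD(1,2)[OF simple that] ab by auto
  have "S m \<in> borel_measurable (F (x m)) \<and> integrable \<Omega> (\<lambda>\<omega>. (S m \<omega>)\<^sup>2) \<and>
    expectation (\<lambda>\<omega>. (S m \<omega>)\<^sup>2) = expectation (\<lambda>\<omega>. \<Sum>i<m. (\<xi> i \<omega>)\<^sup>2 * (x (Suc i) - x i)) \<and>
    integrable \<Omega> (\<lambda>\<omega>. \<Sum>i<m. (\<xi> i \<omega>)\<^sup>2 * (x (Suc i) - x i))"
    using \<open>m \<le> n\<close>
  proof (induction m)
    case 0
    then show ?case by (simp add: S_def)
  next
    case (Suc m)
    then have IH: "S m \<in> borel_measurable (F (x m))" "integrable \<Omega> (\<lambda>\<omega>. (S m \<omega>)\<^sup>2)"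
      "expectation (\<lambda>\<omega>. (S m \<omega>)\<^sup>2) = expectation (\<lambda>\<omega>. \<Sum>i<m. (\<xi> i \<omega>)\<^sup>2 * (x (Suc i) - x i))"
      "integrable \<Omega> (\<lambda>\<omega>. \<Sum>i<m. (\<xi> i \<omega>)\<^sup>2 * (x (Suc i) - x i))" by auto
    define c where "c = \<xi> m"
    define \<Delta> where "\<Delta> = (\<lambda>\<omega>. W (x (Suc m)) \<omega> - W (x m) \<omega>)"
    have lt: "x m < x (Suc m)" and xm: "0 \<le> x m" "x m \<le> T" "0 \<le> x (Suc m)" "x (Suc m) \<le> T"
      using simple Suc.prems x[of m] x[of "Suc m"] by (auto simp: simple_integrand_def)
    have c: "c \<in> borel_measurable (F (x m))"
      using simple Suc.prems by (auto simp: simple_integrand_def c_def)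
    obtain C where C: "\<And>\<omega>. \<omega> \<in> space \<Omega> \<Longrightarrow> \<bar>c \<omega>\<bar> \<le> C"
      using simple Suc.prems unfolding simple_integrand_def c_def by (meson Suc_le_lessD)
    have c'[measurable]: "c \<in> borel_measurable \<Omega>" and S'[measurable]: "S m \<in> borel_measurable \<Omega>"
      using c IH(1) measurable_F xm by auto
    have [measurable]: "\<Delta> \<in> borel_measurable \<Omega>"
      using measurable_W xm by (auto simp: \<Delta>_def)
    have intS: "integrable \<Omega> (S m)"
      by (rule square_integrable_imp_integrable) (use IH in auto)
    have intSc: "integrable \<Omega> (\<lambda>\<omega>. S m \<omega> * c \<omega>)"
      by (rule Bochner_Integration.integrable_bound[OF integrable_mult_left[OF intS, of C]])
        (auto intro!: AE_I2 mult_left_mono order_trans[OF C abs_ge_self] simp: abs_mult)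
    have intc: "integrable \<Omega> (\<lambda>\<omega>. (c \<omega>)\<^sup>2)"
    proof (rule integrable_const_bound[of _ "C\<^sup>2"])
      show "AE \<omega> in \<Omega>. norm ((c \<omega>)\<^sup>2) \<le> C\<^sup>2"
        using C by (auto intro!: AE_I2) (metis abs_ge_zero power2_abs power_mono)
    qed auto
    have D: "integrable \<Omega> \<Delta>" "expectation \<Delta> = 0" "integrable \<Omega> (\<lambda>\<omega>. (\<Delta> \<omega>)\<^sup>2)"
      "expectation (\<lambda>\<omega>. (\<Delta> \<omega>)\<^sup>2) = x (Suc m) - x m"
      using increment_moments[of "x m" "x (Suc m)"] lt xm by (auto simp: \<Delta>_def)
    have "(\<lambda>\<omega>. S m \<omega> * c \<omega>) \<in> borel_measurable (F (x m))" using c IH(1) by measurable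
    then have i1: "indep_var borel (\<lambda>\<omega>. S m \<omega> * c \<omega>) borel \<Delta>"
      unfolding \<Delta>_def using lt xm by (intro increment_indep) auto
    have i2: "indep_var borel (\<lambda>\<omega>. (c \<omega>)\<^sup>2) borel (\<lambda>\<omega>. (\<Delta> \<omega>)\<^sup>2)"
    proof -
      have "indep_var borel c borel \<Delta>"
        unfolding \<Delta>_def using lt xm c by (intro increment_indep) auto
      from indep_var_compose[OF this, of "\<lambda>x. x\<^sup>2" borel "\<lambda>x. x\<^sup>2" borel] show ?thesis
        by (simp add: comp_def)
    qed
    have I1: "integrable \<Omega> (\<lambda>\<omega>. S m \<omega> * c \<omega> * \<Delta> \<omega>)" "expectation (\<lambda>\<omega>. S m \<omega> * c \<omega> * \<Delta> \<omega>) = 0"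
      using indep_var_integrable[OF i1 intSc D(1)] indep_var_lebesgue_integral[OF i1 intSc D(1)] D(2) by auto
    have I2: "integrable \<Omega> (\<lambda>\<omega>. (c \<omega>)\<^sup>2 * (\<Delta> \<omega>)\<^sup>2)"
      "expectation (\<lambda>\<omega>. (c \<omega>)\<^sup>2 * (\<Delta> \<omega>)\<^sup>2) = expectation (\<lambda>\<omega>. (c \<omega>)\<^sup>2 * (x (Suc m) - x m))"
      using indep_var_integrable[OF i2 intc D(3)] indep_var_lebesgue_integral[OF i2 intc D(3)] D(4) by auto
    have eq: "(S (Suc m) \<omega>)\<^sup>2 = (S m \<omega>)\<^sup>2 + 2 * (S m \<omega> * c \<omega> * \<Delta> \<omega>) + (c \<omega>)\<^sup>2 * (\<Delta> \<omega>)\<^sup>2" for \<omega>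
      by (simp add: S_def c_def \<Delta>_def power2_eq_square algebra_simps)
    have "S (Suc m) \<in> borel_measurable (F (x (Suc m)))"
    proof -
      have "S m \<in> borel_measurable (F (x (Suc m)))" "c \<in> borel_measurable (F (x (Suc m)))"
        "W (x m) \<in> borel_measurable (F (x (Suc m)))" "W (x (Suc m)) \<in> borel_measurable (F (x (Suc m)))"
        using IH(1) c xm lt measurable_W_F[of "x m"] measurable_W_F[of "x (Suc m)"]
        by (auto intro: measurable_F_mono[of _ "x m"])
      then have "(\<lambda>\<omega>. S m \<omega> + c \<omega> * (W (x (Suc m)) \<omega> - W (x m) \<omega>)) \<in> borel_measurable (F (x (Suc m)))"
        by measurable
      then show ?thesis by (simp add: S_def c_def)
    qed
    moreover have "expectation (\<lambda>\<omega>. (S (Suc m) \<omega>)\<^sup>2) =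
        expectation (\<lambda>\<omega>. \<Sum>i<Suc m. (\<xi> i \<omega>)\<^sup>2 * (x (Suc i) - x i))"
      unfolding eq using I1 I2 IH intc by (simp add: c_def)
    moreover have "integrable \<Omega> (\<lambda>\<omega>. (S (Suc m) \<omega>)\<^sup>2)"
      unfolding eq using I1 I2 IH intc by simp
    moreover have "integrable \<Omega> (\<lambda>\<omega>. \<Sum>i<Suc m. (\<xi> i \<omega>)\<^sup>2 * (x (Suc i) - x i))"
      using IH intc by (simp add: c_def)
    ultimately show ?case by simp
  qed
  then show "S m \<in> borel_measurable (F (x m))" "integrable \<Omega> (\<lambda>\<omega>. (S m \<omega>)\<^sup>2)"
    and "expectation (\<lambda>\<omega>. (S m \<omega>)\<^sup>2) = expectation (\<lambda>\<omega>. \<Sum>i<m. (\<xi> i \<omega>)\<^sup>2 * (x (Suc i) - x i))"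
    by auto
qed

end

lemma simple_process_as_step_sum:
  assumes "simple_integrand \<Omega> F a b n x \<xi>"
  shows "simple_process n x \<xi> s \<omega> = (\<Sum>i<n. \<xi> i \<omega> * (indicator {s..} (x (Suc i)) - indicator {s..} (x i)))"
proof -
  have "indicator {x i<..x (Suc i)} s = (indicator {s..} (x (Suc i)) - indicator {s..} (x i) :: real)"
    if "i < n" for i
    using simple_integrandD(3)[OF assms that] by (auto simp: indicator_def)
  then show ?thesis by (simp add: simple_process_def)
qed

lemma simple_integral_as_step_sum:
  assumes "simple_integrand \<Omega> F a b n x \<xi>"
  shows "simple_integral W n x \<xi> b \<omega> = (\<Sum>i<n. \<xi> i \<omega> * (W (x (Suc i)) \<omega> - W (x i) \<omega>))"
proof -
  have "min b (x i) = x i" if "i \<le> n" for i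
    using simple_integrandD(2)[OF assms that] by (simp add: min_def)
  then show ?thesis by (simp add: simple_integral_def)
qed

lemma simple_integrand_mono:
  assumes "simple_integrand \<Omega> F a b n x \<xi>" "i \<le> j" "j \<le> n"
  shows "x i \<le> x j"
  using assms(2,3)
proof (induction j)
  case (Suc j)
  then show ?case
    using simple_integrandD(3)[OF assms(1), of j] by (cases "i = Suc j") auto
qed simp

lemma simple_process_square:
  assumes "simple_integrand \<Omega> F a b n x \<xi>"
  shows "(simple_process n x \<xi> s \<omega>)\<^sup>2 = (\<Sum>i<n. (\<xi> i \<omega>)\<^sup>2 * indicator {x i<..x (Suc i)} s)"
proof -
  have "(\<Sum>i<m. \<xi> i \<omega> * indicator {x i<..x (Suc i)} s)\<^sup>2 = (\<Sum>i<m. (\<xi> i \<omega>)\<^sup>2 * indicator {x i<..x (Suc i)} s)"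
    if "m \<le> n" for m
    using that
  proof (induction m)
    case (Suc m)
    have "(\<Sum>i<m. \<xi> i \<omega> * indicator {x i<..x (Suc i)} s) = 0" if "s \<in> {x m<..x (Suc m)}"
    proof (rule sum.neutral, safe)
      fix i assume "i < m"
      then have "x (Suc i) \<le> x m"
        using Suc.prems by (intro simple_integrand_mono[OF assms]) auto
      then show "\<xi> i \<omega> * indicator {x i<..x (Suc i)} s = 0" using that by auto
    qed
    then show ?case
      using Suc by (cases "s \<in> {x m<..x (Suc m)}") (auto simp: power2_eq_square)
  qed simp
  then show ?thesis by (simp add: simple_process_def)
qed

lemma nn_integral_simple_process_square:
  assumes simple: "simple_integrand \<Omega> F a b n x \<xi>"
  shows "(energy a b (\<lambda>s. simple_process n x \<xi> s \<omega>)) =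
    ennreal (\<Sum>i<n. (\<xi> i \<omega>)\<^sup>2 * (x (Suc i) - x i))"
proof -
  have x: "x i \<le> x (Suc i)" "{x i<..x (Suc i)} \<subseteq> {a..b}" if "i < n" for i
  proof -
    have "x i \<in> {a..b}" "x (Suc i) \<in> {a..b}" "x i < x (Suc i)"
      using simple_integrandD[OF simple, of i] simple_integrandD[OF simple, of "Suc i"] that by auto
    then show "x i \<le> x (Suc i)" "{x i<..x (Suc i)} \<subseteq> {a..b}" by auto
  qed
  have "(energy a b (\<lambda>s. simple_process n x \<xi> s \<omega>)) =
    (\<integral>\<^sup>+s. (\<Sum>i<n. ennreal ((\<xi> i \<omega>)\<^sup>2) * indicator {x i<..x (Suc i)} s) \<partial>lborel)"
  proof (rule nn_integral_cong)
    fix s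
    have "ennreal (\<Sum>i<n. (\<xi> i \<omega>)\<^sup>2 * indicator {x i<..x (Suc i)} s) =
      (\<Sum>i<n. ennreal ((\<xi> i \<omega>)\<^sup>2) * indicator {x i<..x (Suc i)} s)"
    proof -
      have "ennreal ((\<xi> i \<omega>)\<^sup>2 * indicator {x i<..x (Suc i)} s) = ennreal ((\<xi> i \<omega>)\<^sup>2) * indicator {x i<..x (Suc i)} s" for i
        by (cases "s \<in> {x i<..x (Suc i)}") auto
      then show ?thesis by (subst sum_ennreal[symmetric]) simp_all
    qed
    moreover have "(\<Sum>i<n. ennreal ((\<xi> i \<omega>)\<^sup>2) * indicator {x i<..x (Suc i)} s) * indicator {a..b} s =
      (\<Sum>i<n. ennreal ((\<xi> i \<omega>)\<^sup>2) * indicator {x i<..x (Suc i)} s)"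
      unfolding sum_distrib_right
      by (intro sum.cong refl) (use x(2) in \<open>auto simp: indicator_def subset_iff\<close>)
    ultimately show "ennreal ((simple_process n x \<xi> s \<omega>)\<^sup>2) * indicator {a..b} s =
      (\<Sum>i<n. ennreal ((\<xi> i \<omega>)\<^sup>2) * indicator {x i<..x (Suc i)} s)"
      by (simp add: simple_process_square[OF simple])
  qed
  also have "\<dots> = (\<Sum>i<n. ennreal ((\<xi> i \<omega>)\<^sup>2) * ennreal (x (Suc i) - x i))"
    using x by (subst nn_integral_sum) (auto simp: nn_integral_cmult_indicator)
  also have "\<dots> = ennreal (\<Sum>i<n. (\<xi> i \<omega>)\<^sup>2 * (x (Suc i) - x i))"
    using x by (subst sum_ennreal[symmetric]) (auto simp: ennreal_mult' intro!: sum.cong)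
  finally show ?thesis .
qed

context brownian_basis
begin

text \<open>The coefficient \<open>\<xi> i\<close> is known at time \<open>x i\<close>, hence so is the sum of squares up to and including the
interval on which \<open>\<xi> i\<close> acts.  Coefficients that would push this sum beyond \<open>R\<close> can therefore be set to
zero in advance; the integral is unchanged on the event that the whole sum is at most \<open>R\<close>.\<close>

lemma truncated_simple_isometry:
  assumes simple: "simple_integrand \<Omega> F a b n x \<xi>" and ab: "0 \<le> a" "b \<le> T" and R: "0 \<le> R"
  defines "A \<equiv> \<lambda>\<omega>. \<Sum>i<n. (\<xi> i \<omega>)\<^sup>2 * (x (Suc i) - x i)"
  shows "(\<EE> \<omega>. indicator {\<omega>. A \<omega> \<le> R} \<omega> * ennreal ((simple_integral W n x \<xi> b \<omega>)\<^sup>2))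
    \<le> (\<EE> \<omega>. ennreal (min R (A \<omega>)))"
proof -
  have x: "0 \<le> x i" "x i \<le> T" if "i \<le> n" for i
    using simple_integrandD(1,2)[OF simple that] ab by auto
  have inc: "x i \<le> x (Suc i)" if "i < n" for i
    using simple_integrandD(3)[OF simple that] by simp
  define B where "B m \<omega> = (\<Sum>k<m. (\<xi> k \<omega>)\<^sup>2 * (x (Suc k) - x k))" for m \<omega>
  define \<xi>' where "\<xi>' i \<omega> = (if B (Suc i) \<omega> \<le> R then \<xi> i \<omega> else 0)" for i \<omega>
  have meas: "\<xi> i \<in> borel_measurable (F (x i))" if "i < n" for i
    using simple_integrandD(4)[OF simple that] .
  have meas': "\<xi>' i \<in> borel_measurable (F (x i))" if "i < n" for i
  proof -
    have [measurable]: "\<xi> k \<in> borel_measurable (F (x i))" if "k \<le> i" for k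
      using \<open>i < n\<close> that x[of k] x[of i] meas[of k] simple_integrand_mono[OF simple, of k i]
      by (auto intro: measurable_F_mono)
    have "B (Suc i) \<in> borel_measurable (F (x i))"
      unfolding B_def by (intro borel_measurable_sum) auto
    moreover have "\<xi> i \<in> borel_measurable (F (x i))" using that meas by simp
    ultimately show ?thesis unfolding \<xi>'_def by measurable
  qed
  have simple': "simple_integrand \<Omega> F a b n x \<xi>'"
    using simple unfolding simple_integrand_def
  proof safe
    fix i assume "i < n" then show "\<xi>' i \<in> borel_measurable (F (x i))" by (rule meas')
  next
    fix i assume i: "i < n"
      and "\<forall>i<n. \<xi> i \<in> borel_measurable (F (x i)) \<and> (\<exists>C. \<forall>\<omega>\<in>space \<Omega>. \<bar>\<xi> i \<omega>\<bar> \<le> C)"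
    then obtain C where C: "\<forall>\<omega>\<in>space \<Omega>. \<bar>\<xi> i \<omega>\<bar> \<le> C" by auto
    then have "\<forall>\<omega>\<in>space \<Omega>. \<bar>\<xi>' i \<omega>\<bar> \<le> C" by (auto simp: \<xi>'_def dest: order_trans[OF abs_ge_zero])
    then show "\<exists>C. \<forall>\<omega>\<in>space \<Omega>. \<bar>\<xi>' i \<omega>\<bar> \<le> C" ..
  qed
  define S where "S \<omega> = (\<Sum>i<n. \<xi>' i \<omega> * (W (x (Suc i)) \<omega> - W (x i) \<omega>))" for \<omega>
  define A' where "A' \<omega> = (\<Sum>i<n. (\<xi>' i \<omega>)\<^sup>2 * (x (Suc i) - x i))" for \<omega>
  note iso = simple_isometry[OF simple' ab order_refl]
  have B_mono: "B i \<omega> \<le> B j \<omega>" if "i \<le> j" "j \<le> n" for i j \<omega>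
    unfolding B_def using that inc by (intro sum_mono2) auto
  have A'_le: "A' \<omega> \<le> min R (A \<omega>)" for \<omega>
  proof -
    have "(\<Sum>i<m. (\<xi>' i \<omega>)\<^sup>2 * (x (Suc i) - x i)) \<le> min R (B m \<omega>)" if "m \<le> n" for m
      using that
    proof (induction m)
      case (Suc m)
      have "B m \<omega> \<le> B (Suc m) \<omega>" using Suc.prems by (intro B_mono) auto
      moreover have "B (Suc m) \<omega> = B m \<omega> + (\<xi> m \<omega>)\<^sup>2 * (x (Suc m) - x m)" by (simp add: B_def)
      ultimately show ?case using Suc by (auto simp: \<xi>'_def min_def split: if_splits)
    qed (use R in \<open>simp add: B_def\<close>)
    then show ?thesis by (simp add: A'_def A_def B_def)
  qed
  have A'_nonneg: "0 \<le> A' \<omega>" for \<omega>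
    unfolding A'_def using inc by (intro sum_nonneg mult_nonneg_nonneg) auto
  have [measurable]: "A' \<in> borel_measurable \<Omega>"
    unfolding A'_def using measurable_F[OF meas'] x
    by (intro borel_measurable_sum borel_measurable_times borel_measurable_power) auto
  have intA': "integrable \<Omega> A'"
    using A'_le A'_nonneg by (intro integrable_const_bound[of _ R]) (auto intro!: AE_I2)
  have eqS: "simple_integral W n x \<xi> b \<omega> = S \<omega>" if "A \<omega> \<le> R" for \<omega>
  proof -
    have "\<xi>' i \<omega> = \<xi> i \<omega>" if "i < n" for i
      using that \<open>A \<omega> \<le> R\<close> B_mono[of "Suc i" n \<omega>] by (auto simp: \<xi>'_def A_def B_def)
    then show ?thesis by (simp add: simple_integral_as_step_sum[OF simple] S_def)
  qed
  have "(\<EE> \<omega>. indicator {\<omega>. A \<omega> \<le> R} \<omega> * ennreal ((simple_integral W n x \<xi> b \<omega>)\<^sup>2))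
    \<le> (\<EE> \<omega>. ennreal ((S \<omega>)\<^sup>2))"
    by (intro nn_integral_mono) (auto simp: indicator_def eqS)
  also have "\<dots> = ennreal (expectation (\<lambda>\<omega>. (S \<omega>)\<^sup>2))"
    using iso(2) by (intro nn_integral_eq_integral) (auto simp: S_def)
  also have "\<dots> = ennreal (expectation A')"
    using iso(3) by (simp add: S_def[abs_def] A'_def[abs_def])
  also have "\<dots> = (\<EE> \<omega>. ennreal (A' \<omega>))"
    using intA' A'_nonneg by (intro nn_integral_eq_integral[symmetric]) auto
  also have "\<dots> \<le> (\<EE> \<omega>. ennreal (min R (A \<omega>)))"
    by (intro nn_integral_mono ennreal_leI A'_le)
  finally show ?thesis .
qed

text \<open>A list of weighted intervals is rewritten over the partition formed by all end points.  The function
\<open>\<phi>\<close> lets one telescoping argument serve both the process (\<open>\<phi> = indicator {s..}\<close>) and its integral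
(\<open>\<phi> = W\<close> along a path).\<close>

lemma steps_on_common_grid:
  assumes "a \<le> b"
    and "\<And>y z \<xi>. (y, z, \<xi>) \<in> set l \<Longrightarrow> a \<le> y \<and> y \<le> z \<and> z \<le> b \<and>
      (y < z \<longrightarrow> \<xi> \<in> borel_measurable (F y) \<and> (\<exists>C. \<forall>\<omega>\<in>space \<Omega>. \<bar>\<xi> \<omega>\<bar> \<le> C))"
    and ab: "0 \<le> a" "b \<le> T"
  shows "\<exists>n x c. simple_integrand \<Omega> F a b n x c \<and>
    (\<forall>(\<phi> :: real \<Rightarrow> real) \<omega>. (\<Sum>i<n. c i \<omega> * (\<phi> (x (Suc i)) - \<phi> (x i))) =
      (\<Sum>(y, z, \<xi>)\<leftarrow>l. \<xi> \<omega> * (\<phi> z - \<phi> y)))"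
proof -
  define G where "G = insert a (fst ` set l \<union> (fst \<circ> snd) ` set l)"
  have fin: "finite G" by (simp add: G_def)
  have G_ab: "G \<subseteq> {a..b}" using assms(2) \<open>a \<le> b\<close> by (force simp: G_def)
  define xs where "xs = sorted_list_of_set G"
  have set_xs: "set xs = G" and sorted: "sorted_wrt (<) xs" and len: "length xs = card G"
    using fin by (auto simp: xs_def)
  define n where "n = card G - 1"
  have cardG: "card G = Suc n" unfolding n_def using fin by (simp add: G_def card_gt_0_iff)
  define x where "x i = xs ! i" for i
  have less: "x i < x j \<longleftrightarrow> i < j" if "i \<le> n" "j \<le> n" for i j
    using sorted_wrt_nth_less[OF sorted, of i j] sorted_wrt_nth_less[OF sorted, of j i] that len cardG
    by (cases i j rule: linorder_cases) (auto simp: x_def)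
  have xG: "x i \<in> G" if "i \<le> n" for i
    using that len cardG set_xs by (auto simp: x_def)
  have Gx: "\<exists>i\<le>n. y = x i" if "y \<in> G" for y
    using that set_xs len cardG unfolding x_def by (metis in_set_conv_nth less_Suc_eq_le)
  define c where "c i \<omega> = (\<Sum>(y, z, \<xi>)\<leftarrow>l. if y \<le> x i \<and> x (Suc i) \<le> z then \<xi> \<omega> else 0)" for i and \<omega> :: 'a
  have telescope: "(\<Sum>i<n. (if y \<le> x i \<and> x (Suc i) \<le> z then v else 0) * (\<phi> (x (Suc i)) - \<phi> (x i)))
      = v * (\<phi> z - \<phi> y)" if "y \<in> G" "z \<in> G" "y \<le> z" for y z v and \<phi> :: "real \<Rightarrow> real"
  proof -
    obtain p q where pq: "p \<le> n" "q \<le> n" "y = x p" "z = x q"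
      using Gx[OF \<open>y \<in> G\<close>] Gx[OF \<open>z \<in> G\<close>] by blast
    then have "p \<le> q" using that less[of q p] by auto
    have cond: "y \<le> x i \<and> x (Suc i) \<le> z \<longleftrightarrow> i \<in> {p..<q}" if "i < n" for i
      using less[of i p] less[of q "Suc i"] that pq by (auto simp: not_less[symmetric])
    have "(\<Sum>i<n. (if y \<le> x i \<and> x (Suc i) \<le> z then v else 0) * (\<phi> (x (Suc i)) - \<phi> (x i)))
      = (\<Sum>i<n. if i \<in> {p..<q} then v * (\<phi> (x (Suc i)) - \<phi> (x i)) else 0)"
      using cond by (intro sum.cong) auto
    also have "\<dots> = (\<Sum>i\<in>{p..<q}. v * (\<phi> (x (Suc i)) - \<phi> (x i)))"
      using pq by (subst sum.inter_restrict[symmetric]) (auto intro!: sum.cong)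
    also have "\<dots> = v * (\<phi> (x q) - \<phi> (x p))"
      using sum_Suc_diff'[OF \<open>p \<le> q\<close>, of "\<lambda>i. \<phi> (x i)"] by (simp add: sum_distrib_left[symmetric])
    finally show ?thesis using pq by simp
  qed
  have "(\<Sum>i<n. c i \<omega> * (\<phi> (x (Suc i)) - \<phi> (x i))) = (\<Sum>(y, z, \<xi>)\<leftarrow>l. \<xi> \<omega> * (\<phi> z - \<phi> y))" for \<phi> :: "real \<Rightarrow> real" and \<omega>
  proof -
    have "(\<Sum>i<n. (\<Sum>(y, z, \<xi>)\<leftarrow>l'. if y \<le> x i \<and> x (Suc i) \<le> z then \<xi> \<omega> else 0) * (\<phi> (x (Suc i)) - \<phi> (x i)))
      = (\<Sum>(y, z, \<xi>)\<leftarrow>l'. \<xi> \<omega> * (\<phi> z - \<phi> y))" if "set l' \<subseteq> set l" for l'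
      using that
    proof (induction l')
      case (Cons s l')
      obtain y z \<xi> where s: "s = (y, z, \<xi>)" by (cases s)
      then have "(y, z, \<xi>) \<in> set l" using Cons.prems by auto
      then have "y \<in> fst ` set l" "z \<in> (fst \<circ> snd) ` set l" by (auto simp: rev_image_eqI)
      then have yz: "y \<in> G" "z \<in> G" "y \<le> z"
        using assms(2)[OF \<open>(y, z, \<xi>) \<in> set l\<close>] by (auto simp: G_def)
      show ?case
        using Cons telescope[OF yz, of "\<xi> \<omega>" \<phi>] by (simp add: s distrib_right sum.distrib)
    qed simp
    then show ?thesis by (simp add: c_def)
  qed
  moreover have "simple_integrand \<Omega> F a b n x c"
    unfolding simple_integrand_def
  proof (intro conjI allI impI)
    fix i assume "i \<le> n" then show "x i \<in> {a..b}" by (rule subsetD[OF G_ab xG])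
  next
    fix i assume "i < n" then show "x i < x (Suc i)" using less by simp
  next
    fix i assume i: "i < n"
    have "x i \<in> {a..b}" using i by (intro subsetD[OF G_ab xG]) simp
    then have xi: "0 \<le> x i" "x i \<le> T" "x i < x (Suc i)" using less[of i "Suc i"] i ab by auto
    have "(\<lambda>\<omega>. \<Sum>(y, z, \<xi>)\<leftarrow>l'. if y \<le> x i \<and> x (Suc i) \<le> z then \<xi> \<omega> else 0) \<in> borel_measurable (F (x i)) \<and>
       (\<exists>C. \<forall>\<omega>\<in>space \<Omega>. \<bar>\<Sum>(y, z, \<xi>)\<leftarrow>l'. if y \<le> x i \<and> x (Suc i) \<le> z then \<xi> \<omega> else 0\<bar> \<le> C)"
      if "set l' \<subseteq> set l" for l'
      using that
    proof (induction l')
      case (Cons s l')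
      obtain y z \<xi> where s: "s = (y, z, \<xi>)" by (cases s)
      then have *: "a \<le> y \<and> y \<le> z \<and> z \<le> b \<and>
        (y < z \<longrightarrow> \<xi> \<in> borel_measurable (F y) \<and> (\<exists>C. \<forall>\<omega>\<in>space \<Omega>. \<bar>\<xi> \<omega>\<bar> \<le> C))"
        using assms(2) Cons.prems by auto
      have IH: "(\<lambda>\<omega>. \<Sum>(y, z, \<xi>)\<leftarrow>l'. if y \<le> x i \<and> x (Suc i) \<le> z then \<xi> \<omega> else 0) \<in> borel_measurable (F (x i))"
       "\<exists>C. \<forall>\<omega>\<in>space \<Omega>. \<bar>\<Sum>(y, z, \<xi>)\<leftarrow>l'. if y \<le> x i \<and> x (Suc i) \<le> z then \<xi> \<omega> else 0\<bar> \<le> C"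
        using Cons by auto
      show ?case
      proof (cases "y \<le> x i \<and> x (Suc i) \<le> z")
        case True
        then have "y < z" using xi by auto
        then obtain C where C: "\<forall>\<omega>\<in>space \<Omega>. \<bar>\<xi> \<omega>\<bar> \<le> C" and "\<xi> \<in> borel_measurable (F y)" using * by auto
        then have "\<xi> \<in> borel_measurable (F (x i))"
          using measurable_F_mono[of \<xi> y "x i"] True xi * ab by auto
        moreover obtain C' where C': "\<forall>\<omega>\<in>space \<Omega>. \<bar>\<Sum>(y, z, \<xi>)\<leftarrow>l'. if y \<le> x i \<and> x (Suc i) \<le> z then \<xi> \<omega> else 0\<bar> \<le> C'"
          using IH(2) by auto
        have "\<forall>\<omega>\<in>space \<Omega>. \<bar>\<xi> \<omega> + (\<Sum>(y, z, \<xi>)\<leftarrow>l'. if y \<le> x i \<and> x (Suc i) \<le> z then \<xi> \<omega> else 0)\<bar> \<le> C + C'"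
        proof
          fix \<omega> assume "\<omega> \<in> space \<Omega>"
          then show "\<bar>\<xi> \<omega> + (\<Sum>(y, z, \<xi>)\<leftarrow>l'. if y \<le> x i \<and> x (Suc i) \<le> z then \<xi> \<omega> else 0)\<bar> \<le> C + C'"
            using C C' by (intro order_trans[OF abs_triangle_ineq] add_mono) auto
        qed
        ultimately show ?thesis using IH(1) True by (auto simp: s)
      qed (use IH s in auto)
    qed auto
    then show "c i \<in> borel_measurable (F (x i))" "\<exists>C. \<forall>\<omega>\<in>space \<Omega>. \<bar>c i \<omega>\<bar> \<le> C"
      by (auto simp: c_def[abs_def])
  qed
  ultimately show ?thesis by blast
qed

end

section \<open>Stochastic integrals as limits in probability\<close>

lemma ennreal_min: "0 \<le> x \<Longrightarrow> 0 \<le> y \<Longrightarrow> ennreal (min x y) = min (ennreal x) (ennreal y)"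
  by (auto simp: min_def ennreal_le_iff)

lemma ennreal_tendsto_0I:
  fixes f :: "nat \<Rightarrow> ennreal"
  assumes "\<And>\<epsilon>. 0 < \<epsilon> \<Longrightarrow> \<forall>\<^sub>F k in sequentially. f k \<le> ennreal \<epsilon>"
  shows "f \<longlonglongrightarrow> 0"
proof (rule order_tendstoI)
  fix a :: ennreal assume "0 < a"
  then obtain c where c: "0 < c" "c < a" using dense by blast
  then obtain \<epsilon> where \<epsilon>: "c = ennreal \<epsilon>" "0 < \<epsilon>" by (cases c) auto
  show "\<forall>\<^sub>F k in sequentially. f k < a"
    using assms[OF \<epsilon>(2)] c \<epsilon> by (auto elim!: eventually_mono)
qed auto

lemma ennreal_tendsto_0_cancel_min:
  fixes f :: "nat \<Rightarrow> ennreal"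
  assumes "(\<lambda>k. min 1 (f k)) \<longlonglongrightarrow> 0"
  shows "f \<longlonglongrightarrow> 0"
proof (rule order_tendstoI)
  fix a :: ennreal assume "0 < a"
  then have "\<forall>\<^sub>F k in sequentially. min 1 (f k) < min 1 a"
    by (intro order_tendstoD(2)[OF assms]) auto
  then show "\<forall>\<^sub>F k in sequentially. f k < a"
    by eventually_elim (auto simp: min_def split: if_splits)
qed auto

text \<open>Bounds on the events \<open>q \<le> N\<close> that do not depend on \<open>N\<close> extend to the whole space as soon as \<open>q\<close> is almost
surely finite.  All localisations below are removed in this way.\<close>

lemma nn_integral_le_by_exhaustion:
  fixes q f :: "'a \<Rightarrow> ennreal"
  assumes [measurable]: "q \<in> borel_measurable M" "f \<in> borel_measurable M"
    and fin: "AE \<omega> in M. q \<omega> < \<infinity>"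
    and le: "\<And>N :: nat. (\<integral>\<^sup>+\<omega>. indicator {\<omega>. q \<omega> \<le> of_nat N} \<omega> * f \<omega> \<partial>M) \<le> C"
  shows "(\<integral>\<^sup>+\<omega>. f \<omega> \<partial>M) \<le> C"
proof -
  have "(\<integral>\<^sup>+\<omega>. f \<omega> \<partial>M) \<le> (\<integral>\<^sup>+\<omega>. liminf (\<lambda>N. indicator {\<omega>. q \<omega> \<le> of_nat N} \<omega> * f \<omega>) \<partial>M)"
  proof (rule nn_integral_mono_AE, use fin in eventually_elim)
    fix \<omega> assume "q \<omega> < \<infinity>"
    then obtain N0 :: nat where "q \<omega> < of_nat N0" using ennreal_Ex_less_of_nat by auto
    then have "\<forall>\<^sub>F N in sequentially. f \<omega> = indicator {\<omega>. q \<omega> \<le> of_nat N} \<omega> * f \<omega>"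
      by (intro eventually_sequentiallyI[of N0])
        (auto simp: indicator_def intro: order_trans[OF less_imp_le])
    then have "(\<lambda>N. indicator {\<omega>. q \<omega> \<le> of_nat N} \<omega> * f \<omega>) \<longlonglongrightarrow> f \<omega>"
      by (rule Lim_transform_eventually[OF tendsto_const])
    then show "f \<omega> \<le> liminf (\<lambda>N. indicator {\<omega>. q \<omega> \<le> of_nat N} \<omega> * f \<omega>)"
      by (simp add: lim_imp_Liminf)
  qed
  also have "\<dots> \<le> liminf (\<lambda>N. \<integral>\<^sup>+\<omega>. indicator {\<omega>. q \<omega> \<le> of_nat N} \<omega> * f \<omega> \<partial>M)"
    by (rule nn_integral_liminf) measurable
  also have "\<dots> \<le> liminf (\<lambda>N. C)"
    by (intro Liminf_mono) (simp add: le)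
  finally show ?thesis by (simp add: Liminf_const)
qed

text \<open>Projection of the time axis onto \<open>[a, b]\<close>.  Processes given on \<open>[a, b]\<close> are extended by their boundary
values, so that joint measurability can be stated on the whole line.\<close>

definition clamp_to :: "real \<Rightarrow> real \<Rightarrow> real \<Rightarrow> real" where
  "clamp_to a b s = max a (min b s)"

lemma clamp_to_id [simp]: "s \<in> {a..b} \<Longrightarrow> clamp_to a b s = s"
  by (auto simp: clamp_to_def)

lemma clamp_to_mem [simp]: "a \<le> b \<Longrightarrow> a \<le> clamp_to a b s \<and> clamp_to a b s \<le> b"
  by (auto simp: clamp_to_def)

lemma clamp_to_mono: "s \<le> s' \<Longrightarrow> clamp_to a b s \<le> clamp_to a b s'"
  by (auto simp: clamp_to_def)

lemma clamp_to_less_imp_le: "clamp_to a b s < clamp_to a b s' \<Longrightarrow> s \<le> clamp_to a b s"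
  by (auto simp: clamp_to_def max_def min_def split: if_splits)

context brownian_basis
begin

lemma progressive_clamp_measurable_at:
  assumes "progressive F t T X" "s \<in> {t..T}"
  shows "(\<lambda>(r, \<omega>). X (clamp_to t s r) \<omega>) \<in> borel_measurable (borel \<Otimes>\<^sub>M F s)"
proof -
  have X: "(\<lambda>(\<tau>, \<omega>). X \<tau> \<omega>) \<in> borel_measurable (restrict_space borel {t..s} \<Otimes>\<^sub>M F s)"
    using assms by (auto simp: progressive_def)
  have "(\<lambda>r. clamp_to t s r) \<in> borel \<rightarrow>\<^sub>M restrict_space borel {t..s}"
    using assms(2) by (intro measurable_restrict_space2) (auto simp: clamp_to_def)
  then have "(\<lambda>z. (clamp_to t s (fst z), snd z)) \<in> (borel \<Otimes>\<^sub>M F s) \<rightarrow>\<^sub>M (restrict_space borel {t..s} \<Otimes>\<^sub>M F s)"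
    by measurable
  from measurable_compose[OF this X] show ?thesis by (simp add: case_prod_beta')
qed

lemma progressive_clamp_measurable:
  assumes "progressive F t T X" "t \<le> T"
  shows "jointly_measurable (\<lambda>s \<omega>. X (clamp_to t T s) \<omega>)"
proof -
  have *: "sets (borel \<Otimes>\<^sub>M \<Omega> :: (real \<times> 'a) measure) = sets (borel \<Otimes>\<^sub>M F T)"
    by (intro sets_pair_measure_cong) (auto simp: sets_F_T)
  show ?thesis
    unfolding measurable_cong_sets[OF * refl]
    using progressive_clamp_measurable_at[OF assms(1), of T] assms(2) by simp
qed

lemma simple_process_measurable:
  assumes "simple_integrand \<Omega> F a b n x \<xi>" "0 \<le> a" "b \<le> T"
  shows "jointly_measurable (\<lambda>s \<omega>. simple_process n x \<xi> s \<omega>)"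
proof -
  have [measurable]: "\<xi> i \<in> borel_measurable \<Omega>" if "i < n" for i
    using simple_integrandD[OF assms(1), of i] that assms by (auto intro!: measurable_F[of _ "x i"])
  show ?thesis
    unfolding simple_process_def case_prod_beta' by (intro borel_measurable_sum) (simp, measurable)
qed

lemma simple_integral_measurable:
  assumes "simple_integrand \<Omega> F a b n x \<xi>" "0 \<le> a" "s \<in> {a..b}" "b \<le> T"
  shows "simple_integral W n x \<xi> s \<in> borel_measurable \<Omega>"
proof -
  have *[measurable]: "\<xi> i \<in> borel_measurable \<Omega>" if "i < n" for i
    using simple_integrandD[OF assms(1), of i] that assms by (auto intro!: measurable_F[of _ "x i"])
  have [measurable]: "W (min s (x i)) \<in> borel_measurable \<Omega>" if "i \<le> n" for i
    using simple_integrandD[OF assms(1), of i] that assms by (auto intro!: measurable_W)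
  have "(\<lambda>\<omega>. simple_integral W n x \<xi> s \<omega>) \<in> borel_measurable \<Omega>"
    unfolding simple_integral_def by (intro borel_measurable_sum) (simp, measurable)
  then show ?thesis by simp
qed

text \<open>\<open>D\<close> is the Ito integral of \<open>H\<close> over \<open>[a, b]\<close>, at the single time \<open>b\<close>.  Convergence in probability is
expressed by the expectation of the truncated distance, which is subadditive, so that differences
can be treated termwise, and lets almost surely convergent subsequences be extracted from convergence in \<open>L\<^sup>1\<close>.\<close>

definition ito_limit :: "real \<Rightarrow> real \<Rightarrow> (real \<Rightarrow> 'a \<Rightarrow> real) \<Rightarrow> ('a \<Rightarrow> real) \<Rightarrow> bool" where
  "ito_limit a b H D \<longleftrightarrow>
     jointly_measurable H \<and> D \<in> borel_measurable \<Omega> \<and>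
     (AE \<omega> in \<Omega>. (energy a b (\<lambda>s. H s \<omega>)) < \<infinity>) \<and>
     (\<exists>n x \<xi>. (\<forall>k. simple_integrand \<Omega> F a b (n k) (x k) (\<xi> k)) \<and>
       (\<lambda>k. \<EE> \<omega>. min 1 (energy a b (\<lambda>s. simple_process (n k) (x k) (\<xi> k) s \<omega> - H s \<omega>)))
         \<longlonglongrightarrow> 0 \<and>
       (\<lambda>k. \<EE> \<omega>. min 1 (ennreal \<bar>simple_integral W (n k) (x k) (\<xi> k) b \<omega> - D \<omega>\<bar>)) \<longlonglongrightarrow> 0)"

lemma tendsto_in_probability_imp_nn_integral_min:
  assumes "tendsto_in_probability \<Omega> X Y"
    and [measurable]: "\<And>k. X k \<in> borel_measurable \<Omega>" "Y \<in> borel_measurable \<Omega>"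
  shows "(\<lambda>k. \<EE> \<omega>. min 1 (ennreal \<bar>X k \<omega> - Y \<omega>\<bar>)) \<longlonglongrightarrow> 0"
proof (rule ennreal_tendsto_0I)
  fix \<epsilon> :: real assume \<epsilon>: "0 < \<epsilon>"
  have "(\<lambda>k. prob {\<omega>\<in>space \<Omega>. \<epsilon>/2 < \<bar>X k \<omega> - Y \<omega>\<bar>}) \<longlonglongrightarrow> 0"
    using assms(1)[unfolded tendsto_in_probability_def, rule_format, OF half_gt_zero[OF \<epsilon>]] .
  then have "\<forall>\<^sub>F k in sequentially. prob {\<omega>\<in>space \<Omega>. \<epsilon>/2 < \<bar>X k \<omega> - Y \<omega>\<bar>} < \<epsilon>/2"
    by (rule order_tendstoD(2)) (use \<epsilon> in simp)
  then show "\<forall>\<^sub>F k in sequentially. (\<EE> \<omega>. min 1 (ennreal \<bar>X k \<omega> - Y \<omega>\<bar>)) \<le> ennreal \<epsilon>"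
  proof eventually_elim
    fix k assume k: "prob {\<omega>\<in>space \<Omega>. \<epsilon>/2 < \<bar>X k \<omega> - Y \<omega>\<bar>} < \<epsilon>/2"
    have "(\<EE> \<omega>. min 1 (ennreal \<bar>X k \<omega> - Y \<omega>\<bar>))
      \<le> (\<EE> \<omega>. ennreal (\<epsilon>/2) + indicator {\<omega>\<in>space \<Omega>. \<epsilon>/2 < \<bar>X k \<omega> - Y \<omega>\<bar>} \<omega>)"
    proof (rule nn_integral_mono)
      fix \<omega> assume "\<omega> \<in> space \<Omega>"
      then show "min 1 (ennreal \<bar>X k \<omega> - Y \<omega>\<bar>) \<le> ennreal (\<epsilon>/2) + indicator {\<omega>\<in>space \<Omega>. \<epsilon>/2 < \<bar>X k \<omega> - Y \<omega>\<bar>} \<omega>"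
      proof (cases "\<epsilon>/2 < \<bar>X k \<omega> - Y \<omega>\<bar>")
        case True
        then show ?thesis using \<open>\<omega> \<in> space \<Omega>\<close> by (intro min.coboundedI1) (simp add: add_increasing)
      next
        case False
        then show ?thesis by (intro min.coboundedI2) (auto simp: not_less intro!: ennreal_leI)
      qed
    qed
    also have "\<dots> = ennreal (\<epsilon>/2) + emeasure \<Omega> {\<omega>\<in>space \<Omega>. \<epsilon>/2 < \<bar>X k \<omega> - Y \<omega>\<bar>}"
      by (subst nn_integral_add) (auto simp: emeasure_space_1)
    also have "\<dots> \<le> ennreal (\<epsilon>/2) + ennreal (\<epsilon>/2)"
      using k by (intro add_mono) (auto simp: emeasure_eq_measure intro!: ennreal_leI)
    also have "\<dots> = ennreal \<epsilon>"
      using \<epsilon> by (simp flip: ennreal_plus)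
    finally show "(\<EE> \<omega>. min 1 (ennreal \<bar>X k \<omega> - Y \<omega>\<bar>)) \<le> ennreal \<epsilon>" .
  qed
qed

end

lemma square_diff_le: "((x::real) - y)\<^sup>2 \<le> 2 * x\<^sup>2 + 2 * y\<^sup>2"
  using sum_squares_ge_zero[of "x + y" 0] by (simp add: power2_eq_square algebra_simps)

lemma square_sum_le: "((x::real) + y)\<^sup>2 \<le> 2 * x\<^sup>2 + 2 * y\<^sup>2"
  using square_diff_le[of x "- y"] by simp

lemma square_sum3_le: "((x::real) + y + z)\<^sup>2 \<le> 3 * x\<^sup>2 + 3 * y\<^sup>2 + 3 * z\<^sup>2"
  using sum_squares_ge_zero[of "x - y" "y - z"] sum_squares_ge_zero[of "x - z" 0]
  by (simp add: power2_eq_square algebra_simps)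

lemma square_le_weighted:
  fixes x y \<eta> :: real
  assumes "0 < \<eta>"
  shows "x\<^sup>2 \<le> (1 + \<eta>) * y\<^sup>2 + (1 + 1 / \<eta>) * (x - y)\<^sup>2"
proof -
  have "0 \<le> (\<eta> * y - (x - y))\<^sup>2 / \<eta>" using assms by simp
  also have "\<dots> = (1 + \<eta>) * y\<^sup>2 + (1 + 1 / \<eta>) * (x - y)\<^sup>2 - x\<^sup>2"
    using assms by (simp add: field_simps power2_eq_square)
  finally show ?thesis by simp
qed

lemma ennreal_le_double_sum:
  assumes "z \<le> 2 * x + 2 * y" "0 \<le> x" "0 \<le> y"
  shows "ennreal z \<le> 2 * ennreal x + 2 * ennreal y"
proof -
  have "ennreal z \<le> ennreal (2 * x + 2 * y)" using assms(1) by (rule ennreal_leI)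
  also have "\<dots> = 2 * ennreal x + 2 * ennreal y" using assms(2,3) by (simp add: ennreal_mult)
  finally show ?thesis .
qed

lemma abs_diff_diff_le: "\<bar>p - p' - (d - d')\<bar> \<le> 2 * \<bar>p - d\<bar> + 2 * \<bar>p' - d'\<bar>" for p p' d d' :: real
  by (auto simp: abs_if)

lemma nn_integral_square_diff_le:
  fixes f g :: "real \<Rightarrow> real"
  assumes [measurable]: "f \<in> borel_measurable borel" "g \<in> borel_measurable borel"
  shows "(energy a b (\<lambda>s. f s - g s)) \<le>
    2 * (energy a b f) + 2 * (energy a b g)"
proof -
  have "(energy a b (\<lambda>s. f s - g s))
    \<le> (\<integral>\<^sup>+s. 2 * (ennreal ((f s)\<^sup>2) * indicator {a..b} s) + 2 * (ennreal ((g s)\<^sup>2) * indicator {a..b} s) \<partial>lborel)"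
    using square_diff_le by (intro nn_integral_mono) (auto simp: indicator_def intro!: ennreal_le_double_sum)
  also have "\<dots> = 2 * (energy a b f) + 2 * (energy a b g)"
    by (subst nn_integral_add) (auto simp: nn_integral_cmult)
  finally show ?thesis .
qed

lemma ennreal_min_1_le_double_sum:
  fixes x y z :: ennreal
  assumes "z \<le> 2 * x + 2 * y"
  shows "min 1 z \<le> 2 * min 1 x + 2 * min 1 y"
proof -
  have "min 1 z \<le> min 1 (2 * x + 2 * y)" using assms by (intro min.mono) auto
  also have "\<dots> \<le> 2 * min 1 x + 2 * min 1 y"
  proof (cases "x \<le> 1 \<and> y \<le> 1")
    case False
    then have "1 \<le> 2 * min 1 x + 2 * min 1 y"
      by (auto simp: min_def not_le intro: order_trans[of _ 2] add_increasing add_increasing2)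
    then show ?thesis by (auto simp: min_def intro: order_trans)
  qed (auto simp: min_def)
  finally show ?thesis .
qed

lemma nn_integral_min_1_le_double_sum:
  assumes [measurable]: "p \<in> borel_measurable M" "p' \<in> borel_measurable M"
    and "AE \<omega> in M. q \<omega> \<le> 2 * p \<omega> + 2 * p' \<omega>"
  shows "(\<integral>\<^sup>+\<omega>. min 1 (q \<omega>) \<partial>M) \<le> 2 * (\<integral>\<^sup>+\<omega>. min 1 (p \<omega>) \<partial>M) + 2 * (\<integral>\<^sup>+\<omega>. min 1 (p' \<omega>) \<partial>M)"
proof -
  have "(\<integral>\<^sup>+\<omega>. min 1 (q \<omega>) \<partial>M) \<le> (\<integral>\<^sup>+\<omega>. 2 * min 1 (p \<omega>) + 2 * min 1 (p' \<omega>) \<partial>M)"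
    using assms(3) by (intro nn_integral_mono_AE) (auto intro: ennreal_min_1_le_double_sum)
  also have "\<dots> = 2 * (\<integral>\<^sup>+\<omega>. min 1 (p \<omega>) \<partial>M) + 2 * (\<integral>\<^sup>+\<omega>. min 1 (p' \<omega>) \<partial>M)"
    by (subst nn_integral_add) (auto simp: nn_integral_cmult)
  finally show ?thesis .
qed

lemma tendsto_0_double_sumI:
  fixes f g h :: "nat \<Rightarrow> ennreal"
  assumes "f \<longlonglongrightarrow> 0" "g \<longlonglongrightarrow> 0" "\<And>k. h k \<le> 2 * f k + 2 * g k"
  shows "h \<longlonglongrightarrow> 0"
proof (rule tendsto_sandwich[OF _ _ tendsto_const])
  have "(\<lambda>k. 2 * f k + 2 * g k) \<longlonglongrightarrow> 2 * 0 + 2 * 0"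
    by (intro tendsto_add ennreal_tendsto_cmult assms) auto
  then show "(\<lambda>k. 2 * f k + 2 * g k) \<longlonglongrightarrow> 0" by simp
qed (use assms(3) in auto)

context brownian_basis
begin

lemma simple_diff:
  assumes s: "simple_integrand \<Omega> F a b n x \<xi>" and s': "simple_integrand \<Omega> F a b n' x' \<xi>'"
    and ab: "0 \<le> a" "b \<le> T"
  shows "\<exists>N g c. simple_integrand \<Omega> F a b N g c \<and>
    (\<forall>s \<omega>. simple_process N g c s \<omega> = simple_process n x \<xi> s \<omega> - simple_process n' x' \<xi>' s \<omega>) \<and>
    (\<forall>\<omega>. simple_integral W N g c b \<omega> = simple_integral W n x \<xi> b \<omega> - simple_integral W n' x' \<xi>' b \<omega>)"
proof -
  define l where "l = map (\<lambda>i. (x i, x (Suc i), \<xi> i)) [0..<n] @ map (\<lambda>i. (x' i, x' (Suc i), \<lambda>\<omega>. - \<xi>' i \<omega>)) [0..<n']"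
  have "a \<le> b" using simple_integrandD(1,2)[OF s, of 0] by auto
  have "\<exists>N g c. simple_integrand \<Omega> F a b N g c \<and>
    (\<forall>(\<phi> :: real \<Rightarrow> real) \<omega>. (\<Sum>i<N. c i \<omega> * (\<phi> (g (Suc i)) - \<phi> (g i))) =
      (\<Sum>(y, z, \<xi>)\<leftarrow>l. \<xi> \<omega> * (\<phi> z - \<phi> y)))"
  proof (rule steps_on_common_grid[OF \<open>a \<le> b\<close> _ ab])
    fix y z \<zeta> assume "(y, z, \<zeta>) \<in> set l"
    then consider i where "i < n" "y = x i" "z = x (Suc i)" "\<zeta> = \<xi> i"
      | i where "i < n'" "y = x' i" "z = x' (Suc i)" "\<zeta> = (\<lambda>\<omega>. - \<xi>' i \<omega>)" by (auto simp: l_def)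
    then show "a \<le> y \<and> y \<le> z \<and> z \<le> b \<and> (y < z \<longrightarrow> \<zeta> \<in> borel_measurable (F y) \<and> (\<exists>C. \<forall>\<omega>\<in>space \<Omega>. \<bar>\<zeta> \<omega>\<bar> \<le> C))"
    proof cases
      case 1
      then show ?thesis using simple_integrandD[OF s, of i] simple_integrandD(1,2)[OF s, of "Suc i"] by auto
    next
      case 2
      then show ?thesis using simple_integrandD[OF s', of i] simple_integrandD(1,2)[OF s', of "Suc i"] by auto
    qed
  qed
  then obtain N g c where simple: "simple_integrand \<Omega> F a b N g c"
    and eq: "\<And>(\<phi> :: real \<Rightarrow> real) \<omega>. (\<Sum>i<N. c i \<omega> * (\<phi> (g (Suc i)) - \<phi> (g i))) = (\<Sum>(y, z, \<xi>)\<leftarrow>l. \<xi> \<omega> * (\<phi> z - \<phi> y))"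
    by blast
  have eq': "(\<Sum>(y, z, \<xi>)\<leftarrow>l. \<xi> \<omega> * (\<phi> z - \<phi> y)) =
    (\<Sum>i<n. \<xi> i \<omega> * (\<phi> (x (Suc i)) - \<phi> (x i))) - (\<Sum>i<n'. \<xi>' i \<omega> * (\<phi> (x' (Suc i)) - \<phi> (x' i)))"
    for \<phi> :: "real \<Rightarrow> real" and \<omega>
    by (simp add: l_def comp_def interv_sum_list_conv_sum_set_nat atLeast0LessThan sum_negf)
  show ?thesis
    using simple
    by (intro exI[of _ N] exI[of _ g] exI[of _ c])
      (simp add: simple_process_as_step_sum[OF simple] simple_process_as_step_sum[OF s] simple_process_as_step_sum[OF s']
        simple_integral_as_step_sum[OF simple] simple_integral_as_step_sum[OF s] simple_integral_as_step_sum[OF s'] 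
        eq[of _ "indicator {_..}"] eq[of _ "\<lambda>u. W u _"] eq')
qed

text \<open>Clamping the partition points to \<open>[a, b]\<close> turns the increment of the integral between \<open>a\<close> and \<open>b\<close> into an
integral over \<open>[a, b]\<close>; the coefficient of an interval that is not collapsed is known at its clamped left end.\<close>

lemma simple_restrict:
  assumes s: "simple_integrand \<Omega> F t u n x \<xi>"
    and ab: "0 \<le> t" "t \<le> a" "a \<le> b" "b \<le> u" "u \<le> T"
  shows "\<exists>N g c. simple_integrand \<Omega> F a b N g c \<and>
    (\<forall>s\<in>{a<..b}. \<forall>\<omega>. simple_process N g c s \<omega> = simple_process n x \<xi> s \<omega>) \<and>
    (\<forall>\<omega>. simple_integral W N g c b \<omega> = simple_integral W n x \<xi> b \<omega> - simple_integral W n x \<xi> a \<omega>)"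
proof -
  define l where "l = map (\<lambda>i. (clamp_to a b (x i), clamp_to a b (x (Suc i)), \<xi> i)) [0..<n]"
  have "\<exists>N g c. simple_integrand \<Omega> F a b N g c \<and>
    (\<forall>(\<phi> :: real \<Rightarrow> real) \<omega>. (\<Sum>i<N. c i \<omega> * (\<phi> (g (Suc i)) - \<phi> (g i))) =
      (\<Sum>(y, z, \<xi>)\<leftarrow>l. \<xi> \<omega> * (\<phi> z - \<phi> y)))"
  proof (rule steps_on_common_grid[OF \<open>a \<le> b\<close>])
    fix y z \<zeta> assume "(y, z, \<zeta>) \<in> set l"
    then obtain i where i: "i < n" "y = clamp_to a b (x i)" "z = clamp_to a b (x (Suc i))" "\<zeta> = \<xi> i"
      by (auto simp: l_def)
    note x = simple_integrandD[OF s, of i]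
    have cl: "a \<le> clamp_to a b v" "clamp_to a b v \<le> b" for v using clamp_to_mem[OF \<open>a \<le> b\<close>] by auto
    have "\<xi> i \<in> borel_measurable (F (clamp_to a b (x i)))" if "clamp_to a b (x i) < clamp_to a b (x (Suc i))"
    proof (rule measurable_F_mono)
      show "\<xi> i \<in> borel_measurable (F (x i))" using x(4) i by simp
      show "x i \<le> clamp_to a b (x i)" using clamp_to_less_imp_le[OF that] .
      show "0 \<le> x i" using x(1) i ab by simp
      show "clamp_to a b (x i) \<le> T" using cl(2)[of "x i"] ab by linarith
    qed
    moreover have "clamp_to a b (x i) \<le> clamp_to a b (x (Suc i))"
      using x(3) i by (intro clamp_to_mono) simp
    ultimately show "a \<le> y \<and> y \<le> z \<and> z \<le> b \<and> (y < z \<longrightarrow> \<zeta> \<in> borel_measurable (F y) \<and> (\<exists>C. \<forall>\<omega>\<in>space \<Omega>. \<bar>\<zeta> \<omega>\<bar> \<le> C))"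
      using x(5) i cl by simp
  qed (use ab in auto)
  then obtain N g c where simple: "simple_integrand \<Omega> F a b N g c"
    and eq: "\<And>(\<phi> :: real \<Rightarrow> real) \<omega>. (\<Sum>i<N. c i \<omega> * (\<phi> (g (Suc i)) - \<phi> (g i))) = (\<Sum>(y, z, \<xi>)\<leftarrow>l. \<xi> \<omega> * (\<phi> z - \<phi> y))"
    by blast
  have eq': "(\<Sum>(y, z, \<xi>)\<leftarrow>l. \<xi> \<omega> * (\<phi> z - \<phi> y)) =
    (\<Sum>i<n. \<xi> i \<omega> * (\<phi> (clamp_to a b (x (Suc i))) - \<phi> (clamp_to a b (x i))))"
    for \<phi> :: "real \<Rightarrow> real" and \<omega>
    by (simp add: l_def comp_def interv_sum_list_conv_sum_set_nat atLeast0LessThan)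
  have "simple_process N g c s \<omega> = simple_process n x \<xi> s \<omega>" if "s \<in> {a<..b}" for s \<omega>
  proof -
    have "indicator {s..} (clamp_to a b v) = (indicator {s..} v :: real)" for v
      using that by (auto simp: indicator_def clamp_to_def)
    then show ?thesis
      by (simp add: simple_process_as_step_sum[OF simple] simple_process_as_step_sum[OF s] eq eq')
  qed
  moreover have "simple_integral W N g c b \<omega> = simple_integral W n x \<xi> b \<omega> - simple_integral W n x \<xi> a \<omega>" for \<omega>
  proof -
    have *: "W (clamp_to a b v) \<omega> - W a \<omega> = W (min b v) \<omega> - W (min a v) \<omega>" for v
      using \<open>a \<le> b\<close> by (auto simp: clamp_to_def min_def max_def)
    then have "W (clamp_to a b v) \<omega> - W (clamp_to a b v') \<omega>
      = (W (min b v) \<omega> - W (min b v') \<omega>) - (W (min a v) \<omega> - W (min a v') \<omega>)" for v v'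
      using *[of v] *[of v'] by linarith
    then have "simple_integral W N g c b \<omega> = (\<Sum>i<n. \<xi> i \<omega> * ((W (min b (x (Suc i))) \<omega> - W (min b (x i)) \<omega>)
        - (W (min a (x (Suc i))) \<omega> - W (min a (x i)) \<omega>)))"
      by (simp only: simple_integral_as_step_sum[OF simple] eq[of _ "\<lambda>u. W u _"] eq')
    then show ?thesis
      by (simp only: simple_integral_def right_diff_distrib[of "\<xi> _ _" "_ - _"] sum_subtractf)
  qed
  ultimately show ?thesis using simple by blast
qed

lemma ito_limit_diff:
  assumes H: "ito_limit a b H D" and H': "ito_limit a b H' D'" and ab: "0 \<le> a" "b \<le> T"
  shows "ito_limit a b (\<lambda>s \<omega>. H s \<omega> - H' s \<omega>) (\<lambda>\<omega>. D \<omega> - D' \<omega>)"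
proof -
  have [measurable]: "jointly_measurable H" "D \<in> borel_measurable \<Omega>"
    "jointly_measurable H'" "D' \<in> borel_measurable \<Omega>"
    using H H' by (auto simp: ito_limit_def)
  obtain n x \<xi> where s: "\<And>k. simple_integrand \<Omega> F a b (n k) (x k) (\<xi> k)"
    and lim: "(\<lambda>k. \<EE> \<omega>. min 1 (energy a b (\<lambda>s. simple_process (n k) (x k) (\<xi> k) s \<omega> - H s \<omega>))) \<longlonglongrightarrow> 0"
      "(\<lambda>k. \<EE> \<omega>. min 1 (ennreal \<bar>simple_integral W (n k) (x k) (\<xi> k) b \<omega> - D \<omega>\<bar>)) \<longlonglongrightarrow> 0"
    using H unfolding ito_limit_def by blast
  obtain n' x' \<xi>' where s': "\<And>k. simple_integrand \<Omega> F a b (n' k) (x' k) (\<xi>' k)"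
    and lim': "(\<lambda>k. \<EE> \<omega>. min 1 (energy a b (\<lambda>s. simple_process (n' k) (x' k) (\<xi>' k) s \<omega> - H' s \<omega>))) \<longlonglongrightarrow> 0"
      "(\<lambda>k. \<EE> \<omega>. min 1 (ennreal \<bar>simple_integral W (n' k) (x' k) (\<xi>' k) b \<omega> - D' \<omega>\<bar>)) \<longlonglongrightarrow> 0"
    using H' unfolding ito_limit_def by blast
  have [measurable]: "jointly_measurable (\<lambda>s \<omega>. simple_process (n k) (x k) (\<xi> k) s \<omega>)"
    "jointly_measurable (\<lambda>s \<omega>. simple_process (n' k) (x' k) (\<xi>' k) s \<omega>)" for k
    using simple_process_measurable[OF s] simple_process_measurable[OF s'] ab by auto
  have "a \<le> b" using simple_integrandD(1,2)[OF s, of 0] by (meson le0 order_trans)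
  then have [measurable]: "simple_integral W (n k) (x k) (\<xi> k) b \<in> borel_measurable \<Omega>"
    "simple_integral W (n' k) (x' k) (\<xi>' k) b \<in> borel_measurable \<Omega>" for k
    using simple_integral_measurable[OF s] simple_integral_measurable[OF s'] ab by auto
  have "\<forall>k. \<exists>N g c. simple_integrand \<Omega> F a b N g c \<and>
    (\<forall>s \<omega>. simple_process N g c s \<omega> = simple_process (n k) (x k) (\<xi> k) s \<omega> - simple_process (n' k) (x' k) (\<xi>' k) s \<omega>) \<and>
    (\<forall>\<omega>. simple_integral W N g c b \<omega> = simple_integral W (n k) (x k) (\<xi> k) b \<omega> - simple_integral W (n' k) (x' k) (\<xi>' k) b \<omega>)"
    using simple_diff[OF s s' ab] by blast
  then obtain N g c where simple: "\<And>k. simple_integrand \<Omega> F a b (N k) (g k) (c k)"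
    and eq: "\<And>k s \<omega>. simple_process (N k) (g k) (c k) s \<omega> = simple_process (n k) (x k) (\<xi> k) s \<omega> - simple_process (n' k) (x' k) (\<xi>' k) s \<omega>"
      "\<And>k \<omega>. simple_integral W (N k) (g k) (c k) b \<omega> = simple_integral W (n k) (x k) (\<xi> k) b \<omega> - simple_integral W (n' k) (x' k) (\<xi>' k) b \<omega>"
    by metis
  show ?thesis
    unfolding ito_limit_def
  proof (intro conjI exI allI)
    show "jointly_measurable (\<lambda>s \<omega>. H s \<omega> - H' s \<omega>)" "(\<lambda>\<omega>. D \<omega> - D' \<omega>) \<in> borel_measurable \<Omega>"
      by measurable
    have "AE \<omega> in \<Omega>. (energy a b (\<lambda>s. H s \<omega>)) < \<infinity>" "AE \<omega> in \<Omega>. (energy a b (\<lambda>s. H' s \<omega>)) < \<infinity>"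
      using H H' by (auto simp: ito_limit_def)
    then show "AE \<omega> in \<Omega>. (energy a b (\<lambda>s. H s \<omega> - H' s \<omega>)) < \<infinity>"
      using AE_space
    proof eventually_elim
      case (elim \<omega>)
      note [measurable] = \<open>\<omega> \<in> space \<Omega>\<close>
      have "(energy a b (\<lambda>s. H s \<omega> - H' s \<omega>)) \<le>
        2 * (energy a b (\<lambda>s. H s \<omega>)) + 2 * (energy a b (\<lambda>s. H' s \<omega>))"
        by (rule nn_integral_square_diff_le) measurable
      also have "\<dots> < \<infinity>" using elim by (auto simp: ennreal_mult_less_top)
      finally show ?case .
    qed
    show "simple_integrand \<Omega> F a b (N k) (g k) (c k)" for k by (rule simple)
    show "(\<lambda>k. \<EE> \<omega>. min 1 (energy a b (\<lambda>s. simple_process (N k) (g k) (c k) s \<omega> - (H s \<omega> - H' s \<omega>)))) \<longlonglongrightarrow> 0"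
    proof (rule tendsto_0_double_sumI[OF lim(1) lim'(1)], rule nn_integral_min_1_le_double_sum)
      fix k
      show "AE \<omega> in \<Omega>. (energy a b (\<lambda>s. simple_process (N k) (g k) (c k) s \<omega> - (H s \<omega> - H' s \<omega>))) \<le>
        2 * (energy a b (\<lambda>s. simple_process (n k) (x k) (\<xi> k) s \<omega> - H s \<omega>)) +
        2 * (energy a b (\<lambda>s. simple_process (n' k) (x' k) (\<xi>' k) s \<omega> - H' s \<omega>))"
      proof (rule AE_I2)
        fix \<omega> assume [measurable]: "\<omega> \<in> space \<Omega>"
        have "simple_process (N k) (g k) (c k) s \<omega> - (H s \<omega> - H' s \<omega>) =
          (simple_process (n k) (x k) (\<xi> k) s \<omega> - H s \<omega>) - (simple_process (n' k) (x' k) (\<xi>' k) s \<omega> - H' s \<omega>)" for s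
          by (simp add: eq)
        then show "(energy a b (\<lambda>s. simple_process (N k) (g k) (c k) s \<omega> - (H s \<omega> - H' s \<omega>))) \<le>
        2 * (energy a b (\<lambda>s. simple_process (n k) (x k) (\<xi> k) s \<omega> - H s \<omega>)) +
        2 * (energy a b (\<lambda>s. simple_process (n' k) (x' k) (\<xi>' k) s \<omega> - H' s \<omega>))"
          by (simp only:) (rule nn_integral_square_diff_le; measurable)
      qed
    qed measurable
    show "(\<lambda>k. \<EE> \<omega>. min 1 (ennreal \<bar>simple_integral W (N k) (g k) (c k) b \<omega> - (D \<omega> - D' \<omega>)\<bar>)) \<longlonglongrightarrow> 0"
      unfolding eq
      by (rule tendsto_0_double_sumI[OF lim(2) lim'(2)], rule nn_integral_min_1_le_double_sum)
        (auto intro!: AE_I2 ennreal_le_double_sum[OF abs_diff_diff_le])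
  qed
qed

end

text \<open>Separates, under a truncation at level \<open>R\<close>, a limit \<open>Q\<close> from an error \<open>q\<close> that tends to zero.\<close>

lemma ennreal_min_add_mult_le:
  fixes Q q R :: ennreal
  assumes "1 \<le> e"
  shows "min R (e * Q + C * q) \<le> e * min R Q + (R + C) * min 1 q"
proof -
  have e: "z \<le> e * z" for z using mult_right_mono[OF assms, of z] by simp
  consider "R \<le> Q" | "Q \<le> R" "q \<le> 1" | "Q \<le> R" "1 \<le> q" by (meson linear)
  then show ?thesis
  proof cases
    case 1
    have "min R (e * Q + C * q) \<le> e * R" using e[of R] by (auto intro: min.coboundedI1)
    also have "\<dots> \<le> e * min R Q + (R + C) * min 1 q" using 1 by (simp add: min_def)
    finally show ?thesis .
  next
    case 2
    have "min R (e * Q + C * q) \<le> e * Q + C * q" by simp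
    also have "\<dots> \<le> e * min R Q + (R + C) * min 1 q"
      using 2 by (auto simp: min_def intro!: add_mono mult_right_mono)
    finally show ?thesis .
  next
    case 3
    have "min R (e * Q + C * q) \<le> R + 0" by simp
    also have "\<dots> \<le> e * min R Q + (R + C) * min 1 q"
      using 3 by (auto simp: min_def add_increasing intro: add_increasing2)
    finally show ?thesis .
  qed
qed

context brownian_basis
begin

lemma AE_subseq_tendsto_0:
  fixes f :: "nat \<Rightarrow> 'a \<Rightarrow> ennreal"
  assumes [measurable]: "\<And>k. f k \<in> borel_measurable \<Omega>"
    and lim: "(\<lambda>k. \<EE> \<omega>. min 1 (f k \<omega>)) \<longlonglongrightarrow> 0"
  shows "\<exists>r :: nat \<Rightarrow> nat. strict_mono r \<and> (AE \<omega> in \<Omega>. (\<lambda>k. f (r k) \<omega>) \<longlonglongrightarrow> 0)"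
proof -
  define v where "v k \<omega> = enn2real (min 1 (f k \<omega>))" for k \<omega>
  have v: "ennreal (v k \<omega>) = min 1 (f k \<omega>)" for k \<omega>
    unfolding v_def by (rule ennreal_enn2real, rule le_less_trans[OF min.cobounded1]) simp
  have v01: "0 \<le> v k \<omega>" "v k \<omega> \<le> 1" for k \<omega>
  proof -
    show "0 \<le> v k \<omega>" by (simp add: v_def)
    have "ennreal (v k \<omega>) \<le> ennreal 1" unfolding v by simp
    then show "v k \<omega> \<le> 1" by (subst (asm) ennreal_le_iff) auto
  qed
  have [measurable]: "v k \<in> borel_measurable \<Omega>" for k unfolding v_def by measurable
  have int: "integrable \<Omega> (v k)" for k
    using v01 by (intro integrable_const_bound[of _ 1]) (auto intro!: AE_I2)
  have "ennreal (\<integral>\<omega>. norm (v k \<omega>) \<partial>\<Omega>) = (\<EE> \<omega>. min 1 (f k \<omega>))" for k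
    using int v01 by (subst nn_integral_eq_integral[symmetric]) (auto simp: v)
  then have "(\<lambda>k. ennreal (\<integral>\<omega>. norm (v k \<omega>) \<partial>\<Omega>)) \<longlonglongrightarrow> ennreal 0"
    using lim by simp
  then have "(\<lambda>k. \<integral>\<omega>. norm (v k \<omega>) \<partial>\<Omega>) \<longlonglongrightarrow> 0"
    by (subst (asm) tendsto_ennreal_iff) auto
  from tendsto_L1_AE_subseq[OF int this] obtain r :: "nat \<Rightarrow> nat"
    where r: "strict_mono r" "AE \<omega> in \<Omega>. (\<lambda>k. v (r k) \<omega>) \<longlonglongrightarrow> 0" by blast
  have "AE \<omega> in \<Omega>. (\<lambda>k. f (r k) \<omega>) \<longlonglongrightarrow> 0"
    using r(2)
  proof eventually_elim
    case (elim \<omega>)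
    then have "(\<lambda>k. ennreal (v (r k) \<omega>)) \<longlonglongrightarrow> ennreal 0" by (intro tendsto_ennrealI)
    then show ?case unfolding v ennreal_0 by (rule ennreal_tendsto_0_cancel_min)
  qed
  with r(1) show ?thesis by blast
qed

text \<open>Along a subsequence the simple integrals \<open>S k\<close> converge to \<open>D\<close> almost surely.  The quadratic sums \<open>A k\<close>
satisfy \<open>A k \<le> (1 + \<eta>) Q + (1 + 1/\<eta>) q k\<close> with \<open>q k \<longlonglongrightarrow> 0\<close>, so that on \<open>Q \<le> R\<close> they eventually stay below
the level \<open>R' = (1 + \<eta>) R + \<eta>\<close>.  Fatou's lemma then transfers the truncated isometry of the simple integrals
at level \<open>R'\<close>, up to an error that disappears as \<open>\<eta>\<close> tends to zero.\<close>

lemma truncated_ito_inequality: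
  assumes H: "ito_limit a b H D" and ab: "0 \<le> a" "b \<le> T" and R: "0 \<le> R"
  defines "Q \<equiv> \<lambda>\<omega>. \<integral>\<^sup>+s\<in>{a..b}. ennreal ((H s \<omega>)\<^sup>2) \<partial>lborel"
  shows "(\<EE> \<omega>. indicator {\<omega>. Q \<omega> \<le> ennreal R} \<omega> * ennreal ((D \<omega>)\<^sup>2)) \<le> (\<EE> \<omega>. min (ennreal R) (Q \<omega>))"
proof -
  have [measurable]: "jointly_measurable H" "D \<in> borel_measurable \<Omega>"
    using H by (auto simp: ito_limit_def)
  obtain n x \<xi> where s: "\<And>k. simple_integrand \<Omega> F a b (n k) (x k) (\<xi> k)"
    and lim: "(\<lambda>k. \<EE> \<omega>. min 1 (energy a b (\<lambda>s. simple_process (n k) (x k) (\<xi> k) s \<omega> - H s \<omega>))) \<longlonglongrightarrow> 0"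
      "(\<lambda>k. \<EE> \<omega>. min 1 (ennreal \<bar>simple_integral W (n k) (x k) (\<xi> k) b \<omega> - D \<omega>\<bar>)) \<longlonglongrightarrow> 0"
    using H unfolding ito_limit_def by blast
  define h where "h k s \<omega> = simple_process (n k) (x k) (\<xi> k) s \<omega>" for k s \<omega>
  define S where "S k \<omega> = simple_integral W (n k) (x k) (\<xi> k) b \<omega>" for k \<omega>
  define q where "q k \<omega> = (energy a b (\<lambda>s. h k s \<omega> - H s \<omega>))" for k \<omega>
  define A where "A k \<omega> = (\<Sum>i<n k. (\<xi> k i \<omega>)\<^sup>2 * (x k (Suc i) - x k i))" for k \<omega>
  have [measurable]: "jointly_measurable (h k)" for k
    using simple_process_measurable[OF s] ab by (auto simp: h_def)
  have "a \<le> b" using simple_integrandD(1,2)[OF s, of 0] by (meson le0 order_trans)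
  then have [measurable]: "S k \<in> borel_measurable \<Omega>" for k
    using simple_integral_measurable[OF s] ab by (auto simp: S_def[abs_def])
  have [measurable]: "q k \<in> borel_measurable \<Omega>" for k
    unfolding q_def by measurable
  have [measurable]: "Q \<in> borel_measurable \<Omega>"
    unfolding Q_def by measurable
  have A_eq: "ennreal (A k \<omega>) = (energy a b (\<lambda>s. h k s \<omega>))" for k \<omega>
    using nn_integral_simple_process_square[OF s] by (simp add: A_def h_def)
  have A_nonneg: "0 \<le> A k \<omega>" for k \<omega>
    unfolding A_def using simple_integrandD(3)[OF s[of k]]
    by (intro sum_nonneg mult_nonneg_nonneg) (auto simp: less_imp_le)
  have [measurable]: "(\<lambda>\<omega>. ennreal (A k \<omega>)) \<in> borel_measurable \<Omega>" for k
    unfolding A_eq by measurable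
  define u where "u k \<omega> = q k \<omega> + ennreal \<bar>S k \<omega> - D \<omega>\<bar>" for k \<omega>
  have [measurable]: "u k \<in> borel_measurable \<Omega>" for k
    unfolding u_def by measurable
  have "(\<lambda>k. (\<EE> \<omega>. min 1 (q k \<omega>)) + (\<EE> \<omega>. min 1 (ennreal \<bar>S k \<omega> - D \<omega>\<bar>))) \<longlonglongrightarrow> 0 + 0"
    using lim unfolding h_def q_def S_def by (intro tendsto_add)
  then have lim_sum: "(\<lambda>k. (\<EE> \<omega>. min 1 (q k \<omega>)) + (\<EE> \<omega>. min 1 (ennreal \<bar>S k \<omega> - D \<omega>\<bar>))) \<longlonglongrightarrow> 0"
    by simp
  have "(\<lambda>k. (\<EE> \<omega>. min 1 (u k \<omega>))) \<longlonglongrightarrow> 0"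
  proof (rule tendsto_sandwich[OF _ _ tendsto_const lim_sum])
    have "(\<EE> \<omega>. min 1 (u k \<omega>)) \<le> (\<EE> \<omega>. min 1 (q k \<omega>) + min 1 (ennreal \<bar>S k \<omega> - D \<omega>\<bar>))" for k
      unfolding u_def by (intro nn_integral_mono) (auto simp: min_def add_increasing add_increasing2)
    also have "\<dots> k = (\<EE> \<omega>. min 1 (q k \<omega>)) + (\<EE> \<omega>. min 1 (ennreal \<bar>S k \<omega> - D \<omega>\<bar>))" for k
      by (intro nn_integral_add) auto
    finally show "\<forall>\<^sub>F k in sequentially. (\<EE> \<omega>. min 1 (u k \<omega>)) \<le>
      (\<EE> \<omega>. min 1 (q k \<omega>)) + (\<EE> \<omega>. min 1 (ennreal \<bar>S k \<omega> - D \<omega>\<bar>))" by simp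
  qed auto
  from AE_subseq_tendsto_0[OF _ this] obtain r :: "nat \<Rightarrow> nat"
    where r: "strict_mono r" and r0: "AE \<omega> in \<Omega>. (\<lambda>k. u (r k) \<omega>) \<longlonglongrightarrow> 0" by auto
  have bound: "(\<EE> \<omega>. indicator {\<omega>. Q \<omega> \<le> ennreal R} \<omega> * ennreal ((D \<omega>)\<^sup>2)) \<le>
      ennreal (1 + \<eta>) * ((\<EE> \<omega>. min (ennreal R) (Q \<omega>)) + ennreal (\<eta> * (R + 1)))" if \<eta>: "0 < \<eta>" for \<eta>
  proof -
    define R' where "R' = (1 + \<eta>) * R + \<eta>"
    define c where "c = 1 + 1 / \<eta>"
    have R': "0 \<le> R'" and c: "0 < c" using R \<eta> by (auto simp: R'_def c_def add_pos_pos)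
    have A_le: "ennreal (A k \<omega>) \<le> ennreal (1 + \<eta>) * Q \<omega> + ennreal c * q k \<omega>" if [measurable]: "\<omega> \<in> space \<Omega>" for k \<omega>
    proof -
      have "ennreal (A k \<omega>) \<le> (\<integral>\<^sup>+s. ennreal (1 + \<eta>) * (ennreal ((H s \<omega>)\<^sup>2) * indicator {a..b} s)
          + ennreal c * (ennreal ((h k s \<omega> - H s \<omega>)\<^sup>2) * indicator {a..b} s) \<partial>lborel)"
        unfolding A_eq
      proof (rule nn_integral_mono)
        fix s
        have "ennreal ((h k s \<omega>)\<^sup>2) \<le> ennreal ((1 + \<eta>) * (H s \<omega>)\<^sup>2 + c * (h k s \<omega> - H s \<omega>)\<^sup>2)"
          unfolding c_def by (intro ennreal_leI square_le_weighted \<eta>)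
        also have "\<dots> = ennreal (1 + \<eta>) * ennreal ((H s \<omega>)\<^sup>2) + ennreal c * ennreal ((h k s \<omega> - H s \<omega>)\<^sup>2)"
          using \<eta> c by (simp add: ennreal_mult)
        finally show "ennreal ((h k s \<omega>)\<^sup>2) * indicator {a..b} s \<le> ennreal (1 + \<eta>) * (ennreal ((H s \<omega>)\<^sup>2) * indicator {a..b} s)
          + ennreal c * (ennreal ((h k s \<omega> - H s \<omega>)\<^sup>2) * indicator {a..b} s)"
          by (auto simp: indicator_def)
      qed
      also have "\<dots> = ennreal (1 + \<eta>) * Q \<omega> + ennreal c * q k \<omega>"
        unfolding Q_def q_def by (subst nn_integral_add) (auto simp: nn_integral_cmult)
      finally show ?thesis .
    qed
    have "(\<EE> \<omega>. indicator {\<omega>. Q \<omega> \<le> ennreal R} \<omega> * ennreal ((D \<omega>)\<^sup>2)) \<le>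
      (\<EE> \<omega>. liminf (\<lambda>k. indicator {\<omega>. ennreal (A (r k) \<omega>) \<le> ennreal R'} \<omega> * ennreal ((S (r k) \<omega>)\<^sup>2)))"
    proof (rule nn_integral_mono_AE, use r0 AE_space in eventually_elim)
      case (elim \<omega>)
      show ?case
      proof (cases "Q \<omega> \<le> ennreal R")
        case True
        have q0: "(\<lambda>k. q (r k) \<omega>) \<longlonglongrightarrow> 0"
          by (rule tendsto_sandwich[OF _ _ tendsto_const elim(1)]) (simp_all add: u_def)
        have S0: "(\<lambda>k. ennreal \<bar>S (r k) \<omega> - D \<omega>\<bar>) \<longlonglongrightarrow> ennreal 0"
          unfolding ennreal_0 by (rule tendsto_sandwich[OF _ _ tendsto_const elim(1)]) (simp_all add: u_def)
        have "(\<lambda>k. \<bar>S (r k) \<omega> - D \<omega>\<bar>) \<longlonglongrightarrow> 0"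
          using S0 by (subst (asm) tendsto_ennreal_iff) auto
        then have "(\<lambda>k. S (r k) \<omega>) \<longlonglongrightarrow> D \<omega>"
          by (simp add: tendsto_rabs_zero_iff LIM_zero_iff)
        then have S2: "(\<lambda>k. ennreal ((S (r k) \<omega>)\<^sup>2)) \<longlonglongrightarrow> ennreal ((D \<omega>)\<^sup>2)"
          by (intro tendsto_ennrealI tendsto_power)
        have "(\<lambda>k. ennreal c * q (r k) \<omega>) \<longlonglongrightarrow> ennreal c * 0"
          by (intro ennreal_tendsto_cmult q0) auto
        then have "\<forall>\<^sub>F k in sequentially. ennreal c * q (r k) \<omega> < ennreal \<eta>"
          by (intro order_tendstoD(2)[of _ "ennreal c * 0"]) (use \<eta> in auto)
        then have "\<forall>\<^sub>F k in sequentially. ennreal ((S (r k) \<omega>)\<^sup>2) =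
            indicator {\<omega>. ennreal (A (r k) \<omega>) \<le> ennreal R'} \<omega> * ennreal ((S (r k) \<omega>)\<^sup>2)"
        proof eventually_elim
          fix k assume k: "ennreal c * q (r k) \<omega> < ennreal \<eta>"
          have "ennreal (A (r k) \<omega>) \<le> ennreal (1 + \<eta>) * Q \<omega> + ennreal c * q (r k) \<omega>"
            using elim by (intro A_le)
          also have "\<dots> \<le> ennreal (1 + \<eta>) * ennreal R + ennreal \<eta>"
            using True k by (intro add_mono mult_left_mono) auto
          also have "\<dots> = ennreal R'"
            using R \<eta> by (simp add: R'_def ennreal_mult)
          finally show "ennreal ((S (r k) \<omega>)\<^sup>2) =
            indicator {\<omega>. ennreal (A (r k) \<omega>) \<le> ennreal R'} \<omega> * ennreal ((S (r k) \<omega>)\<^sup>2)" by simp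
        qed
        from Lim_transform_eventually[OF S2 this] show ?thesis
          using True by (simp add: lim_imp_Liminf)
      qed simp
    qed
    also have "\<dots> \<le> liminf (\<lambda>k. \<EE> \<omega>. indicator {\<omega>. ennreal (A (r k) \<omega>) \<le> ennreal R'} \<omega> * ennreal ((S (r k) \<omega>)\<^sup>2))"
      by (rule nn_integral_liminf) measurable
    also have "\<dots> \<le> liminf (\<lambda>k. ennreal (1 + \<eta>) * (\<EE> \<omega>. min (ennreal R') (Q \<omega>))
        + (ennreal R' + ennreal c) * (\<EE> \<omega>. min 1 (q (r k) \<omega>)))"
    proof (intro Liminf_mono always_eventually allI)
      fix k
      let ?k = "r k"
      have "(\<EE> \<omega>. indicator {\<omega>. ennreal (A ?k \<omega>) \<le> ennreal R'} \<omega> * ennreal ((S ?k \<omega>)\<^sup>2))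
        \<le> (\<EE> \<omega>. ennreal (min R' (A ?k \<omega>)))"
        using truncated_simple_isometry[OF s[of ?k] ab R'] R' A_nonneg
        by (simp add: S_def A_def ennreal_le_iff)
      also have "\<dots> \<le> (\<EE> \<omega>. ennreal (1 + \<eta>) * min (ennreal R') (Q \<omega>) + (ennreal R' + ennreal c) * min 1 (q ?k \<omega>))"
      proof (rule nn_integral_mono)
        fix \<omega> assume \<omega>: "\<omega> \<in> space \<Omega>"
        have "ennreal (min R' (A ?k \<omega>)) = min (ennreal R') (ennreal (A ?k \<omega>))"
          using R' A_nonneg by (simp add: ennreal_min)
        also have "\<dots> \<le> min (ennreal R') (ennreal (1 + \<eta>) * Q \<omega> + ennreal c * q ?k \<omega>)"
          using A_le[OF \<omega>] by (intro min.mono) auto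
        also have "\<dots> \<le> ennreal (1 + \<eta>) * min (ennreal R') (Q \<omega>) + (ennreal R' + ennreal c) * min 1 (q ?k \<omega>)"
          using \<eta> by (intro ennreal_min_add_mult_le) simp
        finally show "ennreal (min R' (A ?k \<omega>)) \<le> ennreal (1 + \<eta>) * min (ennreal R') (Q \<omega>) + (ennreal R' + ennreal c) * min 1 (q ?k \<omega>)" .
      qed
      also have "\<dots> = ennreal (1 + \<eta>) * (\<EE> \<omega>. min (ennreal R') (Q \<omega>))
        + (ennreal R' + ennreal c) * (\<EE> \<omega>. min 1 (q ?k \<omega>))"
        by (subst nn_integral_add) (auto simp: nn_integral_cmult)
      finally show "(\<EE> \<omega>. indicator {\<omega>. ennreal (A ?k \<omega>) \<le> ennreal R'} \<omega> * ennreal ((S ?k \<omega>)\<^sup>2)) \<le>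
        ennreal (1 + \<eta>) * (\<EE> \<omega>. min (ennreal R') (Q \<omega>)) + (ennreal R' + ennreal c) * (\<EE> \<omega>. min 1 (q ?k \<omega>))" .
    qed
    also have "\<dots> = ennreal (1 + \<eta>) * (\<EE> \<omega>. min (ennreal R') (Q \<omega>)) + (ennreal R' + ennreal c) * 0"
    proof (intro lim_imp_Liminf tendsto_add tendsto_const ennreal_tendsto_cmult)
      show "(\<lambda>k. \<EE> \<omega>. min 1 (q (r k) \<omega>)) \<longlonglongrightarrow> 0"
        using LIMSEQ_subseq_LIMSEQ[OF lim(1) r] by (simp add: comp_def q_def h_def)
    qed auto
    also have "\<dots> = ennreal (1 + \<eta>) * (\<EE> \<omega>. min (ennreal R') (Q \<omega>))" by simp
    also have "\<dots> \<le> ennreal (1 + \<eta>) * ((\<EE> \<omega>. min (ennreal R) (Q \<omega>)) + ennreal (\<eta> * (R + 1)))"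
    proof (intro mult_left_mono)
      have "min (ennreal R') (Q \<omega>) \<le> min (ennreal R) (Q \<omega>) + ennreal (\<eta> * (R + 1))" for \<omega>
      proof -
        have "ennreal R' = ennreal R + ennreal (\<eta> * (R + 1))"
          using R \<eta> by (simp add: R'_def algebra_simps flip: ennreal_plus)
        then show ?thesis
          by (cases "ennreal R \<le> Q \<omega>") (auto simp: min_absorb1 min_absorb2 intro: min.coboundedI1 min.coboundedI2)
      qed
      then have "(\<EE> \<omega>. min (ennreal R') (Q \<omega>)) \<le> (\<EE> \<omega>. min (ennreal R) (Q \<omega>) + ennreal (\<eta> * (R + 1)))"
        by (intro nn_integral_mono)
      also have "\<dots> = (\<EE> \<omega>. min (ennreal R) (Q \<omega>)) + ennreal (\<eta> * (R + 1))"
        by (subst nn_integral_add) (auto simp: emeasure_space_1)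
      finally show "(\<EE> \<omega>. min (ennreal R') (Q \<omega>)) \<le> (\<EE> \<omega>. min (ennreal R) (Q \<omega>)) + ennreal (\<eta> * (R + 1))" .
    qed auto
    finally show ?thesis .
  qed
  let ?Y = "\<EE> \<omega>. min (ennreal R) (Q \<omega>)"
  have "?Y \<le> (\<EE> \<omega>. ennreal R)" by (intro nn_integral_mono) auto
  then have "?Y < \<infinity>" by (auto simp: emeasure_space_1 intro: le_less_trans)
  then obtain y where y: "?Y = ennreal y" "0 \<le> y" by (cases ?Y) auto
  have lim': "(\<lambda>k. ennreal ((1 + 1 / real (Suc k)) * (y + 1 / real (Suc k) * (R + 1)))) \<longlonglongrightarrow> ennreal ((1 + 0) * (y + 0 * (R + 1)))"
    by (intro tendsto_intros LIMSEQ_Suc[OF lim_1_over_n] tendsto_ennrealI)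
  have "(\<EE> \<omega>. indicator {\<omega>. Q \<omega> \<le> ennreal R} \<omega> * ennreal ((D \<omega>)\<^sup>2)) \<le> ennreal ((1 + 0) * (y + 0 * (R + 1)))"
  proof (rule LIMSEQ_le_const[OF lim'], intro exI[of _ 0] allI impI)
    fix k :: nat
    show "(\<EE> \<omega>. indicator {\<omega>. Q \<omega> \<le> ennreal R} \<omega> * ennreal ((D \<omega>)\<^sup>2)) \<le>
      ennreal ((1 + 1 / real (Suc k)) * (y + 1 / real (Suc k) * (R + 1)))"
      using bound[of "1 / real (Suc k)"] y R
      by (subst ennreal_mult) (simp_all del: of_nat_Suc add: add_nonneg_nonneg)
  qed
  then show ?thesis using y by simp
qed

lemma ito_inequality:
  assumes H: "ito_limit a b H D" and ab: "0 \<le> a" "b \<le> T"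
  shows "(\<EE> \<omega>. ennreal ((D \<omega>)\<^sup>2)) \<le> (\<EE> \<omega>. (energy a b (\<lambda>s. H s \<omega>)))"
proof -
  have [measurable]: "jointly_measurable H" "D \<in> borel_measurable \<Omega>"
    using H by (auto simp: ito_limit_def)
  show ?thesis
  proof (rule nn_integral_le_by_exhaustion[where q = "\<lambda>\<omega>. \<integral>\<^sup>+s\<in>{a..b}. ennreal ((H s \<omega>)\<^sup>2) \<partial>lborel"])
    fix N :: nat
    show "(\<EE> \<omega>. indicator {\<omega>. (energy a b (\<lambda>s. H s \<omega>)) \<le> of_nat N} \<omega> * ennreal ((D \<omega>)\<^sup>2))
      \<le> (\<EE> \<omega>. (energy a b (\<lambda>s. H s \<omega>)))"
      unfolding ennreal_of_nat_eq_real_of_nat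
      by (rule order_trans[OF truncated_ito_inequality[OF H ab]]) (auto intro!: nn_integral_mono)
  qed (use H in \<open>auto simp: ito_limit_def\<close>)
qed

end

lemma nn_integral_eq_set_lebesgue_integral:
  fixes g :: "real \<Rightarrow> real"
  assumes "set_integrable lborel A g" "\<And>s. s \<in> A \<Longrightarrow> 0 \<le> g s"
  shows "(\<integral>\<^sup>+s\<in>A. ennreal (g s) \<partial>lborel) = ennreal (LBINT s:A. g s)"
proof -
  have "(\<integral>\<^sup>+s\<in>A. ennreal (g s) \<partial>lborel) = (\<integral>\<^sup>+s. ennreal (indicator A s *\<^sub>R g s) \<partial>lborel)"
    by (intro nn_integral_cong) (auto simp: indicator_def)
  also have "\<dots> = ennreal (LBINT s:A. g s)"
    using assms unfolding set_lebesgue_integral_def set_integrable_def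
    by (intro nn_integral_eq_integral) (auto simp: indicator_def)
  finally show ?thesis .
qed

lemma set_integrable_if_nn_integral_finite:
  fixes g :: "real \<Rightarrow> real"
  assumes [measurable]: "g \<in> borel_measurable borel" "A \<in> sets borel" and "\<And>s. s \<in> A \<Longrightarrow> 0 \<le> g s"
    and "(\<integral>\<^sup>+s\<in>A. ennreal (g s) \<partial>lborel) < \<infinity>"
  shows "set_integrable lborel A g"
  unfolding set_integrable_def
proof (rule integrableI_nonneg)
  have "(\<integral>\<^sup>+s. ennreal (indicator A s *\<^sub>R g s) \<partial>lborel) = (\<integral>\<^sup>+s\<in>A. ennreal (g s) \<partial>lborel)"
    by (intro nn_integral_cong) (auto simp: indicator_def)
  with assms(4) show "(\<integral>\<^sup>+s. ennreal (indicator A s *\<^sub>R g s) \<partial>lborel) < \<infinity>" by simp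
qed (use assms(3) in \<open>auto simp: indicator_def\<close>)

context brownian_basis
begin

lemma joint_measurable_section:
  assumes [measurable]: "jointly_measurable X"
  shows "X s \<in> borel_measurable \<Omega>"
proof -
  have "(\<lambda>\<omega>. X s \<omega>) \<in> borel_measurable \<Omega>" by measurable
  then show ?thesis by simp
qed

lemma joint_measurable_path:
  assumes [measurable]: "jointly_measurable X" and [measurable]: "\<omega> \<in> space \<Omega>"
  shows "(\<lambda>s. X s \<omega>) \<in> borel_measurable borel"
  by measurable

text \<open>The approximating simple integrands on \<open>[t, T]\<close>, restricted to \<open>[a, b]\<close>, still approximate \<open>H\<close> there, and their
integrals over \<open>[a, b]\<close> are the increments of their integrals from \<open>t\<close>.\<close>

lemma ito_limit_of_ito_integral:
  assumes ito: "ito_integral \<Omega> F W t T H I" and t: "0 \<le> t" "t \<le> a" "a \<le> b" "b \<le> T"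
  shows "ito_limit a b (\<lambda>s. H (clamp_to t T s)) (\<lambda>\<omega>. I b \<omega> - I a \<omega>)"
proof -
  have "t \<le> T" using t by simp
  define Hc where "Hc s = H (clamp_to t T s)" for s
  have Hc_id: "Hc s = H s" if "s \<in> {t..T}" for s using that by (simp add: Hc_def)
  have mH[measurable]: "jointly_measurable Hc"
    using ito \<open>t \<le> T\<close> by (auto simp: ito_integral_def Hc_def intro: progressive_clamp_measurable)
  have mI[measurable]: "I s \<in> borel_measurable \<Omega>" if "s \<in> {t..T}" for s
  proof -
    have "jointly_measurable (\<lambda>s \<omega>. I (clamp_to t T s) \<omega>)"
      using ito \<open>t \<le> T\<close> by (auto simp: ito_integral_def intro: progressive_clamp_measurable)
    from joint_measurable_section[OF this, of s] show ?thesis using that by simp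
  qed
  obtain n x \<xi> where s: "\<And>k. simple_integrand \<Omega> F t T (n k) (x k) (\<xi> k)"
    and tip: "tendsto_in_probability \<Omega>
          (\<lambda>k \<omega>. LBINT s:{t..T}. (simple_process (n k) (x k) (\<xi> k) s \<omega> - H s \<omega>)\<^sup>2) (\<lambda>_. 0)"
      "\<And>s. s\<in>{t..T} \<Longrightarrow> tendsto_in_probability \<Omega> (\<lambda>k. simple_integral W (n k) (x k) (\<xi> k) s) (I s)"
    using ito unfolding ito_integral_def by blast
  define h where "h k s \<omega> = simple_process (n k) (x k) (\<xi> k) s \<omega>" for k s \<omega>
  define S where "S k s = simple_integral W (n k) (x k) (\<xi> k) s" for k s
  have mh[measurable]: "jointly_measurable (h k)" for k
    unfolding h_def using t by (intro simple_process_measurable[OF s]) auto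
  have mS[measurable]: "S k s \<in> borel_measurable \<Omega>" if "s \<in> {t..T}" for k s
    unfolding S_def using t that by (intro simple_integral_measurable[OF s]) auto
  have "\<forall>k. \<exists>N g c. simple_integrand \<Omega> F a b N g c \<and>
    (\<forall>s\<in>{a<..b}. \<forall>\<omega>. simple_process N g c s \<omega> = h k s \<omega>) \<and>
    (\<forall>\<omega>. simple_integral W N g c b \<omega> = S k b \<omega> - S k a \<omega>)"
    unfolding h_def S_def using simple_restrict[OF s t order_refl] by blast
  then obtain N g c where simple: "\<And>k. simple_integrand \<Omega> F a b (N k) (g k) (c k)"
    and eq: "\<And>k s \<omega>. s \<in> {a<..b} \<Longrightarrow> simple_process (N k) (g k) (c k) s \<omega> = h k s \<omega>"
      "\<And>k \<omega>. simple_integral W (N k) (g k) (c k) b \<omega> = S k b \<omega> - S k a \<omega>"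
    by metis
  have finH: "AE \<omega> in \<Omega>. (energy t T (\<lambda>s. Hc s \<omega>)) < \<infinity>"
  proof -
    have "AE \<omega> in \<Omega>. set_integrable lborel {t..T} (\<lambda>s. (H s \<omega>)\<^sup>2)"
      using ito by (simp add: ito_integral_def)
    then show ?thesis
    proof eventually_elim
      case (elim \<omega>)
      have "(energy t T (\<lambda>s. Hc s \<omega>)) = (energy t T (\<lambda>s. H s \<omega>))"
        by (intro nn_integral_cong) (auto simp: indicator_def Hc_id)
      also have "\<dots> = ennreal (LBINT s:{t..T}. (H s \<omega>)\<^sup>2)"
        using elim by (rule nn_integral_eq_set_lebesgue_integral) simp
      finally show ?case by simp
    qed
  qed
  define L where "L k \<omega> = (LBINT s:{t..T}. (h k s \<omega> - Hc s \<omega>)\<^sup>2)" for k \<omega>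
  have [measurable]: "L k \<in> borel_measurable \<Omega>" for k
    unfolding L_def set_lebesgue_integral_def by measurable
  have L_eq: "L k \<omega> = (LBINT s:{t..T}. (simple_process (n k) (x k) (\<xi> k) s \<omega> - H s \<omega>)\<^sup>2)" for k \<omega>
    unfolding L_def h_def by (intro set_lebesgue_integral_cong) (auto simp: Hc_id)
  have limL: "(\<lambda>k. \<EE> \<omega>. min 1 (ennreal \<bar>L k \<omega> - 0\<bar>)) \<longlonglongrightarrow> 0"
  proof (rule tendsto_in_probability_imp_nn_integral_min)
    show "tendsto_in_probability \<Omega> L (\<lambda>_. 0)" using tip(1) by (simp add: L_eq[abs_def])
  qed simp_all
  show ?thesis
    unfolding Hc_def[symmetric] ito_limit_def
  proof (intro conjI exI allI)
    show "jointly_measurable Hc" by (rule mH)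
    show "(\<lambda>\<omega>. I b \<omega> - I a \<omega>) \<in> borel_measurable \<Omega>" using t by (intro borel_measurable_diff mI) auto
    show "AE \<omega> in \<Omega>. (energy a b (\<lambda>s. Hc s \<omega>)) < \<infinity>"
      using finH
    proof eventually_elim
      case (elim \<omega>)
      have "(energy a b (\<lambda>s. Hc s \<omega>)) \<le> (energy t T (\<lambda>s. Hc s \<omega>))"
        using t by (intro nn_integral_mono) (auto simp: indicator_def)
      then show ?case using elim by (rule le_less_trans)
    qed
    show "simple_integrand \<Omega> F a b (N k) (g k) (c k)" for k by (rule simple)
    show "(\<lambda>k. \<EE> \<omega>. min 1 (energy a b (\<lambda>s. simple_process (N k) (g k) (c k) s \<omega> - Hc s \<omega>))) \<longlonglongrightarrow> 0"
    proof (rule tendsto_sandwich[OF _ _ tendsto_const limL])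
      have le: "AE \<omega> in \<Omega>. (energy a b (\<lambda>s. simple_process (N k) (g k) (c k) s \<omega> - Hc s \<omega>)) \<le> ennreal \<bar>L k \<omega> - 0\<bar>" for k
        using finH AE_space
      proof eventually_elim
        case (elim \<omega>)
        note [measurable] = \<open>\<omega> \<in> space \<Omega>\<close>
        have h2: "(energy t T (\<lambda>s. h k s \<omega>)) < \<infinity>"
          using nn_integral_simple_process_square[OF s] by (simp add: h_def)
        have "(energy t T (\<lambda>s. h k s \<omega> - Hc s \<omega>)) \<le>
          2 * (energy t T (\<lambda>s. h k s \<omega>)) + 2 * (energy t T (\<lambda>s. Hc s \<omega>))"
          by (rule nn_integral_square_diff_le) measurable
        also have "\<dots> < \<infinity>" using elim h2 by (auto simp: ennreal_mult_less_top)
        finally have "set_integrable lborel {t..T} (\<lambda>s. (h k s \<omega> - Hc s \<omega>)\<^sup>2)"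
          by (intro set_integrable_if_nn_integral_finite) auto
        from nn_integral_eq_set_lebesgue_integral[OF this]
        have "(energy t T (\<lambda>s. h k s \<omega> - Hc s \<omega>)) = ennreal (L k \<omega>)"
          by (simp add: L_def)
        moreover have "(energy a b (\<lambda>s. simple_process (N k) (g k) (c k) s \<omega> - Hc s \<omega>))
          \<le> (energy t T (\<lambda>s. h k s \<omega> - Hc s \<omega>))"
        proof (rule nn_integral_mono_AE, use AE_lborel_singleton[of a] in eventually_elim)
          fix s assume "s \<noteq> a"
          then show "ennreal ((simple_process (N k) (g k) (c k) s \<omega> - Hc s \<omega>)\<^sup>2) * indicator {a..b} s
            \<le> ennreal ((h k s \<omega> - Hc s \<omega>)\<^sup>2) * indicator {t..T} s"
            using t by (cases "s \<in> {a<..b}") (auto simp: eq(1) indicator_def)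
        qed
        ultimately show ?case by (simp add: ennreal_leI order_trans)
      qed
      show "\<forall>\<^sub>F k in sequentially. (\<EE> \<omega>. min 1 (energy a b (\<lambda>s. simple_process (N k) (g k) (c k) s \<omega> - Hc s \<omega>)))
        \<le> (\<EE> \<omega>. min 1 (ennreal \<bar>L k \<omega> - 0\<bar>))"
      proof (rule always_eventually, rule allI, rule nn_integral_mono_AE)
        fix k
        show "AE \<omega> in \<Omega>. min 1 (energy a b (\<lambda>s. simple_process (N k) (g k) (c k) s \<omega> - Hc s \<omega>))
          \<le> min 1 (ennreal \<bar>L k \<omega> - 0\<bar>)"
          using le[of k] by eventually_elim (rule min.mono[OF order_refl])
      qed
    qed simp
    show "(\<lambda>k. \<EE> \<omega>. min 1 (ennreal \<bar>simple_integral W (N k) (g k) (c k) b \<omega> - (I b \<omega> - I a \<omega>)\<bar>)) \<longlonglongrightarrow> 0"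
      unfolding eq(2)
    proof (rule tendsto_0_double_sumI)
      have ab: "a \<in> {t..T}" "b \<in> {t..T}" using t by auto
      show "(\<lambda>k. \<EE> \<omega>. min 1 (ennreal \<bar>S k b \<omega> - I b \<omega>\<bar>)) \<longlonglongrightarrow> 0"
        "(\<lambda>k. \<EE> \<omega>. min 1 (ennreal \<bar>S k a \<omega> - I a \<omega>\<bar>)) \<longlonglongrightarrow> 0"
        using tip(2) ab mS mI
        by (auto intro!: tendsto_in_probability_imp_nn_integral_min simp: S_def)
      show "(\<EE> \<omega>. min 1 (ennreal \<bar>S k b \<omega> - S k a \<omega> - (I b \<omega> - I a \<omega>)\<bar>)) \<le>
         2 * (\<EE> \<omega>. min 1 (ennreal \<bar>S k b \<omega> - I b \<omega>\<bar>)) + 2 * (\<EE> \<omega>. min 1 (ennreal \<bar>S k a \<omega> - I a \<omega>\<bar>))" for k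
        using mS[OF ab(1)] mS[OF ab(2)] mI[OF ab(1)] mI[OF ab(2)]
        by (intro nn_integral_min_1_le_double_sum AE_I2 ennreal_le_double_sum[OF abs_diff_diff_le]) auto
    qed
  qed
qed

end

section \<open>Gronwall's lemma and clocks\<close>

text \<open>With the weight \<open>exp (- 2 \<beta> (s - a))\<close> the integral term is at most half of the supremum \<open>N\<close> of the
weighted function, so \<open>N \<le> A + N / 2\<close>; boundedness allows \<open>N\<close> to be cancelled.\<close>

lemma gronwall_ennreal:
  fixes y :: "real \<Rightarrow> ennreal"
  assumes bounded: "\<And>s. s \<in> {a..b} \<Longrightarrow> y s \<le> K" "K < \<infinity>" and \<beta>: "0 < \<beta>"
    and le: "\<And>s. s \<in> {a..b} \<Longrightarrow> y s \<le> A + ennreal \<beta> * (\<integral>\<^sup>+r\<in>{a..s}. y r \<partial>lborel)"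
    and s: "s \<in> {a..b}"
  shows "y s \<le> ennreal (2 * exp (2 * \<beta> * (b - a))) * A"
proof -
  define w where "w s = exp (- (2 * \<beta> * (s - a)))" for s
  have w: "0 < w s" for s by (simp add: w_def)
  define N where "N = (SUP s\<in>{a..b}. ennreal (w s) * y s)"
  have N_upper: "ennreal (w s) * y s \<le> N" if "s \<in> {a..b}" for s
    unfolding N_def using that by (rule SUP_upper)
  have w1: "w s \<le> 1" if "s \<in> {a..b}" for s using that \<beta> by (auto simp: w_def)
  have "N \<le> K"
    unfolding N_def
  proof (rule SUP_least)
    fix s assume s: "s \<in> {a..b}"
    have "ennreal (w s) * y s \<le> 1 * K"
      using w1[OF s] bounded(1)[OF s] by (intro mult_mono) auto
    then show "ennreal (w s) * y s \<le> K" by simp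
  qed
  then have "N < \<infinity>" using bounded(2) by (rule le_less_trans)
  have y_le: "y r \<le> N * ennreal (exp (2 * \<beta> * (r - a)))" if "r \<in> {a..b}" for r
  proof -
    have "y r = ennreal (exp (2 * \<beta> * (r - a))) * (ennreal (w r) * y r)"
      unfolding mult.assoc[symmetric] by (simp add: w_def ennreal_mult''[symmetric] mult_exp_exp)
    also have "\<dots> \<le> ennreal (exp (2 * \<beta> * (r - a))) * N"
      by (intro mult_left_mono N_upper that) simp
    finally show ?thesis by (simp add: mult.commute)
  qed
  have int_le: "ennreal (w s) * (ennreal \<beta> * (\<integral>\<^sup>+r\<in>{a..s}. y r \<partial>lborel)) \<le> N * ennreal (1/2)" if s: "s \<in> {a..b}" for s
  proof -
    have "(\<integral>\<^sup>+r\<in>{a..s}. y r \<partial>lborel) \<le> (\<integral>\<^sup>+r. N * (ennreal (exp (2 * \<beta> * (r - a))) * indicator {a..s} r) \<partial>lborel)"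
      using y_le s by (intro nn_integral_mono) (auto simp: indicator_def)
    also have "\<dots> = N * (\<integral>\<^sup>+r\<in>{a..s}. ennreal (exp (2 * \<beta> * (r - a))) \<partial>lborel)"
      by (intro nn_integral_cmult) auto
    also have "(\<integral>\<^sup>+r\<in>{a..s}. ennreal (exp (2 * \<beta> * (r - a))) \<partial>lborel) =
      ennreal (exp (2 * \<beta> * (s - a)) / (2 * \<beta>) - exp (2 * \<beta> * (a - a)) / (2 * \<beta>))"
    proof (rule nn_integral_FTC_Icc[where F = "\<lambda>r. exp (2 * \<beta> * (r - a)) / (2 * \<beta>)"])
      show "((\<lambda>r. exp (2 * \<beta> * (r - a)) / (2 * \<beta>)) has_real_derivative exp (2 * \<beta> * (x - a))) (at x)" for x
        using \<beta> by (auto intro!: derivative_eq_intros)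
    qed (use s in auto)
    also have "\<dots> \<le> ennreal (exp (2 * \<beta> * (s - a)) / (2 * \<beta>))"
      using \<beta> by (intro ennreal_leI) simp
    finally have "(\<integral>\<^sup>+r\<in>{a..s}. y r \<partial>lborel) \<le> N * ennreal (exp (2 * \<beta> * (s - a)) / (2 * \<beta>))"
      by (simp add: mult_left_mono)
    then have "ennreal (w s) * (ennreal \<beta> * (\<integral>\<^sup>+r\<in>{a..s}. y r \<partial>lborel)) \<le>
      ennreal (w s) * (ennreal \<beta> * (N * ennreal (exp (2 * \<beta> * (s - a)) / (2 * \<beta>))))"
      by (intro mult_left_mono) auto
    also have "\<dots> = N * (ennreal (w s) * (ennreal \<beta> * ennreal (exp (2 * \<beta> * (s - a)) / (2 * \<beta>))))"
      by (simp add: ac_simps)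
    also have "ennreal (w s) * (ennreal \<beta> * ennreal (exp (2 * \<beta> * (s - a)) / (2 * \<beta>))) = ennreal (1 / 2)"
    proof -
      have "w s * exp (2 * \<beta> * (s - a)) = 1" by (simp add: w_def mult_exp_exp)
      then have "w s * (\<beta> * (exp (2 * \<beta> * (s - a)) / (2 * \<beta>))) = 1 / 2" using \<beta> by simp
      moreover have "ennreal (w s) * (ennreal \<beta> * ennreal (exp (2 * \<beta> * (s - a)) / (2 * \<beta>))) =
        ennreal (w s * (\<beta> * (exp (2 * \<beta> * (s - a)) / (2 * \<beta>))))"
        using \<beta> w[of s] by (simp only: ennreal_mult[symmetric] less_imp_le mult_nonneg_nonneg divide_nonneg_nonneg exp_ge_zero zero_le_numeral)
      ultimately show ?thesis by (simp only:)
    qed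
    finally show ?thesis .
  qed
  have "N \<le> A + N * ennreal (1/2)"
    unfolding N_def
  proof (rule SUP_least, fold N_def)
    fix s assume s: "s \<in> {a..b}"
    have "ennreal (w s) * y s \<le> ennreal (w s) * A + ennreal (w s) * (ennreal \<beta> * (\<integral>\<^sup>+r\<in>{a..s}. y r \<partial>lborel))"
      unfolding distrib_left[symmetric] by (intro mult_left_mono le s) simp
    also have "\<dots> \<le> A + N * ennreal (1/2)"
      using int_le[OF s] mult_right_mono[of "ennreal (w s)" 1 A] w1[OF s] by (intro add_mono) auto
    finally show "ennreal (w s) * y s \<le> A + N * ennreal (1/2)" .
  qed
  obtain v where v: "N = ennreal v" "0 \<le> v" using \<open>N < \<infinity>\<close> by (cases N) auto
  have "N \<le> 2 * A"
  proof (cases A)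
    case (real \<alpha>)
    have "ennreal (\<alpha> + v * (1/2)) = ennreal \<alpha> + ennreal (v * (1/2))"
      by (rule ennreal_plus) (use real v in auto)
    also have "ennreal (v * (1/2)) = ennreal v * ennreal (1/2)"
      by (rule ennreal_mult) (use v in auto)
    finally have "ennreal v \<le> ennreal (\<alpha> + v * (1/2))"
      using \<open>N \<le> A + N * ennreal (1/2)\<close> real v by (simp only:)
    then have "v \<le> \<alpha> + v * (1/2)" using real v by (subst (asm) ennreal_le_iff) auto
    then have "v \<le> 2 * \<alpha>" by simp
    then have "ennreal v \<le> ennreal (2 * \<alpha>)" by (rule ennreal_leI)
    then show ?thesis using real v by (simp add: ennreal_mult)
  qed (simp add: ennreal_mult_top)
  have "y s \<le> N * ennreal (exp (2 * \<beta> * (s - a)))" by (rule y_le[OF s])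
  also have "\<dots> \<le> (2 * A) * ennreal (exp (2 * \<beta> * (b - a)))"
    using s \<beta> by (intro mult_mono \<open>N \<le> 2 * A\<close> ennreal_leI) auto
  also have "\<dots> = ennreal (2 * exp (2 * \<beta> * (b - a))) * A"
    by (simp add: ennreal_mult ac_simps)
  finally show ?thesis .
qed

text \<open>The time \<open>\<tau>\<close> at which the running integral last equals \<open>c\<close> (or \<open>b\<close>, if it never exceeds \<open>c\<close>) exists because
the running integral is continuous and increasing.\<close>

lemma clock:
  fixes v :: "real \<Rightarrow> real"
  assumes int: "set_integrable lborel {a..b} v" and nonneg: "\<And>s. s \<in> {a..b} \<Longrightarrow> 0 \<le> v s"
    and "a \<le> b" "0 \<le> c"
  obtains \<tau> where "\<tau> \<in> {a..b}" "\<And>s. s \<in> {a..b} \<Longrightarrow> (LBINT r:{a..s}. v r) \<le> c \<longleftrightarrow> s \<le> \<tau>"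
    "(LBINT r:{a..\<tau>}. v r) = min c (LBINT r:{a..b}. v r)"
proof -
  define V where "V s = (LBINT r:{a..s}. v r)" for s
  have int_s: "set_integrable lborel {a..s} v" if "s \<in> {a..b}" for s
    by (rule set_integrable_subset[OF int]) (use that in auto)
  have V_eq: "V s = integral {a..s} v" if "s \<in> {a..b}" for s
    unfolding V_def using int_s[OF that] by (rule set_borel_integral_eq_integral)
  have "continuous_on {a..b} (\<lambda>s. integral {a..s} v)"
    using set_borel_integral_eq_integral(1)[OF int] by (rule indefinite_integral_continuous_1)
  then have cont: "continuous_on {a..b} V"
    by (rule continuous_on_cong[THEN iffD1, rotated 2]) (simp_all add: V_eq)
  have mono: "V s \<le> V s'" if "s \<in> {a..b}" "s' \<in> {a..b}" "s \<le> s'" for s s'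
    unfolding V_eq[OF that(1)] V_eq[OF that(2)]
    by (rule integral_subset_le)
      (use that nonneg set_borel_integral_eq_integral(1)[OF int_s] in auto)
  have Va: "V a = 0"
    using V_eq[of a] \<open>a \<le> b\<close> by simp
  define S where "S = {s\<in>{a..b}. V s \<le> c}"
  have "compact S"
  proof -
    have "closed S"
      unfolding S_def using continuous_closed_preimage[OF cont closed_atLeastAtMost closed_atMost[of c]]
      by (simp add: vimage_def Int_def)
    moreover have "bounded S" by (rule bounded_subset[of "{a..b}"]) (auto simp: S_def)
    ultimately show ?thesis by (simp add: compact_eq_bounded_closed)
  qed
  moreover have "a \<in> S" using Va \<open>a \<le> b\<close> \<open>0 \<le> c\<close> by (simp add: S_def)
  ultimately obtain \<tau> where \<tau>: "\<tau> \<in> S" "\<And>s. s \<in> S \<Longrightarrow> s \<le> \<tau>"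
    using compact_attains_sup[of S] by auto
  show ?thesis
  proof
    show "\<tau> \<in> {a..b}" using \<tau> by (simp add: S_def)
    show "(LBINT r:{a..s}. v r) \<le> c \<longleftrightarrow> s \<le> \<tau>" if "s \<in> {a..b}" for s
    proof
      assume "(LBINT r:{a..s}. v r) \<le> c" then show "s \<le> \<tau>" using that by (intro \<tau>(2)) (simp add: S_def V_def)
    next
      assume "s \<le> \<tau>" then show "(LBINT r:{a..s}. v r) \<le> c"
        using mono[of s \<tau>] that \<tau>(1) by (auto simp: S_def V_def)
    qed
    show "(LBINT r:{a..\<tau>}. v r) = min c (LBINT r:{a..b}. v r)"
    proof (cases "V b \<le> c")
      case True
      then have "\<tau> = b" using \<tau>(2)[of b] \<tau>(1) \<open>a \<le> b\<close> by (auto simp: S_def)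
      then show ?thesis using True by (simp add: V_def min_def)
    next
      case False
      obtain s where s: "a \<le> s" "s \<le> b" "V s = c"
        using IVT'[of V a c b] False Va \<open>a \<le> b\<close> \<open>0 \<le> c\<close> cont by auto
      then have "s \<le> \<tau>" by (intro \<tau>(2)) (simp add: S_def)
      then have "c \<le> V \<tau>" using mono[of s \<tau>] s \<tau>(1) by (simp add: S_def)
      then have "V \<tau> = c" using \<tau>(1) by (simp add: S_def)
      then show ?thesis using False by (simp add: V_def min_def)
    qed
  qed
qed

text \<open>Truncating a running integral at level \<open>c\<close> is the same as integrating only while it is at most \<open>c\<close>.
This is what makes \<open>truncated_ito_inequality\<close> usable inside Gronwall's lemma.\<close>

lemma nn_integral_clock:
  fixes v :: "real \<Rightarrow> real"
  assumes [measurable]: "v \<in> borel_measurable borel" and nonneg: "\<And>s. 0 \<le> v s"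
    and fin: "(\<integral>\<^sup>+r\<in>{a..b}. ennreal (v r) \<partial>lborel) < \<infinity>" and "0 \<le> c"
  shows "min (ennreal c) (\<integral>\<^sup>+r\<in>{a..b}. ennreal (v r) \<partial>lborel) =
    (\<integral>\<^sup>+r\<in>{a..b}. indicator {r. (\<integral>\<^sup>+q\<in>{a..r}. ennreal (v q) \<partial>lborel) \<le> ennreal c} r * ennreal (v r) \<partial>lborel)"
proof (cases "a \<le> b")
  case True
  have int: "set_integrable lborel {a..b} v"
    by (rule set_integrable_if_nn_integral_finite) (use nonneg fin in auto)
  have int_s: "(\<integral>\<^sup>+r\<in>{a..s}. ennreal (v r) \<partial>lborel) = ennreal (LBINT r:{a..s}. v r)" if "s \<in> {a..b}" for s
    by (rule nn_integral_eq_set_lebesgue_integral[OF set_integrable_subset[OF int]]) (use that nonneg in auto)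
  have nn: "0 \<le> (LBINT r:A. v r)" for A
    unfolding set_lebesgue_integral_def by (rule Bochner_Integration.integral_nonneg) (simp add: nonneg)
  obtain \<tau> where \<tau>: "\<tau> \<in> {a..b}" "\<And>s. s \<in> {a..b} \<Longrightarrow> (LBINT r:{a..s}. v r) \<le> c \<longleftrightarrow> s \<le> \<tau>"
    "(LBINT r:{a..\<tau>}. v r) = min c (LBINT r:{a..b}. v r)"
    using clock[OF int nonneg True \<open>0 \<le> c\<close>] by metis
  have "min (ennreal c) (\<integral>\<^sup>+r\<in>{a..b}. ennreal (v r) \<partial>lborel) = ennreal (min c (LBINT r:{a..b}. v r))"
    using True \<open>0 \<le> c\<close> nn by (simp add: int_s ennreal_min)
  also have "\<dots> = (\<integral>\<^sup>+r\<in>{a..\<tau>}. ennreal (v r) \<partial>lborel)"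
    using \<tau> by (simp add: int_s)
  also have "\<dots> = (\<integral>\<^sup>+r\<in>{a..b}. indicator {r. (\<integral>\<^sup>+q\<in>{a..r}. ennreal (v q) \<partial>lborel) \<le> ennreal c} r * ennreal (v r) \<partial>lborel)"
  proof (rule nn_integral_cong)
    fix r
    have "(\<integral>\<^sup>+q\<in>{a..r}. ennreal (v q) \<partial>lborel) \<le> ennreal c \<longleftrightarrow> r \<le> \<tau>" if "r \<in> {a..b}"
      using \<tau>(2)[OF that] \<open>0 \<le> c\<close> by (simp add: int_s[OF that] ennreal_le_iff)
    then show "ennreal (v r) * indicator {a..\<tau>} r =
      indicator {r. (\<integral>\<^sup>+q\<in>{a..r}. ennreal (v q) \<partial>lborel) \<le> ennreal c} r * ennreal (v r) * indicator {a..b} r"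
      using \<tau>(1) by (cases "r \<in> {a..b}"; cases "r \<le> \<tau>") simp_all
  qed
  finally show ?thesis .
qed simp

section \<open>Moment bounds driven by a clock\<close>

context brownian_basis
begin

lemma tonelli_time:
  fixes X :: "real \<Rightarrow> 'a \<Rightarrow> ennreal"
  assumes [measurable]: "jointly_measurable X"
  shows "(\<EE> \<omega>. (\<integral>\<^sup>+r\<in>{a..s}. X r \<omega> \<partial>lborel)) = (\<integral>\<^sup>+r\<in>{a..s}. (\<EE> \<omega>. X r \<omega>) \<partial>lborel)"
proof -
  interpret pair_sigma_finite lborel \<Omega> ..
  have "(\<EE> \<omega>. (\<integral>\<^sup>+r\<in>{a..s}. X r \<omega> \<partial>lborel)) = (\<integral>\<^sup>+r. (\<EE> \<omega>. X r \<omega> * indicator {a..s} r) \<partial>lborel)"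
    by (rule Fubini') measurable
  also have "\<dots> = (\<integral>\<^sup>+r\<in>{a..s}. (\<EE> \<omega>. X r \<omega>) \<partial>lborel)"
    by (intro nn_integral_cong nn_integral_multc) measurable
  finally show ?thesis .
qed

lemma running_integral_measurable:
  fixes X :: "real \<Rightarrow> 'a \<Rightarrow> ennreal"
  assumes [measurable]: "jointly_measurable X"
  shows "jointly_measurable (\<lambda>s \<omega>. \<integral>\<^sup>+r\<in>{a..s}. X r \<omega> \<partial>lborel)"
proof -
  have "(\<lambda>z. \<integral>\<^sup>+r. (if a \<le> r \<and> r \<le> fst z then X r (snd z) else 0) \<partial>lborel) \<in> borel_measurable (borel \<Otimes>\<^sub>M \<Omega>)"
    by (rule lborel.borel_measurable_nn_integral) measurable
  moreover have "(\<integral>\<^sup>+r. (if a \<le> r \<and> r \<le> s then X r \<omega> else 0) \<partial>lborel) = (\<integral>\<^sup>+r\<in>{a..s}. X r \<omega> \<partial>lborel)" for s \<omega>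
    by (intro nn_integral_cong) (auto simp: indicator_def)
  ultimately show ?thesis by (simp add: case_prod_beta')
qed

text \<open>Gronwall's lemma for \<open>E U\<close> requires that \<open>E U\<close> be bounded beforehand, which is not known.  The
expectation is therefore taken over the event \<open>Q s \<le> R\<close>, where \<open>Q\<close> is the clock \<open>\<integral>\<^sub>a H\<^sup>2\<close>; as \<open>Q\<close> increases, this
event only shrinks with \<open>s\<close>, so the inequality for \<open>U\<close> survives the restriction.  A first application of
Gronwall's lemma shows that the restricted expectation is finite, a second one gives a bound without \<open>R\<close>.\<close>

lemma moment_bound:
  fixes U :: "real \<Rightarrow> 'a \<Rightarrow> ennreal"
  assumes ab: "0 \<le> a" "b \<le> T" and \<beta>: "0 < \<beta>"
    and [measurable]: "jointly_measurable U" "A \<in> borel_measurable \<Omega>"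
    and D: "\<And>s. s \<in> {a..b} \<Longrightarrow> ito_limit a s H (D s)"
    and le: "\<And>s. s \<in> {a..b} \<Longrightarrow> AE \<omega> in \<Omega>. U s \<omega> \<le> A \<omega> + ennreal \<beta> * (\<integral>\<^sup>+r\<in>{a..s}. U r \<omega> \<partial>lborel) + 3 * ennreal ((D s \<omega>)\<^sup>2)"
    and HU: "\<And>s \<omega>. s \<in> {a..b} \<Longrightarrow> \<omega> \<in> space \<Omega> \<Longrightarrow> ennreal ((H s \<omega>)\<^sup>2) \<le> ennreal \<beta> * U s \<omega>"
    and fin: "AE \<omega> in \<Omega>. (\<integral>\<^sup>+r\<in>{a..b}. U r \<omega> \<partial>lborel) < \<infinity>"
    and s: "s \<in> {a..b}"
  shows "(\<EE> \<omega>. U s \<omega>) \<le> ennreal (2 * exp (8 * \<beta> * (b - a))) * (\<EE> \<omega>. A \<omega>)"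
proof (cases "(\<EE> \<omega>. A \<omega>) = \<infinity>")
  case False
  define EA where "EA = (\<EE> \<omega>. A \<omega>)"
  have EA: "EA < \<infinity>" using False by (simp add: EA_def less_top)
  have mH[measurable]: "jointly_measurable H"
    using D[OF s] by (simp add: ito_limit_def)
  have mD[measurable]: "D r \<in> borel_measurable \<Omega>" if "r \<in> {a..b}" for r
    using D[OF that] by (simp add: ito_limit_def)
  define Q where "Q r \<omega> = (energy a r (\<lambda>q. H q \<omega>))" for r \<omega>
  have mQ[measurable]: "jointly_measurable Q"
    unfolding Q_def by (rule running_integral_measurable) measurable
  have Q_mono: "Q r \<omega> \<le> Q r' \<omega>" if "r \<le> r'" for r r' \<omega>
    unfolding Q_def using that by (intro nn_integral_mono) (auto simp: indicator_def)
  have Q_fin: "AE \<omega> in \<Omega>. Q r \<omega> < \<infinity>" if "r \<in> {a..b}" for r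
    using D[OF that] by (simp add: ito_limit_def Q_def)
  define B :: "nat \<Rightarrow> real \<Rightarrow> 'a \<Rightarrow> ennreal" where "B R r \<omega> = indicator {\<omega>. Q r \<omega> \<le> ennreal (real R)} \<omega>" for R r \<omega>
  have B_anti: "B R r' \<omega> \<le> B R r \<omega>" if "r \<le> r'" for R r r' \<omega>
    using Q_mono[OF that, of \<omega>] by (auto simp: B_def indicator_def intro: order_trans)
  have [measurable]: "jointly_measurable (B R)" for R
    unfolding B_def indicator_def by measurable
  have B1: "B R r \<omega> \<le> 1" for R r \<omega> by (simp add: B_def indicator_def)
  \<comment> \<open>The factor \<open>g\<close> is the indicator of \<open>\<integral> U \<le> N\<close> in the first pass and \<open>1\<close> in the second.\<close>
  have basic: "(\<EE> \<omega>. g \<omega> * B R r \<omega> * U r \<omega>) \<le> EA + ennreal \<beta> * (\<integral>\<^sup>+q\<in>{a..r}. (\<EE> \<omega>. g \<omega> * B R q \<omega> * U q \<omega>) \<partial>lborel)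
      + 3 * (\<EE> \<omega>. min (ennreal (real R)) (Q r \<omega>))"
    if r: "r \<in> {a..b}" and [measurable]: "g \<in> borel_measurable \<Omega>" and g1: "\<And>\<omega>. g \<omega> \<le> 1" for g R r
  proof -
    have [measurable]: "(\<lambda>\<omega>. \<integral>\<^sup>+q\<in>{a..r}. (g \<omega> * B R q \<omega> * U q \<omega>) \<partial>lborel) \<in> borel_measurable \<Omega>"
      by measurable
    have "(\<EE> \<omega>. g \<omega> * B R r \<omega> * U r \<omega>) \<le>
      (\<EE> \<omega>. A \<omega> + ennreal \<beta> * (\<integral>\<^sup>+q\<in>{a..r}. (g \<omega> * B R q \<omega> * U q \<omega>) \<partial>lborel) + 3 * (B R r \<omega> * ennreal ((D r \<omega>)\<^sup>2)))"
    proof (rule nn_integral_mono_AE, use le[OF r] AE_space in eventually_elim)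
      case (elim \<omega>)
      note [measurable] = \<open>\<omega> \<in> space \<Omega>\<close>
      have "g \<omega> * B R r \<omega> * U r \<omega> \<le> g \<omega> * B R r \<omega> * (A \<omega> + ennreal \<beta> * (\<integral>\<^sup>+q\<in>{a..r}. U q \<omega> \<partial>lborel) + 3 * ennreal ((D r \<omega>)\<^sup>2))"
        using elim by (intro mult_left_mono) auto
      also have "\<dots> = g \<omega> * B R r \<omega> * A \<omega> + ennreal \<beta> * (g \<omega> * B R r \<omega> * (\<integral>\<^sup>+q\<in>{a..r}. U q \<omega> \<partial>lborel)) + 3 * (g \<omega> * (B R r \<omega> * ennreal ((D r \<omega>)\<^sup>2)))"
        by (simp add: algebra_simps)
      also have "\<dots> \<le> 1 * A \<omega> + ennreal \<beta> * (\<integral>\<^sup>+q\<in>{a..r}. (g \<omega> * B R q \<omega> * U q \<omega>) \<partial>lborel) + 3 * (1 * (B R r \<omega> * ennreal ((D r \<omega>)\<^sup>2)))"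
      proof (intro add_mono mult_left_mono mult_right_mono)
        show "g \<omega> * B R r \<omega> \<le> 1" using mult_mono[OF g1 B1] by simp
        have "g \<omega> * B R r \<omega> * (\<integral>\<^sup>+q\<in>{a..r}. U q \<omega> \<partial>lborel) = (\<integral>\<^sup>+q. g \<omega> * B R r \<omega> * (U q \<omega> * indicator {a..r} q) \<partial>lborel)"
          by (rule nn_integral_cmult[symmetric]) measurable
        also have "\<dots> \<le> (\<integral>\<^sup>+q\<in>{a..r}. (g \<omega> * B R q \<omega> * U q \<omega>) \<partial>lborel)"
          using B_anti by (intro nn_integral_mono) (auto simp: indicator_def intro!: mult_mono)
        finally show "g \<omega> * B R r \<omega> * (\<integral>\<^sup>+q\<in>{a..r}. U q \<omega> \<partial>lborel) \<le> (\<integral>\<^sup>+q\<in>{a..r}. (g \<omega> * B R q \<omega> * U q \<omega>) \<partial>lborel)" .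
      qed (use g1 in auto)
      finally show ?case by simp
    qed
    also have "\<dots> = EA + ennreal \<beta> * (\<EE> \<omega>. (\<integral>\<^sup>+q\<in>{a..r}. (g \<omega> * B R q \<omega> * U q \<omega>) \<partial>lborel)) + 3 * (\<EE> \<omega>. B R r \<omega> * ennreal ((D r \<omega>)\<^sup>2))"
      using mD[OF r] by (simp add: nn_integral_add nn_integral_cmult EA_def)
    also have "(\<EE> \<omega>. (\<integral>\<^sup>+q\<in>{a..r}. (g \<omega> * B R q \<omega> * U q \<omega>) \<partial>lborel)) = (\<integral>\<^sup>+q\<in>{a..r}. (\<EE> \<omega>. g \<omega> * B R q \<omega> * U q \<omega>) \<partial>lborel)"
      by (rule tonelli_time) measurable
    finally show ?thesis
      using truncated_ito_inequality[OF D[OF r], of "real R"] r ab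
      by (auto simp: B_def Q_def elim!: order_trans intro!: add_mono mult_left_mono)
  qed
  have min_le: "(\<EE> \<omega>. min (ennreal (real R)) (Q r \<omega>)) \<le> ennreal (real R)" for R r
  proof -
    have "(\<EE> \<omega>. min (ennreal (real R)) (Q r \<omega>)) \<le> (\<EE> \<omega>. ennreal (real R))"
      by (intro nn_integral_mono) simp
    then show ?thesis by (simp add: emeasure_space_1)
  qed
  define c1 where "c1 = ennreal (2 * exp (2 * \<beta> * (b - a)))"
  \<comment> \<open>Restricted to \<open>\<integral> U \<le> N\<close> the expectation is bounded, so Gronwall applies; the crude bound \<open>R\<close> for the
    stochastic integral keeps the result independent of \<open>N\<close>.\<close>
  have pass1: "(\<EE> \<omega>. B R r \<omega> * U r \<omega>) \<le> c1 * (EA + 3 * ennreal (real R))" if r: "r \<in> {a..b}" for r R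
  proof (rule nn_integral_le_by_exhaustion[OF _ _ fin])
    fix N :: nat
    define g :: "'a \<Rightarrow> ennreal" where "g = indicator {\<omega>. (\<integral>\<^sup>+r\<in>{a..b}. U r \<omega> \<partial>lborel) \<le> of_nat N}"
    have [measurable]: "g \<in> borel_measurable \<Omega>" unfolding g_def indicator_def by measurable
    have g1: "g \<omega> \<le> 1" for \<omega> by (simp add: g_def indicator_def)
    define y where "y r = (\<EE> \<omega>. g \<omega> * B R r \<omega> * U r \<omega>)" for r
    have y_le: "y r \<le> (EA + 3 * ennreal (real R)) + ennreal \<beta> * (\<integral>\<^sup>+q\<in>{a..r}. y q \<partial>lborel)" if "r \<in> {a..b}" for r
    proof -
      have "y r \<le> EA + ennreal \<beta> * (\<integral>\<^sup>+q\<in>{a..r}. y q \<partial>lborel) + 3 * (\<EE> \<omega>. min (ennreal (real R)) (Q r \<omega>))"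
        unfolding y_def by (rule basic) (use that g1 in auto)
      also have "\<dots> \<le> EA + ennreal \<beta> * (\<integral>\<^sup>+q\<in>{a..r}. y q \<partial>lborel) + 3 * ennreal (real R)"
        by (intro add_mono mult_left_mono min_le) auto
      finally show ?thesis by (simp add: ac_simps)
    qed
    have int_y: "(\<integral>\<^sup>+q\<in>{a..r}. y q \<partial>lborel) \<le> of_nat N" if "r \<in> {a..b}" for r
    proof -
      have "(\<integral>\<^sup>+q\<in>{a..r}. y q \<partial>lborel) = (\<EE> \<omega>. (\<integral>\<^sup>+q\<in>{a..r}. (g \<omega> * B R q \<omega> * U q \<omega>) \<partial>lborel))"
        unfolding y_def by (rule tonelli_time[symmetric]) measurable
      also have "\<dots> \<le> (\<EE> \<omega>. of_nat N)"
      proof (rule nn_integral_mono)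
        fix \<omega> assume [measurable]: "\<omega> \<in> space \<Omega>"
        show "(\<integral>\<^sup>+q\<in>{a..r}. (g \<omega> * B R q \<omega> * U q \<omega>) \<partial>lborel) \<le> of_nat N"
        proof (cases "(\<integral>\<^sup>+r\<in>{a..b}. U r \<omega> \<partial>lborel) \<le> of_nat N")
          case True
          have "(\<integral>\<^sup>+q\<in>{a..r}. (g \<omega> * B R q \<omega> * U q \<omega>) \<partial>lborel) \<le> (\<integral>\<^sup>+q\<in>{a..b}. U q \<omega> \<partial>lborel)"
          proof (rule nn_integral_mono)
            fix q
            have "g \<omega> * B R q \<omega> * U q \<omega> \<le> 1 * 1 * U q \<omega>" by (intro mult_right_mono mult_mono g1 B1) auto
            then show "g \<omega> * B R q \<omega> * U q \<omega> * indicator {a..r} q \<le> U q \<omega> * indicator {a..b} q"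
              using that by (auto simp: indicator_def)
          qed
          then show ?thesis using True by (rule order_trans)
        next
          case False
          then have "g \<omega> = 0" by (simp add: g_def)
          then show ?thesis by simp
        qed
      qed
      finally show ?thesis by (simp add: emeasure_space_1)
    qed
    have "y r \<le> c1 * (EA + 3 * ennreal (real R))"
      unfolding c1_def
    proof (rule gronwall_ennreal[OF _ _ \<beta> y_le r])
      show "y r \<le> (EA + 3 * ennreal (real R)) + ennreal \<beta> * of_nat N" if "r \<in> {a..b}" for r
        using y_le[OF that] int_y[OF that] by (auto elim!: order_trans intro!: add_mono mult_left_mono)
      show "(EA + 3 * ennreal (real R)) + ennreal \<beta> * of_nat N < \<infinity>"
        using EA by (simp add: ennreal_mult_less_top of_nat_less_top)
    qed
    then show "(\<EE> \<omega>. indicator {\<omega>. (\<integral>\<^sup>+r\<in>{a..b}. U r \<omega> \<partial>lborel) \<le> of_nat N} \<omega> * (B R r \<omega> * U r \<omega>)) \<le> c1 * (EA + 3 * ennreal (real R))"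
      by (simp add: y_def g_def mult.assoc)
  qed measurable
  \<comment> \<open>Finiteness being known, the stochastic integral is now estimated by \<open>U\<close> itself, which removes \<open>R\<close>.\<close>
  have pass2: "(\<EE> \<omega>. B R r \<omega> * U r \<omega>) \<le> ennreal (2 * exp (2 * (4 * \<beta>) * (b - a))) * EA" if r: "r \<in> {a..b}" for r R
  proof (rule gronwall_ennreal[OF pass1 _ _ _ r])
    show "c1 * (EA + 3 * ennreal (real R)) < \<infinity>"
      using EA by (simp add: c1_def ennreal_mult_less_top)
    show "0 < 4 * \<beta>" using \<beta> by simp
    fix r assume r: "r \<in> {a..b}"
    define y where "y r = (\<EE> \<omega>. B R r \<omega> * U r \<omega>)" for r
    have min_le: "(\<EE> \<omega>. min (ennreal (real R)) (Q r \<omega>)) \<le> ennreal \<beta> * (\<integral>\<^sup>+q\<in>{a..r}. y q \<partial>lborel)"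
    proof -
      have "(\<EE> \<omega>. min (ennreal (real R)) (Q r \<omega>)) \<le> (\<EE> \<omega>. ennreal \<beta> * (\<integral>\<^sup>+q\<in>{a..r}. (B R q \<omega> * U q \<omega>) \<partial>lborel))"
      proof (rule nn_integral_mono_AE, use Q_fin[OF r] AE_space in eventually_elim)
        case (elim \<omega>)
        note [measurable] = \<open>\<omega> \<in> space \<Omega>\<close>
        have "min (ennreal (real R)) (Q r \<omega>) = (\<integral>\<^sup>+q\<in>{a..r}. (B R q \<omega> * ennreal ((H q \<omega>)\<^sup>2)) \<partial>lborel)"
          unfolding Q_def
          by (subst nn_integral_clock) (use elim in \<open>auto simp: Q_def B_def indicator_def intro!: nn_integral_cong\<close>)
        also have "\<dots> \<le> (\<integral>\<^sup>+q. ennreal \<beta> * ((B R q \<omega> * U q \<omega>) * indicator {a..r} q) \<partial>lborel)"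
        proof (rule nn_integral_mono)
          fix q
          have "B R q \<omega> * ennreal ((H q \<omega>)\<^sup>2) \<le> B R q \<omega> * (ennreal \<beta> * U q \<omega>)" if "q \<in> {a..r}"
            using HU[of q \<omega>] that r elim by (intro mult_left_mono) auto
          then show "B R q \<omega> * ennreal ((H q \<omega>)\<^sup>2) * indicator {a..r} q \<le> ennreal \<beta> * ((B R q \<omega> * U q \<omega>) * indicator {a..r} q)"
            by (cases "q \<in> {a..r}") (auto simp: ac_simps)
        qed
        also have "\<dots> = ennreal \<beta> * (\<integral>\<^sup>+q\<in>{a..r}. (B R q \<omega> * U q \<omega>) \<partial>lborel)"
          by (rule nn_integral_cmult) measurable
        finally show ?case .
      qed
      also have "\<dots> = ennreal \<beta> * (\<EE> \<omega>. (\<integral>\<^sup>+q\<in>{a..r}. (B R q \<omega> * U q \<omega>) \<partial>lborel))"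
        by (rule nn_integral_cmult) measurable
      also have "(\<EE> \<omega>. (\<integral>\<^sup>+q\<in>{a..r}. (B R q \<omega> * U q \<omega>) \<partial>lborel)) = (\<integral>\<^sup>+q\<in>{a..r}. y q \<partial>lborel)"
        unfolding y_def by (rule tonelli_time) measurable
      finally show ?thesis .
    qed
    have "y r \<le> EA + ennreal \<beta> * (\<integral>\<^sup>+q\<in>{a..r}. y q \<partial>lborel) + 3 * (\<EE> \<omega>. min (ennreal (real R)) (Q r \<omega>))"
      using basic[OF r, of "\<lambda>_. 1" R] by (simp add: y_def)
    also have "\<dots> \<le> EA + ennreal \<beta> * (\<integral>\<^sup>+q\<in>{a..r}. y q \<partial>lborel) + 3 * (ennreal \<beta> * (\<integral>\<^sup>+q\<in>{a..r}. y q \<partial>lborel))"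
      by (intro add_mono mult_left_mono min_le) auto
    also have "\<dots> = EA + (1 + 3) * (ennreal \<beta> * (\<integral>\<^sup>+q\<in>{a..r}. y q \<partial>lborel))"
      unfolding distrib_right by (simp add: add.assoc)
    also have "\<dots> = EA + ennreal (4 * \<beta>) * (\<integral>\<^sup>+q\<in>{a..r}. y q \<partial>lborel)"
      using \<beta> by (simp add: ennreal_mult mult.assoc)
    finally show "(\<EE> \<omega>. B R r \<omega> * U r \<omega>) \<le> EA + ennreal (4 * \<beta>) * (\<integral>\<^sup>+q\<in>{a..r}. (\<EE> \<omega>. B R q \<omega> * U q \<omega>) \<partial>lborel)"
      unfolding y_def .
  qed
  show ?thesis
  proof (rule nn_integral_le_by_exhaustion[OF _ _ Q_fin[OF s]])
    fix N :: nat
    show "(\<EE> \<omega>. indicator {\<omega>. Q s \<omega> \<le> of_nat N} \<omega> * U s \<omega>) \<le> ennreal (2 * exp (8 * \<beta> * (b - a))) * (\<EE> \<omega>. A \<omega>)"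
      using pass2[OF s, of N] by (simp add: B_def EA_def ennreal_of_nat_eq_real_of_nat)
  qed measurable
qed (simp add: ennreal_mult_top)

end

section \<open>Solutions with Lipschitz coefficients\<close>

lemma LBINT_combine:
  fixes g :: "real \<Rightarrow> real"
  assumes "set_integrable lborel {t..u} g" "t \<le> a" "a \<le> s" "s \<le> u"
  shows "(LBINT r:{t..s}. g r) = (LBINT r:{t..a}. g r) + (LBINT r:{a..s}. g r)"
proof -
  have *: "set_integrable lborel {x..y} g" if "t \<le> x" "y \<le> u" for x y
    by (rule set_integrable_subset[OF assms(1)]) (use that in auto)
  show ?thesis
    using assms * set_borel_integral_eq_integral[OF *]
    by (simp add: Henstock_Kurzweil_Integration.integral_combine)
qed

text \<open>The Cauchy-Schwarz inequality, from the nonnegative integral of the squared deviation of \<open>g\<close> from its mean.\<close>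

lemma square_LBINT_le:
  fixes g :: "real \<Rightarrow> real"
  assumes g: "set_integrable lborel {a..b} g" and "a \<le> b"
  shows "ennreal ((LBINT r:{a..b}. g r)\<^sup>2) \<le> ennreal (b - a) * (energy a b g)"
proof (cases "a = b")
  case True
  have "(LBINT r:{a..b}. g r) = 0"
    using True set_borel_integral_eq_integral(2)[OF g] by simp
  then show ?thesis by simp
next
  case False
  then have l: "0 < b - a" using assms by simp
  have [measurable]: "(\<lambda>r. indicator {a..b} r *\<^sub>R g r) \<in> borel_measurable borel"
    using g by (auto simp: set_integrable_def dest: borel_measurable_integrable)
  define G where "G r = indicator {a..b} r * g r" for r
  have [measurable]: "G \<in> borel_measurable borel"
    using \<open>(\<lambda>r. indicator {a..b} r *\<^sub>R g r) \<in> borel_measurable borel\<close> by (simp add: G_def[abs_def])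
  have nn_eq: "(energy a b g) = (energy a b G)"
    by (intro nn_integral_cong) (auto simp: G_def indicator_def)
  show ?thesis
  proof (cases "(energy a b g) < \<infinity>")
    case True
    have int2: "set_integrable lborel {a..b} (\<lambda>r. (G r)\<^sup>2)"
      by (rule set_integrable_if_nn_integral_finite) (use True nn_eq in auto)
    have int1: "set_integrable lborel {a..b} G"
      using g by (simp add: set_integrable_def G_def[abs_def] indicator_inter_arith[symmetric] mult.assoc[symmetric])
    have intc: "set_integrable lborel {a..b} (\<lambda>r. c)" for c :: real
      using l by (simp add: set_integrable_def)
    define m where "m = (LBINT r:{a..b}. G r)"
    have m_eq: "(LBINT r:{a..b}. g r) = m"
      unfolding m_def by (intro set_lebesgue_integral_cong) (auto simp: G_def)
    have "0 \<le> (LBINT r:{a..b}. (G r - m / (b - a))\<^sup>2)"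
      unfolding set_lebesgue_integral_def by (rule Bochner_Integration.integral_nonneg) simp
    also have "(\<lambda>r. (G r - m / (b - a))\<^sup>2) = (\<lambda>r. (G r)\<^sup>2 - (2 * m / (b - a)) * G r + (m / (b - a))\<^sup>2)"
      by (simp add: power2_diff fun_eq_iff algebra_simps)
    also have "(LBINT r:{a..b}. (G r)\<^sup>2 - (2 * m / (b - a)) * G r + (m / (b - a))\<^sup>2) =
      (LBINT r:{a..b}. (G r)\<^sup>2) - (2 * m / (b - a)) * m + (m / (b - a))\<^sup>2 * (b - a)"
      using l int1 int2 intc
      by (subst set_integral_add; (subst set_integral_diff)?) (auto simp: m_def set_integral_mult_right set_integral_const mult.commute)
    also have "\<dots> = (LBINT r:{a..b}. (G r)\<^sup>2) - m\<^sup>2 / (b - a)"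
    proof -
      have *: "(m / l)\<^sup>2 * l = m\<^sup>2 / l" "2 * m / l * m = 2 * (m\<^sup>2 / l)" if "0 < l" for l :: real
        using that by (simp_all add: power2_eq_square)
      show ?thesis unfolding *[OF l] by (simp only: mult_2 diff_add_eq_diff_diff_swap)
    qed
    finally have "m\<^sup>2 \<le> (b - a) * (LBINT r:{a..b}. (G r)\<^sup>2)"
      using l by (simp add: field_simps)
    then have "ennreal (m\<^sup>2) \<le> ennreal (b - a) * ennreal (LBINT r:{a..b}. (G r)\<^sup>2)"
      using l by (subst ennreal_mult'[symmetric]) (auto intro: ennreal_leI)
    then show ?thesis
      unfolding m_eq nn_eq by (subst nn_integral_eq_set_lebesgue_integral[OF int2]) auto
  next
    case False
    then show ?thesis using l by (simp add: less_top[symmetric] ennreal_mult_top ennreal_top_mult)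
  qed
qed

lemma nn_integral_square_finite_if_continuous:
  fixes g :: "real \<Rightarrow> real"
  assumes "continuous_on {a..b} g"
  shows "(energy a b g) < \<infinity>"
proof -
  have "bounded (g ` {a..b})"
    using assms by (intro compact_imp_bounded compact_continuous_image) auto
  then obtain C where "\<forall>y\<in>g ` {a..b}. norm y \<le> C" by (auto simp: bounded_iff)
  then have C: "\<bar>g r\<bar> \<le> C" if "r \<in> {a..b}" for r using that by auto
  have "(g r)\<^sup>2 \<le> C\<^sup>2" if "r \<in> {a..b}" for r
    using power_mono[OF C[OF that], of 2] by simp
  then have "(energy a b g) \<le> (\<integral>\<^sup>+r. ennreal (C\<^sup>2) * indicator {a..b} r \<partial>lborel)"
    by (intro nn_integral_mono) (auto simp: indicator_def intro: ennreal_leI)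
  also have "\<dots> = ennreal (C\<^sup>2) * emeasure lborel {a..b}"
    by (simp add: nn_integral_cmult_indicator)
  also have "\<dots> < \<infinity>"
    by (cases "a \<le> b") (auto simp: ennreal_mult_less_top)
  finally show ?thesis .
qed

text \<open>The growth bounds follow from the Lipschitz bounds with \<open>\<alpha>\<close> bounding the coefficients at \<open>x = 0\<close>.\<close>

locale lipschitz_sde = brownian_basis \<Omega> F W T
  for \<Omega> :: "'a measure" and F W T +
  fixes f \<sigma> :: "real \<Rightarrow> real \<Rightarrow> real" and \<alpha> L :: real
  assumes L: "0 < L" and T_nonneg: "0 \<le> T"
    and growth_f: "s \<in> {0..T} \<Longrightarrow> \<bar>f s x\<bar> \<le> \<alpha> + L * \<bar>x\<bar>"
    and growth_\<sigma>: "s \<in> {0..T} \<Longrightarrow> \<bar>\<sigma> s x\<bar> \<le> \<alpha> + L * \<bar>x\<bar>"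
    and lipschitz_f: "s \<in> {0..T} \<Longrightarrow> \<bar>f s x - f s y\<bar> \<le> L * \<bar>x - y\<bar>"
    and lipschitz_\<sigma>: "s \<in> {0..T} \<Longrightarrow> \<bar>\<sigma> s x - \<sigma> s y\<bar> \<le> L * \<bar>x - y\<bar>"
begin

text \<open>\<open>\<kappa>\<close> is a common factor for the squared growth and Lipschitz bounds.  \<open>\<beta>\<close> is a rate at which
\<open>moment_bound\<close> applies: it dominates \<open>\<kappa>\<close>, for the diffusion, and \<open>3 T \<kappa>\<close>, for the drift, where \<open>T\<close> comes from
the Cauchy-Schwarz inequality and \<open>3\<close> from the square of a sum of three terms.  \<open>C0\<close> is the resulting
constant over the whole of \<open>[0, T]\<close>.\<close>

definition \<kappa> :: real where "\<kappa> = 2 * (\<alpha>\<^sup>2 + L\<^sup>2)"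

definition \<beta> :: real where "\<beta> = (3 * T + 1) * \<kappa>"

definition C0 :: real where "C0 = 2 * exp (8 * \<beta> * T)"

lemma \<kappa>_pos: "0 < \<kappa>" "L\<^sup>2 \<le> \<kappa>"
  using L by (auto simp: \<kappa>_def add_nonneg_pos)

lemma \<beta>: "0 < \<beta>" "\<kappa> \<le> \<beta>" "3 * T * \<kappa> \<le> \<beta>"
proof -
  have "0 \<le> 3 * T * \<kappa>" using \<kappa>_pos T_nonneg by simp
  moreover have "\<beta> = 3 * T * \<kappa> + \<kappa>" by (simp add: \<beta>_def algebra_simps)
  ultimately show "0 < \<beta>" "\<kappa> \<le> \<beta>" "3 * T * \<kappa> \<le> \<beta>" using \<kappa>_pos by linarith+
qed

lemma C0: "0 < C0" "b - a \<le> T \<Longrightarrow> 2 * exp (8 * \<beta> * (b - a)) \<le> C0"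
  using \<beta> T_nonneg by (auto simp: C0_def)

lemma square_growth:
  assumes "\<bar>y\<bar> \<le> \<alpha> + L * \<bar>x\<bar>"
  shows "y\<^sup>2 \<le> \<kappa> * (1 + x\<^sup>2)"
proof -
  have "y\<^sup>2 \<le> (\<alpha> + L * \<bar>x\<bar>)\<^sup>2" using assms by (intro power2_le_iff_abs_le[THEN iffD2]) auto
  also have "\<dots> \<le> 2 * \<alpha>\<^sup>2 + 2 * (L * \<bar>x\<bar>)\<^sup>2" by (rule square_sum_le)
  also have "\<dots> \<le> \<kappa> * (1 + x\<^sup>2)" by (simp add: \<kappa>_def power_mult_distrib algebra_simps)
  finally show ?thesis .
qed

lemma square_lipschitz:
  assumes "\<bar>y\<bar> \<le> L * \<bar>x\<bar>"
  shows "y\<^sup>2 \<le> \<kappa> * x\<^sup>2"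
proof -
  have "y\<^sup>2 \<le> (L * \<bar>x\<bar>)\<^sup>2" using assms by (intro power2_le_iff_abs_le[THEN iffD2]) auto
  also have "\<dots> \<le> \<kappa> * x\<^sup>2" using \<kappa>_pos by (auto simp: power_mult_distrib intro: mult_right_mono)
  finally show ?thesis .
qed

text \<open>\<open>I\<close> is the stochastic integral term of a solution \<open>X\<close>.  The equation is recorded between arbitrary times
\<open>a \<le> s\<close>, the form in which two solutions with different starting times can be subtracted.\<close>

definition integral_part :: "real \<Rightarrow> real \<Rightarrow> (real \<Rightarrow> 'a \<Rightarrow> real) \<Rightarrow> (real \<Rightarrow> 'a \<Rightarrow> real) \<Rightarrow> bool" where
  "integral_part t p X I \<longleftrightarrow>
    (\<forall>a b. t \<le> a \<longrightarrow> a \<le> b \<longrightarrow> b \<le> T \<longrightarrow>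
      ito_limit a b (\<lambda>s \<omega>. \<sigma> (clamp_to t T s) (X (clamp_to t T s) \<omega>)) (\<lambda>\<omega>. I b \<omega> - I a \<omega>)) \<and>
    (AE \<omega> in \<Omega>. set_integrable lborel {t..T} (\<lambda>s. f s (X s \<omega>)) \<and> continuous_on {t..T} (\<lambda>s. X s \<omega>) \<and> X t \<omega> = p \<and>
      (\<forall>a\<in>{t..T}. \<forall>s\<in>{a..T}. X s \<omega> = X a \<omega> + (LBINT r:{a..s}. f r (X r \<omega>)) + (I s \<omega> - I a \<omega>)))"

lemma integral_part_ito:
  assumes "integral_part t p X I" "t \<le> a" "a \<le> b" "b \<le> T"
  shows "ito_limit a b (\<lambda>s \<omega>. \<sigma> (clamp_to t T s) (X (clamp_to t T s) \<omega>)) (\<lambda>\<omega>. I b \<omega> - I a \<omega>)"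
  using assms by (simp add: integral_part_def)

lemma integral_part_path:
  assumes "integral_part t p X I"
  shows "AE \<omega> in \<Omega>. continuous_on {t..T} (\<lambda>s. X s \<omega>) \<and> X t \<omega> = p"
  using assms unfolding integral_part_def by (elim conjE) (erule eventually_mono, elim conjE, intro conjI)

lemma integral_part_increment:
  assumes I: "integral_part t p X I" and "t \<le> a" "a \<le> s" "s \<le> T"
  shows "AE \<omega> in \<Omega>. set_integrable lborel {a..s} (\<lambda>r. f r (X r \<omega>)) \<and>
    X s \<omega> = X a \<omega> + (LBINT r:{a..s}. f r (X r \<omega>)) + (I s \<omega> - I a \<omega>)"
proof -
  have "AE \<omega> in \<Omega>. set_integrable lborel {t..T} (\<lambda>s. f s (X s \<omega>)) \<and>
      (\<forall>a\<in>{t..T}. \<forall>s\<in>{a..T}. X s \<omega> = X a \<omega> + (LBINT r:{a..s}. f r (X r \<omega>)) + (I s \<omega> - I a \<omega>))"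
    using I unfolding integral_part_def by (elim conjE) (erule eventually_mono, elim conjE, intro conjI)
  then show ?thesis
  proof (rule eventually_mono, elim conjE, intro conjI)
    fix \<omega>
    show "set_integrable lborel {a..s} (\<lambda>r. f r (X r \<omega>))" if "set_integrable lborel {t..T} (\<lambda>s. f s (X s \<omega>))"
      by (rule set_integrable_subset[OF that]) (use assms in auto)
    show "X s \<omega> = X a \<omega> + (LBINT r:{a..s}. f r (X r \<omega>)) + (I s \<omega> - I a \<omega>)"
      if "\<forall>a\<in>{t..T}. \<forall>s\<in>{a..T}. X s \<omega> = X a \<omega> + (LBINT r:{a..s}. f r (X r \<omega>)) + (I s \<omega> - I a \<omega>)"
      by (rule that[rule_format]) (use assms in auto)
  qed
qed

lemma integral_part_exists:
  assumes X: "strong_solution \<Omega> F W f \<sigma> t T p X" and t: "0 \<le> t" "t \<le> T"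
  shows "\<exists>I. integral_part t p X I"
proof -
  obtain I where ito: "ito_integral \<Omega> F W t T (\<lambda>s \<omega>. \<sigma> s (X s \<omega>)) I"
    and eq: "AE \<omega> in \<Omega>. \<forall>s\<in>{t..T}. X s \<omega> = p + (LBINT r:{t..s}. f r (X r \<omega>)) + I s \<omega>"
    using X unfolding strong_solution_def by blast
  have "AE \<omega> in \<Omega>. set_integrable lborel {t..T} (\<lambda>s. f s (X s \<omega>))" "AE \<omega> in \<Omega>. continuous_on {t..T} (\<lambda>s. X s \<omega>)"
    "AE \<omega> in \<Omega>. X t \<omega> = p"
    using X by (auto simp: strong_solution_def)
  then have "AE \<omega> in \<Omega>. set_integrable lborel {t..T} (\<lambda>s. f s (X s \<omega>)) \<and> continuous_on {t..T} (\<lambda>s. X s \<omega>) \<and> X t \<omega> = p \<and>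
      (\<forall>a\<in>{t..T}. \<forall>s\<in>{a..T}. X s \<omega> = X a \<omega> + (LBINT r:{a..s}. f r (X r \<omega>)) + (I s \<omega> - I a \<omega>))"
    using eq
  proof eventually_elim
    case (elim \<omega>)
    have "X s \<omega> = X a \<omega> + (LBINT r:{a..s}. f r (X r \<omega>)) + (I s \<omega> - I a \<omega>)" if "a \<in> {t..T}" "s \<in> {a..T}" for a s
      using LBINT_combine[OF elim(1), of a s] elim(4)[rule_format, of a] elim(4)[rule_format, of s] that by auto
    with elim show ?case by blast
  qed
  then show ?thesis
    unfolding integral_part_def using ito_limit_of_ito_integral[OF ito t(1)] by (intro exI[of _ I]) simp
qed

lemma solution_measurable:
  assumes "strong_solution \<Omega> F W f \<sigma> t T p X" "t \<le> T"
  shows "jointly_measurable (\<lambda>s \<omega>. X (clamp_to t T s) \<omega>)"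
  using assms by (intro progressive_clamp_measurable) (auto simp: strong_solution_def)

lemma drift_square_le:
  fixes g :: "real \<Rightarrow> real" and V :: "real \<Rightarrow> ennreal"
  assumes "set_integrable lborel {a..s} g" "a \<le> s" "s - a \<le> T"
    and g: "\<And>r. r \<in> {a..s} \<Longrightarrow> ennreal ((g r)\<^sup>2) \<le> ennreal \<kappa> * V r"
    and [measurable]: "V \<in> borel_measurable borel"
  shows "ennreal ((LBINT r:{a..s}. g r)\<^sup>2) \<le> ennreal (T * \<kappa>) * (\<integral>\<^sup>+r\<in>{a..s}. V r \<partial>lborel)"
proof -
  have "ennreal ((LBINT r:{a..s}. g r)\<^sup>2) \<le> ennreal (s - a) * (energy a s g)"
    by (rule square_LBINT_le) fact+
  also have "\<dots> \<le> ennreal T * (\<integral>\<^sup>+r. ennreal \<kappa> * (V r * indicator {a..s} r) \<partial>lborel)"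
  proof (rule mult_mono)
    show "(energy a s g) \<le> (\<integral>\<^sup>+r. ennreal \<kappa> * (V r * indicator {a..s} r) \<partial>lborel)"
      using g by (intro nn_integral_mono) (auto simp: indicator_def)
  qed (use assms(3) in \<open>auto intro: ennreal_leI\<close>)
  also have "\<dots> = ennreal (T * \<kappa>) * (\<integral>\<^sup>+r\<in>{a..s}. V r \<partial>lborel)"
    using T_nonneg \<kappa>_pos by (simp add: nn_integral_cmult ennreal_mult mult.assoc)
  finally show ?thesis .
qed

lemma drift_triple_le:
  assumes "z\<^sup>2 \<le> 3 * x\<^sup>2 + 3 * y\<^sup>2 + 3 * w\<^sup>2" and "ennreal (y\<^sup>2) \<le> ennreal (T * \<kappa>) * J"
  shows "ennreal (z\<^sup>2) \<le> 3 * ennreal (x\<^sup>2) + ennreal \<beta> * J + 3 * ennreal (w\<^sup>2)"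
proof -
  have "ennreal (z\<^sup>2) \<le> ennreal (3 * x\<^sup>2 + 3 * y\<^sup>2 + 3 * w\<^sup>2)" using assms(1) by (rule ennreal_leI)
  also have "\<dots> = 3 * ennreal (x\<^sup>2) + 3 * ennreal (y\<^sup>2) + 3 * ennreal (w\<^sup>2)" by (simp add: ennreal_mult)
  also have "\<dots> \<le> 3 * ennreal (x\<^sup>2) + 3 * (ennreal (T * \<kappa>) * J) + 3 * ennreal (w\<^sup>2)"
    using assms(2) by (intro add_mono mult_left_mono) auto
  also have "3 * (ennreal (T * \<kappa>) * J) = ennreal (3 * T * \<kappa>) * J"
    using T_nonneg \<kappa>_pos by (simp add: ennreal_mult mult.assoc)
  also have "\<dots> \<le> ennreal \<beta> * J" using \<beta> by (intro mult_right_mono ennreal_leI) auto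
  finally show ?thesis by (simp add: add_mono)
qed

text \<open>\<open>moment_bound\<close> with \<open>U = 1 + X\<^sup>2\<close>.\<close>

lemma solution_second_moment:
  assumes X: "strong_solution \<Omega> F W f \<sigma> t T p X" and t: "0 \<le> t" "t \<le> T" and s: "s \<in> {t..T}"
  shows "(\<EE> \<omega>. ennreal (1 + (X s \<omega>)\<^sup>2)) \<le> ennreal (C0 * (1 + 3 * p\<^sup>2))"
proof -
  obtain I where I: "integral_part t p X I" using integral_part_exists[OF X t] ..
  note ito = integral_part_ito[OF I] and path = integral_part_path[OF I]
  define Xc where "Xc s = X (clamp_to t T s)" for s
  have Xc: "Xc s = X s" if "s \<in> {t..T}" for s using that by (simp add: Xc_def)
  have [measurable]: "jointly_measurable Xc"
    unfolding Xc_def using solution_measurable[OF X] t by simp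
  define U where "U s \<omega> = ennreal (1 + (Xc s \<omega>)\<^sup>2)" for s \<omega>
  have [measurable]: "jointly_measurable U" unfolding U_def by measurable
  have "(\<EE> \<omega>. U s \<omega>) \<le> ennreal (2 * exp (8 * \<beta> * (T - t))) * (\<EE> \<omega>. ennreal (1 + 3 * p\<^sup>2))"
  proof (rule moment_bound[OF t(1) order_refl \<beta>(1) _ _ ito])
    show "AE \<omega> in \<Omega>. U s \<omega> \<le> ennreal (1 + 3 * p\<^sup>2) + ennreal \<beta> * (\<integral>\<^sup>+r\<in>{t..s}. U r \<omega> \<partial>lborel) + 3 * ennreal ((I s \<omega> - I t \<omega>)\<^sup>2)"
      if s: "s \<in> {t..T}" for s
    proof -
      have s1: "t \<le> s" and s2: "s \<le> T" using s by auto
      show ?thesis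
        using integral_part_increment[OF I order_refl s1 s2] path AE_space
      proof eventually_elim
        case (elim \<omega>)
        note [measurable] = \<open>\<omega> \<in> space \<Omega>\<close>
        let ?J = "LBINT r:{t..s}. f r (X r \<omega>)"
        have "ennreal (?J\<^sup>2) \<le> ennreal (T * \<kappa>) * (\<integral>\<^sup>+r\<in>{t..s}. U r \<omega> \<partial>lborel)"
        proof (rule drift_square_le)
          show "set_integrable lborel {t..s} (\<lambda>r. f r (X r \<omega>))" using elim by simp
          fix r assume r: "r \<in> {t..s}"
          then have "(f r (X r \<omega>))\<^sup>2 \<le> \<kappa> * (1 + (X r \<omega>)\<^sup>2)"
            using s t by (intro square_growth growth_f) auto
          then show "ennreal ((f r (X r \<omega>))\<^sup>2) \<le> ennreal \<kappa> * U r \<omega>"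
            using r s \<kappa>_pos unfolding U_def by (subst ennreal_mult[symmetric]) (auto simp: Xc intro!: ennreal_leI)
        qed (use s t in auto)
        moreover have "X s \<omega> = p + ?J + (I s \<omega> - I t \<omega>)"
          using elim by simp
        then have "(X s \<omega>)\<^sup>2 \<le> 3 * p\<^sup>2 + 3 * ?J\<^sup>2 + 3 * (I s \<omega> - I t \<omega>)\<^sup>2"
          using square_sum3_le by simp
        ultimately have "ennreal ((X s \<omega>)\<^sup>2) \<le> 3 * ennreal (p\<^sup>2) + ennreal \<beta> * (\<integral>\<^sup>+r\<in>{t..s}. U r \<omega> \<partial>lborel) + 3 * ennreal ((I s \<omega> - I t \<omega>)\<^sup>2)"
          by (intro drift_triple_le)
        then have "1 + ennreal ((X s \<omega>)\<^sup>2) \<le> 1 + (3 * ennreal (p\<^sup>2) + ennreal \<beta> * (\<integral>\<^sup>+r\<in>{t..s}. U r \<omega> \<partial>lborel) + 3 * ennreal ((I s \<omega> - I t \<omega>)\<^sup>2))"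
          by (rule add_left_mono)
        then show ?case using s by (simp add: U_def Xc ennreal_mult add.assoc)
      qed
    qed
    show "ennreal ((\<sigma> (clamp_to t T s) (X (clamp_to t T s) \<omega>))\<^sup>2) \<le> ennreal \<beta> * U s \<omega>" if "s \<in> {t..T}" for s \<omega>
    proof -
      have "(\<sigma> s (X s \<omega>))\<^sup>2 \<le> \<kappa> * (1 + (X s \<omega>)\<^sup>2)"
        using that t by (intro square_growth growth_\<sigma>) auto
      also have "\<dots> \<le> \<beta> * (1 + (X s \<omega>)\<^sup>2)" using \<beta> by (intro mult_right_mono) auto
      finally show ?thesis
        using that \<beta> unfolding U_def by (subst ennreal_mult[symmetric]) (auto simp: Xc intro!: ennreal_leI)
    qed
    show "AE \<omega> in \<Omega>. (\<integral>\<^sup>+r\<in>{t..T}. U r \<omega> \<partial>lborel) < \<infinity>"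
      using path
    proof eventually_elim
      case (elim \<omega>)
      then have "continuous_on {t..T} (\<lambda>r. sqrt (1 + (X r \<omega>)\<^sup>2))" by (intro continuous_intros) auto
      from nn_integral_square_finite_if_continuous[OF this]
      have "(\<integral>\<^sup>+r\<in>{t..T}. ennreal (1 + (X r \<omega>)\<^sup>2) \<partial>lborel) < \<infinity>" by simp
      also have "(\<integral>\<^sup>+r\<in>{t..T}. ennreal (1 + (X r \<omega>)\<^sup>2) \<partial>lborel) = (\<integral>\<^sup>+r\<in>{t..T}. U r \<omega> \<partial>lborel)"
        by (intro nn_integral_cong) (auto simp: U_def Xc indicator_def)
      finally show ?case .
    qed
  qed (use s t in auto)
  also have "\<dots> \<le> ennreal C0 * ennreal (1 + 3 * p\<^sup>2)"
    using C0(2)[of T t] t by (intro mult_mono ennreal_leI) (auto simp: emeasure_space_1)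
  finally show ?thesis
    using s C0 by (simp add: U_def Xc ennreal_mult)
qed

text \<open>Drift and stochastic integral are both bounded by the time integral of the second moment over
\<open>[t, s]\<close>, and the second moment is bounded.\<close>

lemma solution_increment:
  assumes X: "strong_solution \<Omega> F W f \<sigma> t T p X" and t: "0 \<le> t" "t \<le> T" and s: "s \<in> {t..T}"
  shows "(\<EE> \<omega>. ennreal ((X s \<omega> - p)\<^sup>2)) \<le> ennreal (2 * (T + 1) * \<kappa> * C0 * (1 + 3 * p\<^sup>2) * (s - t))"
proof -
  obtain I where I: "integral_part t p X I" using integral_part_exists[OF X t] ..
  note ito = integral_part_ito[OF I] and path = integral_part_path[OF I]
  have s1: "t \<le> s" and s2: "s \<le> T" using s by auto
  define Xc where "Xc s = X (clamp_to t T s)" for s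
  have Xc: "Xc s = X s" if "s \<in> {t..T}" for s using that by (simp add: Xc_def)
  have [measurable]: "jointly_measurable Xc"
    unfolding Xc_def using solution_measurable[OF X] t by simp
  define U where "U s \<omega> = ennreal (1 + (Xc s \<omega>)\<^sup>2)" for s \<omega>
  have [measurable]: "jointly_measurable U" unfolding U_def by measurable
  have D: "ito_limit t s (\<lambda>s \<omega>. \<sigma> (clamp_to t T s) (X (clamp_to t T s) \<omega>)) (\<lambda>\<omega>. I s \<omega> - I t \<omega>)"
    using s by (intro ito) auto
  have [measurable]: "(\<lambda>\<omega>. I s \<omega> - I t \<omega>) \<in> borel_measurable \<Omega>" using D by (simp add: ito_limit_def)
  have int_U[measurable]: "(\<lambda>\<omega>. \<integral>\<^sup>+r\<in>{t..s}. U r \<omega> \<partial>lborel) \<in> borel_measurable \<Omega>" by measurable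
  have "(\<EE> \<omega>. (\<integral>\<^sup>+r\<in>{t..s}. U r \<omega> \<partial>lborel)) = (\<integral>\<^sup>+r\<in>{t..s}. (\<EE> \<omega>. U r \<omega>) \<partial>lborel)"
    by (rule tonelli_time) measurable
  also have "\<dots> \<le> (\<integral>\<^sup>+r. ennreal (C0 * (1 + 3 * p\<^sup>2)) * indicator {t..s} r \<partial>lborel)"
    using solution_second_moment[OF X t] s by (intro nn_integral_mono) (auto simp: indicator_def U_def Xc)
  also have "\<dots> = ennreal (C0 * (1 + 3 * p\<^sup>2) * (s - t))"
    using s C0 by (simp add: nn_integral_cmult_indicator ennreal_mult)
  finally have EU: "(\<EE> \<omega>. (\<integral>\<^sup>+r\<in>{t..s}. U r \<omega> \<partial>lborel)) \<le> ennreal (C0 * (1 + 3 * p\<^sup>2) * (s - t))" .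
  have "(\<EE> \<omega>. ennreal ((I s \<omega> - I t \<omega>)\<^sup>2)) \<le> (\<EE> \<omega>. (energy t s (\<lambda>r. \<sigma> (clamp_to t T r) (X (clamp_to t T r) \<omega>))))"
    using ito_inequality[OF D] s t by simp
  also have "\<dots> \<le> (\<EE> \<omega>. ennreal \<kappa> * (\<integral>\<^sup>+r\<in>{t..s}. U r \<omega> \<partial>lborel))"
  proof (rule nn_integral_mono)
    fix \<omega> assume [measurable]: "\<omega> \<in> space \<Omega>"
    have "(energy t s (\<lambda>r. \<sigma> (clamp_to t T r) (X (clamp_to t T r) \<omega>))) \<le> (\<integral>\<^sup>+r. ennreal \<kappa> * (U r \<omega> * indicator {t..s} r) \<partial>lborel)"
    proof (rule nn_integral_mono)
      fix r
      have "ennreal ((\<sigma> r (X r \<omega>))\<^sup>2) \<le> ennreal \<kappa> * U r \<omega>" if "r \<in> {t..s}"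
      proof -
        have "(\<sigma> r (X r \<omega>))\<^sup>2 \<le> \<kappa> * (1 + (X r \<omega>)\<^sup>2)" using that s t by (intro square_growth growth_\<sigma>) auto
        then show ?thesis
          using that s \<kappa>_pos unfolding U_def by (subst ennreal_mult[symmetric]) (auto simp: Xc intro!: ennreal_leI)
      qed
      then show "ennreal ((\<sigma> (clamp_to t T r) (X (clamp_to t T r) \<omega>))\<^sup>2) * indicator {t..s} r \<le> ennreal \<kappa> * (U r \<omega> * indicator {t..s} r)"
        using s by (cases "r \<in> {t..s}") auto
    qed
    also have "\<dots> = ennreal \<kappa> * (\<integral>\<^sup>+r\<in>{t..s}. U r \<omega> \<partial>lborel)" by (rule nn_integral_cmult) measurable
    finally show "(energy t s (\<lambda>r. \<sigma> (clamp_to t T r) (X (clamp_to t T r) \<omega>))) \<le> ennreal \<kappa> * (\<integral>\<^sup>+r\<in>{t..s}. U r \<omega> \<partial>lborel)" .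
  qed
  also have "\<dots> = ennreal \<kappa> * (\<EE> \<omega>. (\<integral>\<^sup>+r\<in>{t..s}. U r \<omega> \<partial>lborel))" by (rule nn_integral_cmult) measurable
  finally have ED: "(\<EE> \<omega>. ennreal ((I s \<omega> - I t \<omega>)\<^sup>2)) \<le> ennreal \<kappa> * (\<EE> \<omega>. (\<integral>\<^sup>+r\<in>{t..s}. U r \<omega> \<partial>lborel))" .
  have "(\<EE> \<omega>. ennreal ((X s \<omega> - p)\<^sup>2)) \<le> (\<EE> \<omega>. 2 * (ennreal (T * \<kappa>) * (\<integral>\<^sup>+r\<in>{t..s}. U r \<omega> \<partial>lborel)) + 2 * ennreal ((I s \<omega> - I t \<omega>)\<^sup>2))"
  proof (rule nn_integral_mono_AE, use integral_part_increment[OF I order_refl s1 s2] path AE_space in eventually_elim)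
    case (elim \<omega>)
    note [measurable] = \<open>\<omega> \<in> space \<Omega>\<close>
    let ?J = "LBINT r:{t..s}. f r (X r \<omega>)"
    have J: "ennreal (?J\<^sup>2) \<le> ennreal (T * \<kappa>) * (\<integral>\<^sup>+r\<in>{t..s}. U r \<omega> \<partial>lborel)"
    proof (rule drift_square_le)
      show "set_integrable lborel {t..s} (\<lambda>r. f r (X r \<omega>))" using elim by simp
      fix r assume r: "r \<in> {t..s}"
      then have "(f r (X r \<omega>))\<^sup>2 \<le> \<kappa> * (1 + (X r \<omega>)\<^sup>2)"
        using s t by (intro square_growth growth_f) auto
      then show "ennreal ((f r (X r \<omega>))\<^sup>2) \<le> ennreal \<kappa> * U r \<omega>"
        using r s \<kappa>_pos unfolding U_def by (subst ennreal_mult[symmetric]) (auto simp: Xc intro!: ennreal_leI)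
    qed (use s t in auto)
    have "X s \<omega> - p = ?J + (I s \<omega> - I t \<omega>)" using elim by simp
    then have "(X s \<omega> - p)\<^sup>2 \<le> 2 * ?J\<^sup>2 + 2 * (I s \<omega> - I t \<omega>)\<^sup>2" using square_sum_le by simp
    then have "ennreal ((X s \<omega> - p)\<^sup>2) \<le> 2 * ennreal (?J\<^sup>2) + 2 * ennreal ((I s \<omega> - I t \<omega>)\<^sup>2)"
      by (intro ennreal_le_double_sum) auto
    also have "\<dots> \<le> 2 * (ennreal (T * \<kappa>) * (\<integral>\<^sup>+r\<in>{t..s}. U r \<omega> \<partial>lborel)) + 2 * ennreal ((I s \<omega> - I t \<omega>)\<^sup>2)"
      using J by (intro add_mono mult_left_mono) auto
    finally show ?case .
  qed
  also have "\<dots> = 2 * (ennreal (T * \<kappa>) * (\<EE> \<omega>. (\<integral>\<^sup>+r\<in>{t..s}. U r \<omega> \<partial>lborel))) + 2 * (\<EE> \<omega>. ennreal ((I s \<omega> - I t \<omega>)\<^sup>2))"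
    by (simp add: nn_integral_add nn_integral_cmult)
  also have "\<dots> \<le> 2 * (ennreal (T * \<kappa>) * ennreal (C0 * (1 + 3 * p\<^sup>2) * (s - t))) + 2 * (ennreal \<kappa> * ennreal (C0 * (1 + 3 * p\<^sup>2) * (s - t)))"
    using EU by (intro add_mono mult_left_mono order_trans[OF ED]) auto
  also have "\<dots> = ennreal (2 * (T * \<kappa> * (C0 * (1 + 3 * p\<^sup>2) * (s - t))) + 2 * (\<kappa> * (C0 * (1 + 3 * p\<^sup>2) * (s - t))))"
    using C0 \<kappa>_pos T_nonneg s by (simp add: ennreal_mult)
  also have "2 * (T * \<kappa> * (C0 * (1 + 3 * p\<^sup>2) * (s - t))) + 2 * (\<kappa> * (C0 * (1 + 3 * p\<^sup>2) * (s - t))) = 2 * (T + 1) * \<kappa> * C0 * (1 + 3 * p\<^sup>2) * (s - t)"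
    by (simp add: algebra_simps)
  finally show ?thesis .
qed

text \<open>\<open>moment_bound\<close> with \<open>U = (X - Y)\<^sup>2\<close>: from time \<open>t'\<close> on, the difference solves an equation whose
coefficients are bounded by a multiple of \<open>\<bar>X - Y\<bar>\<close>.\<close>

lemma solution_stability:
  assumes X: "strong_solution \<Omega> F W f \<sigma> t T p X" and Y: "strong_solution \<Omega> F W f \<sigma> t' T p' Y"
    and t: "0 \<le> t" "t \<le> t'" "t' \<le> T" and s: "s \<in> {t'..T}"
  shows "(\<EE> \<omega>. ennreal ((X s \<omega> - Y s \<omega>)\<^sup>2)) \<le>
    ennreal C0 * (3 * (\<EE> \<omega>. ennreal ((X t' \<omega> - p')\<^sup>2)))"
proof -
  have tT: "t \<le> T" "0 \<le> t'" using t by auto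
  obtain I where I: "integral_part t p X I" using integral_part_exists[OF X t(1) tT(1)] ..
  note itoX = integral_part_ito[OF I] and pathX = integral_part_path[OF I]
  obtain I' where I': "integral_part t' p' Y I'" using integral_part_exists[OF Y tT(2) t(3)] ..
  note itoY = integral_part_ito[OF I'] and pathY = integral_part_path[OF I']
  define Z where "Z s \<omega> = X (clamp_to t T s) \<omega> - Y (clamp_to t' T s) \<omega>" for s \<omega>
  have Z: "Z s \<omega> = X s \<omega> - Y s \<omega>" if "s \<in> {t'..T}" for s \<omega> using that t by (simp add: Z_def)
  have [measurable]: "jointly_measurable (\<lambda>s \<omega>. X (clamp_to t T s) \<omega>)"
    "jointly_measurable (\<lambda>s \<omega>. Y (clamp_to t' T s) \<omega>)"
    using solution_measurable[OF X] solution_measurable[OF Y] t tT by auto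
  have [measurable]: "jointly_measurable Z" unfolding Z_def by measurable
  define U where "U s \<omega> = ennreal ((Z s \<omega>)\<^sup>2)" for s \<omega>
  have [measurable]: "jointly_measurable U" unfolding U_def by measurable
  have "(\<lambda>\<omega>. X t' \<omega>) \<in> borel_measurable \<Omega>"
    using joint_measurable_section[OF solution_measurable[OF X tT(1)], of t'] t by simp
  then have [measurable]: "X t' \<in> borel_measurable \<Omega>" by simp
  have "(\<EE> \<omega>. U s \<omega>) \<le> ennreal (2 * exp (8 * \<beta> * (T - t'))) * (\<EE> \<omega>. 3 * ennreal ((X t' \<omega> - p')\<^sup>2))"
  proof (rule moment_bound[OF tT(2) order_refl \<beta>(1)])
    show "ito_limit t' s (\<lambda>s \<omega>. \<sigma> (clamp_to t T s) (X (clamp_to t T s) \<omega>) - \<sigma> (clamp_to t' T s) (Y (clamp_to t' T s) \<omega>))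
      (\<lambda>\<omega>. (I s \<omega> - I t' \<omega>) - (I' s \<omega> - I' t' \<omega>))" if "s \<in> {t'..T}" for s
      using that t tT by (intro ito_limit_diff itoX itoY) auto
    show "AE \<omega> in \<Omega>. U s \<omega> \<le> 3 * ennreal ((X t' \<omega> - p')\<^sup>2) + ennreal \<beta> * (\<integral>\<^sup>+r\<in>{t'..s}. U r \<omega> \<partial>lborel) +
      3 * ennreal ((I s \<omega> - I t' \<omega> - (I' s \<omega> - I' t' \<omega>))\<^sup>2)" if s: "s \<in> {t'..T}" for s
    proof -
      have s1: "t' \<le> s" and s2: "s \<le> T" using s by auto
      show ?thesis
        using integral_part_increment[OF I t(2) s1 s2] integral_part_increment[OF I' order_refl s1 s2] pathY AE_space
      proof eventually_elim
        case (elim \<omega>)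
        note [measurable] = \<open>\<omega> \<in> space \<Omega>\<close>
        let ?J = "LBINT r:{t'..s}. f r (X r \<omega>) - f r (Y r \<omega>)"
        have int: "set_integrable lborel {t'..s} (\<lambda>r. f r (X r \<omega>))" "set_integrable lborel {t'..s} (\<lambda>r. f r (Y r \<omega>))"
          using elim by simp_all
        have "ennreal (?J\<^sup>2) \<le> ennreal (T * \<kappa>) * (\<integral>\<^sup>+r\<in>{t'..s}. U r \<omega> \<partial>lborel)"
        proof (rule drift_square_le)
          show "set_integrable lborel {t'..s} (\<lambda>r. f r (X r \<omega>) - f r (Y r \<omega>))"
            using int by (rule set_integral_diff)
          fix r assume r: "r \<in> {t'..s}"
          then have "(f r (X r \<omega>) - f r (Y r \<omega>))\<^sup>2 \<le> \<kappa> * (X r \<omega> - Y r \<omega>)\<^sup>2"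
            using s t by (intro square_lipschitz lipschitz_f) auto
          then show "ennreal ((f r (X r \<omega>) - f r (Y r \<omega>))\<^sup>2) \<le> ennreal \<kappa> * U r \<omega>"
            using r s \<kappa>_pos unfolding U_def by (subst ennreal_mult[symmetric]) (auto simp: Z intro!: ennreal_leI)
        qed (use s t in auto)
        moreover have "X s \<omega> - Y s \<omega> = (X t' \<omega> - p') + ?J + (I s \<omega> - I t' \<omega> - (I' s \<omega> - I' t' \<omega>))"
        proof -
          have "X s \<omega> = X t' \<omega> + (LBINT r:{t'..s}. f r (X r \<omega>)) + (I s \<omega> - I t' \<omega>)" using elim by simp
          moreover have "Y s \<omega> = p' + (LBINT r:{t'..s}. f r (Y r \<omega>)) + (I' s \<omega> - I' t' \<omega>)" using elim by simp
          moreover have "?J = (LBINT r:{t'..s}. f r (X r \<omega>)) - (LBINT r:{t'..s}. f r (Y r \<omega>))"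
            using int by (rule set_integral_diff)
          ultimately show ?thesis by simp
        qed
        then have "(X s \<omega> - Y s \<omega>)\<^sup>2 \<le> 3 * (X t' \<omega> - p')\<^sup>2 + 3 * ?J\<^sup>2 + 3 * (I s \<omega> - I t' \<omega> - (I' s \<omega> - I' t' \<omega>))\<^sup>2"
          by (simp only: square_sum3_le)
        ultimately have "ennreal ((X s \<omega> - Y s \<omega>)\<^sup>2) \<le> 3 * ennreal ((X t' \<omega> - p')\<^sup>2) + ennreal \<beta> * (\<integral>\<^sup>+r\<in>{t'..s}. U r \<omega> \<partial>lborel)
          + 3 * ennreal ((I s \<omega> - I t' \<omega> - (I' s \<omega> - I' t' \<omega>))\<^sup>2)"
          by (intro drift_triple_le)
        then show ?case using s by (simp add: U_def Z)
      qed
    qed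
    show "ennreal ((\<sigma> (clamp_to t T s) (X (clamp_to t T s) \<omega>) - \<sigma> (clamp_to t' T s) (Y (clamp_to t' T s) \<omega>))\<^sup>2) \<le> ennreal \<beta> * U s \<omega>"
      if "s \<in> {t'..T}" for s \<omega>
    proof -
      have "(\<sigma> s (X s \<omega>) - \<sigma> s (Y s \<omega>))\<^sup>2 \<le> \<kappa> * (X s \<omega> - Y s \<omega>)\<^sup>2"
        using that t by (intro square_lipschitz lipschitz_\<sigma>) auto
      also have "\<dots> \<le> \<beta> * (X s \<omega> - Y s \<omega>)\<^sup>2" using \<beta> by (intro mult_right_mono) auto
      finally show ?thesis
        using that \<beta> t unfolding U_def by (subst ennreal_mult[symmetric]) (auto simp: Z intro!: ennreal_leI)
    qed
    show "AE \<omega> in \<Omega>. (\<integral>\<^sup>+r\<in>{t'..T}. U r \<omega> \<partial>lborel) < \<infinity>"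
      using pathX pathY
    proof eventually_elim
      case (elim \<omega>)
      then have "continuous_on {t'..T} (\<lambda>r. X r \<omega> - Y r \<omega>)"
        using t by (intro continuous_on_diff) (auto elim: continuous_on_subset)
      from nn_integral_square_finite_if_continuous[OF this]
      have "(energy t' T (\<lambda>r. X r \<omega> - Y r \<omega>)) < \<infinity>" .
      also have "(energy t' T (\<lambda>r. X r \<omega> - Y r \<omega>)) = (\<integral>\<^sup>+r\<in>{t'..T}. U r \<omega> \<partial>lborel)"
        by (intro nn_integral_cong) (auto simp: U_def Z indicator_def)
      finally show ?case .
    qed
  qed (use s t in auto)
  also have "\<dots> \<le> ennreal C0 * (3 * (\<EE> \<omega>. ennreal ((X t' \<omega> - p')\<^sup>2)))"
    using C0(2)[of T t'] t tT by (simp add: nn_integral_cmult) (intro mult_mono ennreal_leI, auto)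
  finally show ?thesis
    using s by (simp add: U_def Z)
qed

end

section \<open>Transport of controls between states\<close>

context brownian_basis
begin

lemma progressive_running_integral:
  assumes "progressive F t T u"
  shows "progressive F t T (\<lambda>s \<omega>. LBINT r:{t..s}. u r \<omega>)"
  unfolding progressive_def
proof
  fix s assume s: "s \<in> {t..T}"
  note [measurable] = progressive_clamp_measurable_at[OF assms s]
  have [measurable]: "(\<lambda>x. x) \<in> restrict_space borel {t..s} \<rightarrow>\<^sub>M (borel :: real measure)"
    by (rule measurable_restrict_space1) simp
  have "(\<lambda>z. LINT r|lborel. (if t \<le> r \<and> r \<le> fst z then u (clamp_to t s r) (snd z) else 0))
    \<in> borel_measurable (restrict_space borel {t..s} \<Otimes>\<^sub>M F s)"
    by (rule lborel.borel_measurable_lebesgue_integral) measurable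
  moreover have "(LINT r|lborel. (if t \<le> r \<and> r \<le> \<tau> then u (clamp_to t s r) \<omega> else 0)) = (LBINT r:{t..\<tau>}. u r \<omega>)"
    if "\<tau> \<in> {t..s}" for \<tau> \<omega>
    unfolding set_lebesgue_integral_def using that by (intro Bochner_Integration.integral_cong) (auto simp: indicator_def)
  ultimately show "(\<lambda>(\<tau>, \<omega>). LBINT r:{t..\<tau>}. u r \<omega>) \<in> borel_measurable (restrict_space borel {t..s} \<Otimes>\<^sub>M F s)"
    by (subst measurable_cong[where g = "\<lambda>z. LINT r|lborel. (if t \<le> r \<and> r \<le> fst z then u (clamp_to t s r) (snd z) else 0)"])
      (auto simp: space_pair_measure space_restrict_space)
qed

lemma control_clamp_measurable:
  assumes "u \<in> controls \<Omega> F T ubar t" "t \<le> T"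
  shows "jointly_measurable (\<lambda>s \<omega>. u (clamp_to t T s) \<omega>)"
  using assms by (intro progressive_clamp_measurable) (auto simp: controls_def)

lemma control_bounds:
  assumes "u \<in> controls \<Omega> F T ubar t" "s \<in> {t..T}" "\<omega> \<in> space \<Omega>"
  shows "0 \<le> u s \<omega>" "u s \<omega> \<le> ubar"
  using assms by (auto simp: controls_def)

lemma control_set_integrable:
  assumes u: "u \<in> controls \<Omega> F T ubar t" and "t \<le> T" and \<omega>: "\<omega> \<in> space \<Omega>" and "t \<le> a" "b \<le> T"
  shows "set_integrable lborel {a..b} (\<lambda>s. u s \<omega>)"
proof -
  have [measurable]: "(\<lambda>s. u (clamp_to t T s) \<omega>) \<in> borel_measurable borel"
    using joint_measurable_path[OF control_clamp_measurable[OF u \<open>t \<le> T\<close>] \<omega>] .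
  have "set_integrable lborel {a..b} (\<lambda>s. u (clamp_to t T s) \<omega>)"
    unfolding set_integrable_def
  proof (rule Bochner_Integration.integrable_bound[where f = "\<lambda>s. ubar * indicator {a..b} s"])
    show "AE s in lborel. norm (indicator {a..b} s *\<^sub>R u (clamp_to t T s) \<omega>) \<le> norm (ubar * indicator {a..b} s :: real)"
      using control_bounds[OF u _ \<omega>] \<open>t \<le> T\<close> by (intro AE_I2) (auto simp: indicator_def intro!: order_trans[OF _ abs_ge_self])
    show "integrable lborel (\<lambda>s. ubar * indicator {a..b} s :: real)"
      by (intro integrable_mult_right integrable_real_indicator) (auto simp: emeasure_lborel_Icc_eq)
  qed simp_all
  moreover have "(\<lambda>s. indicator {a..b} s *\<^sub>R u (clamp_to t T s) \<omega>) = (\<lambda>s. indicator {a..b} s *\<^sub>R u s \<omega>)"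
    using assms(4,5) by (auto simp: indicator_def fun_eq_iff)
  ultimately show ?thesis by (simp add: set_integrable_def)
qed

lemma zero_control: "0 \<le> ubar \<Longrightarrow> (\<lambda>_ _. 0) \<in> controls \<Omega> F T ubar t"
  by (simp add: controls_def progressive_def)

lemma complement_control:
  assumes "u \<in> controls \<Omega> F T ubar t"
  shows "(\<lambda>s \<omega>. ubar - u s \<omega>) \<in> controls \<Omega> F T ubar t"
  using assms unfolding controls_def progressive_def by (auto simp: case_prod_beta')

text \<open>The condition is on the volume used up to the present time, so that the control stays progressive.\<close>

definition stop_at :: "real \<Rightarrow> real \<Rightarrow> (real \<Rightarrow> 'a \<Rightarrow> real) \<Rightarrow> real \<Rightarrow> 'a \<Rightarrow> real" where
  "stop_at t c u s \<omega> = (if (LBINT r:{t..s}. u r \<omega>) \<le> c then u s \<omega> else 0)"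

lemma stop_at_control:
  assumes u: "u \<in> controls \<Omega> F T ubar t" and "0 \<le> ubar"
  shows "stop_at t c u \<in> controls \<Omega> F T ubar t"
proof -
  have p: "progressive F t T u" "progressive F t T (\<lambda>s \<omega>. LBINT r:{t..s}. u r \<omega>)"
    using u progressive_running_integral by (auto simp: controls_def)
  have "progressive F t T (stop_at t c u)"
    unfolding progressive_def
  proof
    fix s assume s: "s \<in> {t..T}"
    have [measurable]: "(\<lambda>z. u (fst z) (snd z)) \<in> borel_measurable (restrict_space borel {t..s} \<Otimes>\<^sub>M F s)"
      "(\<lambda>z. LBINT r:{t..fst z}. u r (snd z)) \<in> borel_measurable (restrict_space borel {t..s} \<Otimes>\<^sub>M F s)"
      using p s by (auto simp: progressive_def case_prod_beta')
    show "(\<lambda>(\<tau>, \<omega>). stop_at t c u \<tau> \<omega>) \<in> borel_measurable (restrict_space borel {t..s} \<Otimes>\<^sub>M F s)"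
      unfolding stop_at_def case_prod_beta' by measurable
  qed
  then show ?thesis using u \<open>0 \<le> ubar\<close> by (auto simp: controls_def stop_at_def)
qed

lemma stop_at_le:
  assumes "u \<in> controls \<Omega> F T ubar t" "s \<in> {t..T}" "\<omega> \<in> space \<Omega>"
  shows "stop_at t c u s \<omega> \<le> u s \<omega>"
  using control_bounds[OF assms] by (simp add: stop_at_def)

lemma stop_at_total:
  assumes u: "u \<in> controls \<Omega> F T ubar t" and t: "t \<le> T" and \<omega>: "\<omega> \<in> space \<Omega>" and c: "0 \<le> c"
  shows "(LBINT s:{t..T}. stop_at t c u s \<omega>) = min c (LBINT s:{t..T}. u s \<omega>)"
proof -
  have int: "set_integrable lborel {t..T} (\<lambda>s. u s \<omega>)"
    using control_set_integrable[OF u t \<omega>] by simp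
  obtain \<tau> where \<tau>: "\<tau> \<in> {t..T}" "\<And>s. s \<in> {t..T} \<Longrightarrow> (LBINT r:{t..s}. u r \<omega>) \<le> c \<longleftrightarrow> s \<le> \<tau>"
    "(LBINT r:{t..\<tau>}. u r \<omega>) = min c (LBINT r:{t..T}. u r \<omega>)"
    using clock[OF int control_bounds(1)[OF u _ \<omega>] t c] by metis
  have "(LBINT s:{t..T}. stop_at t c u s \<omega>) = (LBINT r:{t..\<tau>}. u r \<omega>)"
    unfolding set_lebesgue_integral_def
    by (intro Bochner_Integration.integral_cong) (use \<tau>(1,2) in \<open>auto simp: stop_at_def indicator_def\<close>)
  then show ?thesis using \<tau>(3) by simp
qed

text \<open>Stopping at the volume \<open>M - z\<close> enforces the upper constraint.  The lower constraint is an upper one for the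
complement \<open>ubar - u\<close>, whose total may not exceed \<open>z + ubar (T - t) - m\<close>.  The final volume becomes
\<open>max m (min M (z + \<integral> u))\<close>, and since \<open>m \<le> M\<close> at most one of the two corrections acts on a given path.\<close>

lemma clip_to_admissible:
  assumes u: "u \<in> controls \<Omega> F T ubar t" and t: "t \<le> T" and ubar: "0 \<le> ubar" and mM: "m \<le> M"
    and z: "z \<le> M" "m - ubar * (T - t) \<le> z"
  shows "\<exists>u'\<in>admissible \<Omega> F T ubar m M t z. \<forall>\<omega>\<in>space \<Omega>. \<forall>\<delta>\<ge>0.
    usage t z u T \<omega> \<in> {m - \<delta>..M + \<delta>} \<longrightarrow> (LBINT s:{t..T}. \<bar>u s \<omega> - u' s \<omega>\<bar>) \<le> \<delta>"
proof -
  define u1 where "u1 = stop_at t (M - z) u"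
  have u1: "u1 \<in> controls \<Omega> F T ubar t" unfolding u1_def by (rule stop_at_control[OF u ubar])
  define v where "v s \<omega> = ubar - u1 s \<omega>" for s \<omega>
  have v: "v \<in> controls \<Omega> F T ubar t" unfolding v_def by (rule complement_control[OF u1])
  define c where "c = z + ubar * (T - t) - m"
  have c: "0 \<le> c" using z by (simp add: c_def)
  define v' where "v' = stop_at t c v"
  have v': "v' \<in> controls \<Omega> F T ubar t" unfolding v'_def by (rule stop_at_control[OF v ubar])
  define u' where "u' s \<omega> = ubar - v' s \<omega>" for s \<omega>
  have u': "u' \<in> controls \<Omega> F T ubar t" unfolding u'_def by (rule complement_control[OF v'])
  have int: "set_integrable lborel {t..T} (\<lambda>s. w s \<omega>)" if "w \<in> controls \<Omega> F T ubar t" "\<omega> \<in> space \<Omega>" for w \<omega>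
    using control_set_integrable[OF that(1) t that(2)] by simp
  have compl: "(LBINT s:{t..T}. ubar - w s \<omega>) = ubar * (T - t) - (LBINT s:{t..T}. w s \<omega>)"
    if "w \<in> controls \<Omega> F T ubar t" "\<omega> \<in> space \<Omega>" for w \<omega>
  proof -
    have "set_integrable lborel {t..T} (\<lambda>s. ubar)" using t by (simp add: set_integrable_def)
    from set_integral_diff(2)[OF this int[OF that]] show ?thesis
      using t by (simp add: set_lebesgue_integral_def mult.commute)
  qed
  have tot1: "(LBINT s:{t..T}. u1 s \<omega>) = min (M - z) (LBINT s:{t..T}. u s \<omega>)" if "\<omega> \<in> space \<Omega>" for \<omega>
    unfolding u1_def using stop_at_total[OF u t that] z by simp
  have tot': "(LBINT s:{t..T}. u' s \<omega>) = max (m - z) (LBINT s:{t..T}. u1 s \<omega>)" if \<omega>: "\<omega> \<in> space \<Omega>" for \<omega>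
  proof -
    have "(LBINT s:{t..T}. u' s \<omega>) = ubar * (T - t) - min c (LBINT s:{t..T}. v s \<omega>)"
      unfolding u'_def compl[OF v' \<omega>] unfolding v'_def stop_at_total[OF v t \<omega> c] ..
    also have "(LBINT s:{t..T}. v s \<omega>) = ubar * (T - t) - (LBINT s:{t..T}. u1 s \<omega>)"
      unfolding v_def by (rule compl[OF u1 \<omega>])
    finally show ?thesis by (simp add: c_def min_def max_def)
  qed
  have le: "u1 s \<omega> \<le> u s \<omega>" "u1 s \<omega> \<le> u' s \<omega>" if "s \<in> {t..T}" "\<omega> \<in> space \<Omega>" for s \<omega>
    using stop_at_le[OF u that, of "M - z"] stop_at_le[OF v that, of c]
    by (auto simp: u1_def[symmetric] v'_def[symmetric] u'_def v_def)
  have "AE \<omega> in \<Omega>. usage t z u' T \<omega> \<in> {m..M}"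
    using mM by (intro AE_I2) (auto simp: usage_def tot' tot1)
  then have adm: "u' \<in> admissible \<Omega> F T ubar m M t z" using u' by (simp add: admissible_def)
  have "(LBINT s:{t..T}. \<bar>u s \<omega> - u' s \<omega>\<bar>) \<le> \<delta>"
    if \<omega>: "\<omega> \<in> space \<Omega>" and \<delta>: "0 \<le> \<delta>" "usage t z u T \<omega> \<in> {m - \<delta>..M + \<delta>}" for \<omega> \<delta>
  proof -
    have i1: "set_integrable lborel {t..T} (\<lambda>s. u s \<omega> - u1 s \<omega>)" "set_integrable lborel {t..T} (\<lambda>s. u' s \<omega> - u1 s \<omega>)"
      using int[OF u \<omega>] int[OF u1 \<omega>] int[OF u' \<omega>] by (auto intro: set_integral_diff)
    have "(LBINT s:{t..T}. \<bar>u s \<omega> - u' s \<omega>\<bar>) \<le> (LBINT s:{t..T}. (u s \<omega> - u1 s \<omega>) + (u' s \<omega> - u1 s \<omega>))"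
    proof (rule set_integral_mono)
      have "set_integrable lborel {t..T} (\<lambda>s. u s \<omega> - u' s \<omega>)"
        using int[OF u \<omega>] int[OF u' \<omega>] by (rule set_integral_diff)
      then show "set_integrable lborel {t..T} (\<lambda>s. \<bar>u s \<omega> - u' s \<omega>\<bar>)" by (rule set_integrable_abs)
      show "set_integrable lborel {t..T} (\<lambda>s. (u s \<omega> - u1 s \<omega>) + (u' s \<omega> - u1 s \<omega>))"
        using i1 by (rule set_integral_add)
      show "\<bar>u s \<omega> - u' s \<omega>\<bar> \<le> (u s \<omega> - u1 s \<omega>) + (u' s \<omega> - u1 s \<omega>)" if "s \<in> {t..T}" for s
        using le[OF that \<omega>] by linarith
    qed
    also have "\<dots> = ((LBINT s:{t..T}. u s \<omega>) - (LBINT s:{t..T}. u1 s \<omega>)) + ((LBINT s:{t..T}. u' s \<omega>) - (LBINT s:{t..T}. u1 s \<omega>))"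
      using i1 int[OF u \<omega>] int[OF u1 \<omega>] int[OF u' \<omega>] by (simp add: set_integral_add set_integral_diff)
    also have "\<dots> \<le> \<delta>"
      unfolding tot'[OF \<omega>] tot1[OF \<omega>] using \<delta> mM by (auto simp: usage_def min_def max_def)
    finally show ?thesis .
  qed
  then show ?thesis by (intro bexI[OF _ adm] ballI allI impI) simp
qed

lemma extend_control:
  assumes u: "u \<in> controls \<Omega> F T ubar t" and t: "0 \<le> t" "t \<le> T" "0 \<le> t'" and ubar: "0 \<le> ubar"
  shows "(\<lambda>s \<omega>. if t \<le> s then u s \<omega> else 0) \<in> controls \<Omega> F T ubar t'"
proof -
  have "progressive F t' T (\<lambda>s \<omega>. if t \<le> s then u s \<omega> else 0)"
    unfolding progressive_def
  proof
    fix s assume s: "s \<in> {t'..T}"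
    have [measurable]: "(\<lambda>x. x) \<in> restrict_space borel {t'..s} \<rightarrow>\<^sub>M (borel :: real measure)"
      by (rule measurable_restrict_space1) simp
    show "(\<lambda>(\<tau>, \<omega>). if t \<le> \<tau> then u \<tau> \<omega> else 0) \<in> borel_measurable (restrict_space borel {t'..s} \<Otimes>\<^sub>M F s)"
    proof (cases "t \<le> s")
      case True
      have [measurable]: "(\<lambda>(r, \<omega>). u (clamp_to t s r) \<omega>) \<in> borel_measurable (borel \<Otimes>\<^sub>M F s)"
        using u True s by (intro progressive_clamp_measurable_at) (auto simp: controls_def)
      have "(\<lambda>z. if t \<le> fst z then u (clamp_to t s (fst z)) (snd z) else 0) \<in> borel_measurable (restrict_space borel {t'..s} \<Otimes>\<^sub>M F s)"
        by measurable
      then show ?thesis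
        by (subst measurable_cong[where g = "\<lambda>z. if t \<le> fst z then u (clamp_to t s (fst z)) (snd z) else 0"])
          (auto simp: space_pair_measure space_restrict_space)
    next
      case False
      then show ?thesis
        by (subst measurable_cong[where g = "\<lambda>z. 0"]) (auto simp: space_pair_measure space_restrict_space)
    qed
  qed
  then show ?thesis using u t ubar by (auto simp: controls_def)
qed

text \<open>Extending by zero, or restricting, moves the final volume by at most the right-hand side, so that
clipping costs no more than that.\<close>

lemma admissible_transfer:
  assumes u: "u \<in> admissible \<Omega> F T ubar m M t z" and ubar: "0 \<le> ubar" and mM: "m \<le> M"
    and t: "0 \<le> t" "t \<le> T" and t': "0 \<le> t'" "t' \<le> T" and z': "z' \<le> M" "m - ubar * (T - t') \<le> z'"
  shows "\<exists>u'\<in>admissible \<Omega> F T ubar m M t' z'.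
    AE \<omega> in \<Omega>. (LBINT s:{t'..T}. \<bar>(if t \<le> s then u s \<omega> else 0) - u' s \<omega>\<bar>) \<le> \<bar>z - z'\<bar> + ubar * \<bar>t - t'\<bar>"
proof -
  have uc: "u \<in> controls \<Omega> F T ubar t" and adm: "AE \<omega> in \<Omega>. usage t z u T \<omega> \<in> {m..M}"
    using u by (auto simp: admissible_def)
  define w where "w s \<omega> = (if t \<le> s then u s \<omega> else 0)" for s \<omega>
  have w: "w \<in> controls \<Omega> F T ubar t'"
    unfolding w_def by (rule extend_control[OF uc t t'(1) ubar])
  define \<delta> where "\<delta> = \<bar>z - z'\<bar> + ubar * \<bar>t - t'\<bar>"
  have \<delta>: "0 \<le> \<delta>" using ubar by (simp add: \<delta>_def)
  have close: "\<bar>usage t' z' w T \<omega> - usage t z u T \<omega>\<bar> \<le> \<delta>" if \<omega>: "\<omega> \<in> space \<Omega>" for \<omega>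
  proof (cases "t' \<le> t")
    case True
    have "(LBINT s:{t'..T}. w s \<omega>) = (LBINT s:{t..T}. u s \<omega>)"
      unfolding set_lebesgue_integral_def using True
      by (intro Bochner_Integration.integral_cong) (auto simp: w_def indicator_def)
    moreover have "0 \<le> ubar * \<bar>t - t'\<bar>" using ubar by simp
    ultimately show ?thesis unfolding usage_def \<delta>_def by linarith
  next
    case False
    have "(LBINT s:{t'..T}. w s \<omega>) = (LBINT s:{t'..T}. u s \<omega>)"
      using False by (intro set_lebesgue_integral_cong) (auto simp: w_def)
    moreover have "(LBINT s:{t..T}. u s \<omega>) = (LBINT s:{t..t'}. u s \<omega>) + (LBINT s:{t'..T}. u s \<omega>)"
      using False t' by (intro LBINT_combine[OF control_set_integrable[OF uc t(2) \<omega> order_refl order_refl]]) auto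
    moreover have "0 \<le> (LBINT s:{t..t'}. u s \<omega>)"
      unfolding set_lebesgue_integral_def using control_bounds[OF uc _ \<omega>] t'
      by (intro Bochner_Integration.integral_nonneg) (auto simp: indicator_def)
    moreover have "(LBINT s:{t..t'}. u s \<omega>) \<le> (LBINT s:{t..t'}. ubar)"
    proof (rule set_integral_mono)
      show "set_integrable lborel {t..t'} (\<lambda>s. u s \<omega>)" using control_set_integrable[OF uc t(2) \<omega>] t' by simp
      show "set_integrable lborel {t..t'} (\<lambda>s. ubar)" by (cases "t \<le> t'") (auto simp: set_integrable_def)
    qed (use control_bounds[OF uc _ \<omega>] t' in auto)
    moreover have "(LBINT s:{t..t'}. ubar) = ubar * (t' - t)"
      using False by (simp add: set_lebesgue_integral_def mult.commute)
    ultimately show ?thesis using False by (auto simp: usage_def \<delta>_def)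
  qed
  obtain u' where u': "u' \<in> admissible \<Omega> F T ubar m M t' z'"
    and clip: "\<forall>\<omega>\<in>space \<Omega>. \<forall>\<delta>\<ge>0. usage t' z' w T \<omega> \<in> {m - \<delta>..M + \<delta>} \<longrightarrow>
      (LBINT s:{t'..T}. \<bar>w s \<omega> - u' s \<omega>\<bar>) \<le> \<delta>"
    using clip_to_admissible[OF w t'(2) ubar mM z'] ..
  have "AE \<omega> in \<Omega>. (LBINT s:{t'..T}. \<bar>w s \<omega> - u' s \<omega>\<bar>) \<le> \<delta>"
    using adm AE_space
  proof eventually_elim
    case (elim \<omega>)
    then show ?case using close[of \<omega>] \<delta> by (intro clip[rule_format]) auto
  qed
  then show ?thesis by (intro bexI[OF _ u']) (simp add: w_def \<delta>_def)
qed

lemma admissible_nonempty: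
  assumes "0 \<le> ubar" "m \<le> M" "t \<le> T" "z \<le> M" "m - ubar * (T - t) \<le> z"
  shows "admissible \<Omega> F T ubar m M t z \<noteq> {}"
  using clip_to_admissible[OF zero_control[OF assms(1)] assms(3,1,2,4,5)] by blast

end

section \<open>Payoffs and the value function\<close>

lemma abs_le_weighted_square: "0 < \<eta> \<Longrightarrow> \<bar>x\<bar> \<le> \<eta> + x\<^sup>2 / \<eta>" for x \<eta> :: real
proof -
  assume \<eta>: "0 < \<eta>"
  have "0 \<le> (\<bar>x\<bar> - \<eta>)\<^sup>2 + \<bar>x\<bar> * \<eta>" using \<eta> by (intro add_nonneg_nonneg) auto
  then have "\<bar>x\<bar> * \<eta> \<le> \<eta>\<^sup>2 + x\<^sup>2" by (simp add: power2_diff algebra_simps)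
  then have "\<bar>x\<bar> \<le> (\<eta>\<^sup>2 + x\<^sup>2) / \<eta>" using \<eta> by (simp add: pos_le_divide_eq)
  then show ?thesis using \<eta> by (simp add: add_divide_distrib power2_eq_square)
qed

lemma abs_mult_le_weighted_squares: "0 < \<eta> \<Longrightarrow> \<bar>x * y\<bar> \<le> \<eta> * x\<^sup>2 + y\<^sup>2 / \<eta>" for x y \<eta> :: real
proof -
  assume \<eta>: "0 < \<eta>"
  have "0 \<le> (\<eta> * \<bar>x\<bar> - \<bar>y\<bar>)\<^sup>2 + \<bar>x * y\<bar> * \<eta>" using \<eta> by (intro add_nonneg_nonneg) auto
  then have "\<bar>x * y\<bar> * \<eta> \<le> \<eta>\<^sup>2 * x\<^sup>2 + y\<^sup>2" by (simp add: power2_diff power_mult_distrib abs_mult algebra_simps)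
  then have "\<bar>x * y\<bar> \<le> (\<eta>\<^sup>2 * x\<^sup>2 + y\<^sup>2) / \<eta>" using \<eta> by (simp add: pos_le_divide_eq)
  then show ?thesis using \<eta> by (simp add: add_divide_distrib power2_eq_square)
qed

lemma abs_exp_diff_le:
  fixes r s t1 t2 :: real
  assumes "0 \<le> r" "t1 \<le> t2" "t2 \<le> s"
  shows "\<bar>exp (- r * (s - t1)) - exp (- r * (s - t2))\<bar> \<le> r * (t2 - t1)"
proof -
  define x where "x = r * (t2 - t1)"
  have x: "0 \<le> x" using assms by (simp add: x_def)
  have eq: "exp (- r * (s - t1)) = exp (- r * (s - t2)) * exp (- x)"
    by (simp add: x_def mult_exp_exp algebra_simps)
  have "1 - x \<le> exp (- x)" using exp_ge_add_one_self[of "- x"] by simp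
  moreover have "exp (- x) \<le> 1" using x by simp
  moreover have "exp (- r * (s - t2)) \<le> 1" using assms by simp
  ultimately have "exp (- r * (s - t2)) * (1 - exp (- x)) \<le> 1 * x"
    by (intro mult_mono) auto
  moreover have "\<bar>exp (- r * (s - t1)) - exp (- r * (s - t2))\<bar> = exp (- r * (s - t2)) * (1 - exp (- x))"
    using \<open>exp (- x) \<le> 1\<close> unfolding eq by (subst abs_of_nonpos) (auto simp: algebra_simps)
  ultimately show ?thesis by (simp add: x_def)
qed

locale swing = lipschitz_sde \<Omega> F W T f \<sigma> \<alpha> L
  for \<Omega> :: "'a measure" and F W T f \<sigma> \<alpha> L +
  fixes P :: "real \<Rightarrow> real \<Rightarrow> real \<Rightarrow> 'a \<Rightarrow> real" and r K ubar m M :: real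
  assumes solution: "t \<in> {0..T} \<Longrightarrow> strong_solution \<Omega> F W f \<sigma> t T p (P t p)"
    and r: "0 \<le> r" and ubar: "0 < ubar" and mM: "m < M"
begin

text \<open>The discounted margin, extended by zero outside \<open>[t, T]\<close> so that payoffs with different starting times
become integrals over one product space.\<close>

definition gain :: "real \<Rightarrow> real \<Rightarrow> real \<Rightarrow> 'a \<Rightarrow> real" where
  "gain t p s \<omega> = indicator {t..T} s * (exp (- r * (s - t)) * (P t p (clamp_to t T s) \<omega> - K))"

definition rate :: "real \<Rightarrow> (real \<Rightarrow> 'a \<Rightarrow> real) \<Rightarrow> real \<Rightarrow> 'a \<Rightarrow> real" where
  "rate t u s \<omega> = indicator {t..T} s * u (clamp_to t T s) \<omega>"

definition payoff :: "real \<Rightarrow> real \<Rightarrow> (real \<Rightarrow> 'a \<Rightarrow> real) \<Rightarrow> real" where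
  "payoff t p u = expectation (\<lambda>\<omega>. LBINT s:{t..T}. exp (- r * (s - t)) * (P t p s \<omega> - K) * u s \<omega>)"

definition price_bound :: "real \<Rightarrow> real" where "price_bound p = 2 * (C0 * (1 + 3 * p\<^sup>2)) + 2 * K\<^sup>2"

lemma price_bound_nonneg: "0 \<le> price_bound p"
  using C0(1) by (simp add: price_bound_def)

lemma gain_measurable [measurable]:
  assumes "t \<in> {0..T}"
  shows "jointly_measurable (\<lambda>s \<omega>. gain t p s \<omega>)"
proof -
  have [measurable]: "jointly_measurable (\<lambda>s \<omega>. P t p (clamp_to t T s) \<omega>)"
    using solution_measurable[OF solution[OF assms]] assms by simp
  show ?thesis unfolding gain_def by measurable
qed

lemma rate_measurable [measurable]:
  assumes "u \<in> controls \<Omega> F T ubar t" "t \<le> T"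
  shows "jointly_measurable (\<lambda>s \<omega>. rate t u s \<omega>)"
proof -
  note [measurable] = control_clamp_measurable[OF assms]
  show ?thesis unfolding rate_def by measurable
qed

lemma rate_bounds:
  assumes "u \<in> controls \<Omega> F T ubar t" "t \<le> T" "\<omega> \<in> space \<Omega>"
  shows "0 \<le> rate t u s \<omega>" "rate t u s \<omega> \<le> ubar"
  using control_bounds[OF assms(1) _ assms(3), of "clamp_to t T s"] assms(2) ubar by (auto simp: rate_def indicator_def)

lemma price_moment:
  assumes t: "t \<in> {0..T}" and s: "s \<in> {t..T}"
  shows "(\<EE> \<omega>. ennreal ((P t p s \<omega> - K)\<^sup>2)) \<le> ennreal (price_bound p)"
proof -
  have "(\<lambda>\<omega>. P t p s \<omega>) \<in> borel_measurable \<Omega>"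
    using joint_measurable_section[OF solution_measurable[OF solution[OF t, of p]], of s] t s by simp
  then have [measurable]: "P t p s \<in> borel_measurable \<Omega>" by simp
  have "(\<EE> \<omega>. ennreal ((P t p s \<omega> - K)\<^sup>2)) \<le> (\<EE> \<omega>. 2 * ennreal (1 + (P t p s \<omega>)\<^sup>2) + ennreal (2 * K\<^sup>2))"
  proof (rule nn_integral_mono)
    fix \<omega>
    have "(P t p s \<omega> - K)\<^sup>2 \<le> 2 * (1 + (P t p s \<omega>)\<^sup>2) + 2 * K\<^sup>2" using square_diff_le[of "P t p s \<omega>" K] by simp
    then have "ennreal ((P t p s \<omega> - K)\<^sup>2) \<le> ennreal (2 * (1 + (P t p s \<omega>)\<^sup>2) + 2 * K\<^sup>2)" by (rule ennreal_leI)
    also have "\<dots> = ennreal (2 * (1 + (P t p s \<omega>)\<^sup>2)) + ennreal (2 * K\<^sup>2)" by (rule ennreal_plus) auto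
    also have "ennreal (2 * (1 + (P t p s \<omega>)\<^sup>2)) = 2 * ennreal (1 + (P t p s \<omega>)\<^sup>2)" by (subst ennreal_mult) auto
    finally show "ennreal ((P t p s \<omega> - K)\<^sup>2) \<le> 2 * ennreal (1 + (P t p s \<omega>)\<^sup>2) + ennreal (2 * K\<^sup>2)" .
  qed
  also have "\<dots> = 2 * (\<EE> \<omega>. ennreal (1 + (P t p s \<omega>)\<^sup>2)) + ennreal (2 * K\<^sup>2)"
    by (subst nn_integral_add) (auto simp: nn_integral_cmult emeasure_space_1 simp del: ennreal_plus)
  also have "\<dots> \<le> 2 * ennreal (C0 * (1 + 3 * p\<^sup>2)) + ennreal (2 * K\<^sup>2)"
    using solution_second_moment[OF solution[OF t] _ _ s] t by (intro add_mono mult_left_mono) auto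
  also have "\<dots> = ennreal (2 * (C0 * (1 + 3 * p\<^sup>2))) + ennreal (2 * K\<^sup>2)"
    using C0(1) by (subst ennreal_mult[of 2]) auto
  also have "\<dots> = ennreal (price_bound p)"
    unfolding price_bound_def using C0(1) by (intro ennreal_plus[symmetric]) auto
  finally show ?thesis .
qed

lemma gain_square_le:
  assumes "t \<in> {0..T}" "s \<in> {t..T}"
  shows "(gain t p s \<omega>)\<^sup>2 \<le> (P t p s \<omega> - K)\<^sup>2"
proof -
  have "\<bar>exp (- r * (s - t))\<bar> \<le> 1" using r assms by simp
  then have "\<bar>exp (- r * (s - t)) * (P t p s \<omega> - K)\<bar> \<le> \<bar>P t p s \<omega> - K\<bar>"
    unfolding abs_mult by (intro mult_left_le_one_le) auto
  then have "\<bar>gain t p s \<omega>\<bar> \<le> \<bar>P t p s \<omega> - K\<bar>"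
    using assms(2) by (simp add: gain_def)
  then show ?thesis by (simp add: power2_le_iff_abs_le[symmetric] abs_le_square_iff)
qed

lemma gain_second_moment:
  assumes t: "t \<in> {0..T}"
  shows "(\<integral>\<^sup>+s. (\<EE> \<omega>. ennreal ((gain t p s \<omega>)\<^sup>2)) \<partial>lborel) \<le> ennreal (T * price_bound p)"
proof -
  have "(\<EE> \<omega>. ennreal ((gain t p s \<omega>)\<^sup>2)) \<le> ennreal (price_bound p) * indicator {0..T} s" for s
  proof (cases "s \<in> {t..T}")
    case True
    have "(\<EE> \<omega>. ennreal ((gain t p s \<omega>)\<^sup>2)) \<le> (\<EE> \<omega>. ennreal ((P t p s \<omega> - K)\<^sup>2))"
      by (intro nn_integral_mono ennreal_leI gain_square_le t True)
    also have "\<dots> \<le> ennreal (price_bound p)" by (rule price_moment[OF t True])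
    finally show ?thesis using True t by (simp add: indicator_def)
  qed (simp add: gain_def)
  then have "(\<integral>\<^sup>+s. (\<EE> \<omega>. ennreal ((gain t p s \<omega>)\<^sup>2)) \<partial>lborel) \<le> (\<integral>\<^sup>+s. ennreal (price_bound p) * indicator {0..T} s \<partial>lborel)"
    by (intro nn_integral_mono)
  also have "\<dots> = ennreal (price_bound p) * ennreal T"
    using T_nonneg by (simp add: nn_integral_cmult_indicator)
  also have "\<dots> = ennreal (T * price_bound p)" using T_nonneg price_bound_nonneg by (simp add: ennreal_mult mult.commute)
  finally show ?thesis .
qed

text \<open>Bounds the mean square distance of two prices at any common time, when \<open>t1 \<le> t2\<close>: the first price has
moved away from \<open>p1\<close> by the time \<open>t2\<close> at which the second one starts in \<open>p2\<close>.\<close>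

definition price_gap :: "real \<Rightarrow> real \<Rightarrow> real \<Rightarrow> real \<Rightarrow> real" where
  "price_gap t1 p1 t2 p2 =
    C0 * (3 * (2 * (2 * (T + 1) * \<kappa> * C0 * (1 + 3 * p1\<^sup>2) * \<bar>t2 - t1\<bar>) + 2 * (p1 - p2)\<^sup>2))"

text \<open>The three summands come from the times in \<open>[t1, t2)\<close>, where only one gain is present, from the two
discount factors, and from the two prices.\<close>

definition gain_gap :: "real \<Rightarrow> real \<Rightarrow> real \<Rightarrow> real \<Rightarrow> real" where
  "gain_gap t1 p1 t2 p2 = price_bound p1 * \<bar>t2 - t1\<bar> + (2 * (r * \<bar>t2 - t1\<bar>)\<^sup>2 * price_bound p1 + 2 * price_gap t1 p1 t2 p2) * T"

lemma price_gap_nonneg: "0 \<le> price_gap t1 p1 t2 p2"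
  unfolding price_gap_def using C0(1) \<kappa>_pos T_nonneg by (intro mult_nonneg_nonneg add_nonneg_nonneg) auto

lemma gain_gap_nonneg: "0 \<le> gain_gap t1 p1 t2 p2"
  unfolding gain_gap_def using price_gap_nonneg price_bound_nonneg T_nonneg by (intro mult_nonneg_nonneg add_nonneg_nonneg) auto

lemma price_difference:
  assumes t: "0 \<le> t1" "t1 \<le> t2" "t2 \<le> T" and s: "s \<in> {t2..T}"
  shows "(\<EE> \<omega>. ennreal ((P t1 p1 s \<omega> - P t2 p2 s \<omega>)\<^sup>2)) \<le> ennreal (price_gap t1 p1 t2 p2)"
proof -
  have t1: "t1 \<in> {0..T}" and t2: "t2 \<in> {0..T}" using t by auto
  define B where "B = 2 * (T + 1) * \<kappa> * C0 * (1 + 3 * p1\<^sup>2) * (t2 - t1)"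
  have B: "0 \<le> B" unfolding B_def using C0(1) \<kappa>_pos T_nonneg t by (intro mult_nonneg_nonneg add_nonneg_nonneg) auto
  have "(\<lambda>\<omega>. P t1 p1 t2 \<omega>) \<in> borel_measurable \<Omega>"
    using joint_measurable_section[OF solution_measurable[OF solution[OF t1, of p1]], of t2] t by simp
  then have [measurable]: "P t1 p1 t2 \<in> borel_measurable \<Omega>" by simp
  have "(\<EE> \<omega>. ennreal ((P t1 p1 t2 \<omega> - p2)\<^sup>2)) \<le> (\<EE> \<omega>. 2 * ennreal ((P t1 p1 t2 \<omega> - p1)\<^sup>2) + 2 * ennreal ((p1 - p2)\<^sup>2))"
  proof (intro nn_integral_mono ennreal_le_double_sum)
    show "(P t1 p1 t2 \<omega> - p2)\<^sup>2 \<le> 2 * (P t1 p1 t2 \<omega> - p1)\<^sup>2 + 2 * (p1 - p2)\<^sup>2" for \<omega>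
      using square_sum_le[of "P t1 p1 t2 \<omega> - p1" "p1 - p2"] by simp
  qed auto
  also have "\<dots> = 2 * (\<EE> \<omega>. ennreal ((P t1 p1 t2 \<omega> - p1)\<^sup>2)) + 2 * ennreal ((p1 - p2)\<^sup>2)"
    by (subst nn_integral_add) (auto simp: nn_integral_cmult emeasure_space_1)
  also have "\<dots> \<le> 2 * ennreal B + 2 * ennreal ((p1 - p2)\<^sup>2)"
    unfolding B_def using solution_increment[OF solution[OF t1], of t2 p1] t by (intro add_mono mult_left_mono) auto
  also have "\<dots> = ennreal (2 * B + 2 * (p1 - p2)\<^sup>2)"
    using B by (simp add: ennreal_mult)
  finally have start: "(\<EE> \<omega>. ennreal ((P t1 p1 t2 \<omega> - p2)\<^sup>2)) \<le> ennreal (2 * B + 2 * (p1 - p2)\<^sup>2)" .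
  have "(\<EE> \<omega>. ennreal ((P t1 p1 s \<omega> - P t2 p2 s \<omega>)\<^sup>2)) \<le>
    ennreal C0 * (3 * (\<EE> \<omega>. ennreal ((P t1 p1 t2 \<omega> - p2)\<^sup>2)))"
    by (rule solution_stability[OF solution[OF t1] solution[OF t2] t s])
  also have "\<dots> \<le> ennreal C0 * (3 * ennreal (2 * B + 2 * (p1 - p2)\<^sup>2))"
    by (intro mult_left_mono start) auto
  also have "\<dots> = ennreal (C0 * (3 * (2 * B + 2 * (p1 - p2)\<^sup>2)))"
  proof -
    have *: "ennreal C0 * (3 * ennreal x) = ennreal (C0 * (3 * x))" if "0 \<le> x" for x
      using that C0(1) by (simp add: ennreal_mult)
    show ?thesis by (rule *) (use B in simp)
  qed
  also have "C0 * (3 * (2 * B + 2 * (p1 - p2)\<^sup>2)) = price_gap t1 p1 t2 p2"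
    using t by (simp add: price_gap_def B_def)
  finally show ?thesis .
qed

lemma gain_difference:
  assumes t: "0 \<le> t1" "t1 \<le> t2" "t2 \<le> T"
  shows "(\<integral>\<^sup>+s. (\<EE> \<omega>. ennreal ((gain t1 p1 s \<omega> - gain t2 p2 s \<omega>)\<^sup>2)) \<partial>lborel) \<le> ennreal (gain_gap t1 p1 t2 p2)"
proof -
  have t1: "t1 \<in> {0..T}" and t2: "t2 \<in> {0..T}" using t by auto
  define B where "B = 2 * (r * (t2 - t1))\<^sup>2 * price_bound p1 + 2 * price_gap t1 p1 t2 p2"
  have B: "0 \<le> B" unfolding B_def using price_bound_nonneg price_gap_nonneg by simp
  have "(\<EE> \<omega>. ennreal ((gain t1 p1 s \<omega> - gain t2 p2 s \<omega>)\<^sup>2)) \<le>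
    ennreal (price_bound p1) * indicator {t1..t2} s + ennreal B * indicator {0..T} s" for s
  proof -
    consider "s \<notin> {t1..T}" | "s \<in> {t1..<t2}" | "s \<in> {t2..T}" using t by force
    then show ?thesis
    proof cases
      case 1
      then have "gain t1 p1 s \<omega> = 0" "gain t2 p2 s \<omega> = 0" for \<omega> using t by (auto simp: gain_def)
      then show ?thesis by simp
    next
      case 2
      have "(\<EE> \<omega>. ennreal ((gain t1 p1 s \<omega> - gain t2 p2 s \<omega>)\<^sup>2)) \<le> (\<EE> \<omega>. ennreal ((P t1 p1 s \<omega> - K)\<^sup>2))"
      proof (intro nn_integral_mono ennreal_leI)
        fix \<omega>
        have "gain t2 p2 s \<omega> = 0" using 2 by (simp add: gain_def)
        then show "(gain t1 p1 s \<omega> - gain t2 p2 s \<omega>)\<^sup>2 \<le> (P t1 p1 s \<omega> - K)\<^sup>2"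
          using gain_square_le[OF t1, of s p1 \<omega>] 2 t by simp
      qed
      also have "\<dots> \<le> ennreal (price_bound p1)" using price_moment[OF t1] 2 t by simp
      also have "\<dots> \<le> ennreal (price_bound p1) * indicator {t1..t2} s + ennreal B * indicator {0..T} s"
        using 2 by (simp add: indicator_def)
      finally show ?thesis .
    next
      case 3
      have s1: "s \<in> {t1..T}" using 3 t by simp
      have "(\<lambda>\<omega>. P t1 p1 s \<omega>) \<in> borel_measurable \<Omega>" "(\<lambda>\<omega>. P t2 p2 s \<omega>) \<in> borel_measurable \<Omega>"
        using joint_measurable_section[OF solution_measurable[OF solution[OF t1, of p1]], of s]
          joint_measurable_section[OF solution_measurable[OF solution[OF t2, of p2]], of s] t 3 s1 by simp_all
      then have [measurable]: "P t1 p1 s \<in> borel_measurable \<Omega>" "P t2 p2 s \<in> borel_measurable \<Omega>" by simp_all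
      let ?e1 = "exp (- r * (s - t1))" and ?e2 = "exp (- r * (s - t2))"
      have sq: "(?e1 - ?e2)\<^sup>2 \<le> (r * (t2 - t1))\<^sup>2"
        using abs_exp_diff_le[OF r t(2), of s] 3 by (intro power2_le_iff_abs_le[THEN iffD2]) auto
      have e2: "?e2\<^sup>2 \<le> 1" using r 3 by (simp add: power_le_one)
      have "(\<EE> \<omega>. ennreal ((gain t1 p1 s \<omega> - gain t2 p2 s \<omega>)\<^sup>2)) \<le>
        (\<EE> \<omega>. ennreal (2 * (r * (t2 - t1))\<^sup>2) * ennreal ((P t1 p1 s \<omega> - K)\<^sup>2) + 2 * ennreal ((P t1 p1 s \<omega> - P t2 p2 s \<omega>)\<^sup>2))"
      proof (rule nn_integral_mono)
        fix \<omega>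
        have "gain t1 p1 s \<omega> - gain t2 p2 s \<omega> = (?e1 - ?e2) * (P t1 p1 s \<omega> - K) + ?e2 * (P t1 p1 s \<omega> - P t2 p2 s \<omega>)"
          using 3 s1 by (simp add: gain_def algebra_simps)
        then have "(gain t1 p1 s \<omega> - gain t2 p2 s \<omega>)\<^sup>2 \<le> 2 * ((?e1 - ?e2) * (P t1 p1 s \<omega> - K))\<^sup>2 + 2 * (?e2 * (P t1 p1 s \<omega> - P t2 p2 s \<omega>))\<^sup>2"
          by (simp only: square_sum_le)
        also have "\<dots> \<le> 2 * ((r * (t2 - t1))\<^sup>2 * (P t1 p1 s \<omega> - K)\<^sup>2) + 2 * (1 * (P t1 p1 s \<omega> - P t2 p2 s \<omega>)\<^sup>2)"
          unfolding power_mult_distrib[of "?e1 - ?e2"] power_mult_distrib[of ?e2]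
          by (intro add_mono mult_left_mono mult_right_mono sq e2) auto
        finally have "ennreal ((gain t1 p1 s \<omega> - gain t2 p2 s \<omega>)\<^sup>2) \<le>
          2 * ennreal ((r * (t2 - t1))\<^sup>2 * (P t1 p1 s \<omega> - K)\<^sup>2) + 2 * ennreal ((P t1 p1 s \<omega> - P t2 p2 s \<omega>)\<^sup>2)"
          by (intro ennreal_le_double_sum) auto
        also have "2 * ennreal ((r * (t2 - t1))\<^sup>2 * (P t1 p1 s \<omega> - K)\<^sup>2) = ennreal (2 * (r * (t2 - t1))\<^sup>2) * ennreal ((P t1 p1 s \<omega> - K)\<^sup>2)"
          by (simp add: ennreal_mult mult.assoc)
        finally show "ennreal ((gain t1 p1 s \<omega> - gain t2 p2 s \<omega>)\<^sup>2) \<le>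
          ennreal (2 * (r * (t2 - t1))\<^sup>2) * ennreal ((P t1 p1 s \<omega> - K)\<^sup>2) + 2 * ennreal ((P t1 p1 s \<omega> - P t2 p2 s \<omega>)\<^sup>2)" .
      qed
      also have "\<dots> = ennreal (2 * (r * (t2 - t1))\<^sup>2) * (\<EE> \<omega>. ennreal ((P t1 p1 s \<omega> - K)\<^sup>2)) + 2 * (\<EE> \<omega>. ennreal ((P t1 p1 s \<omega> - P t2 p2 s \<omega>)\<^sup>2))"
        by (subst nn_integral_add) (auto simp: nn_integral_cmult)
      also have "\<dots> \<le> ennreal (2 * (r * (t2 - t1))\<^sup>2) * ennreal (price_bound p1) + 2 * ennreal (price_gap t1 p1 t2 p2)"
        by (intro add_mono mult_left_mono price_moment[OF t1 s1] price_difference[OF t 3]) auto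
      also have "\<dots> = ennreal B"
        unfolding B_def using price_bound_nonneg price_gap_nonneg by (simp add: ennreal_mult)
      also have "\<dots> \<le> ennreal (price_bound p1) * indicator {t1..t2} s + ennreal B * indicator {0..T} s"
        using 3 t by (simp add: indicator_def)
      finally show ?thesis .
    qed
  qed
  then have "(\<integral>\<^sup>+s. (\<EE> \<omega>. ennreal ((gain t1 p1 s \<omega> - gain t2 p2 s \<omega>)\<^sup>2)) \<partial>lborel) \<le>
    (\<integral>\<^sup>+s. ennreal (price_bound p1) * indicator {t1..t2} s + ennreal B * indicator {0..T} s \<partial>lborel)"
    by (intro nn_integral_mono)
  also have "\<dots> = ennreal (price_bound p1) * ennreal (t2 - t1) + ennreal B * ennreal T"
    using t T_nonneg by (subst nn_integral_add) (auto simp: nn_integral_cmult_indicator)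
  also have "\<dots> = ennreal (gain_gap t1 p1 t2 p2)"
    using t T_nonneg price_bound_nonneg B by (simp add: ennreal_mult gain_gap_def B_def)
  finally show ?thesis .
qed

text \<open>One of the two summands is a bound, depending on which starting time is the earlier one; the sum is
symmetric.\<close>

definition total_gap :: "real \<Rightarrow> real \<Rightarrow> real \<Rightarrow> real \<Rightarrow> real" where
  "total_gap t1 p1 t2 p2 = gain_gap t1 p1 t2 p2 + gain_gap t2 p2 t1 p1"

lemma gain_difference_total:
  assumes t1: "t1 \<in> {0..T}" and t2: "t2 \<in> {0..T}"
  shows "(\<integral>\<^sup>+s. (\<EE> \<omega>. ennreal ((gain t1 p1 s \<omega> - gain t2 p2 s \<omega>)\<^sup>2)) \<partial>lborel) \<le> ennreal (total_gap t1 p1 t2 p2)"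
proof (cases "t1 \<le> t2")
  case True
  have "(\<integral>\<^sup>+s. (\<EE> \<omega>. ennreal ((gain t1 p1 s \<omega> - gain t2 p2 s \<omega>)\<^sup>2)) \<partial>lborel) \<le> ennreal (gain_gap t1 p1 t2 p2)"
    using t1 t2 True by (intro gain_difference) auto
  also have "\<dots> \<le> ennreal (total_gap t1 p1 t2 p2)"
    unfolding total_gap_def using gain_gap_nonneg[of t2 p2 t1 p1] by (intro ennreal_leI) simp
  finally show ?thesis .
next
  case False
  have "(\<integral>\<^sup>+s. (\<EE> \<omega>. ennreal ((gain t2 p2 s \<omega> - gain t1 p1 s \<omega>)\<^sup>2)) \<partial>lborel) \<le> ennreal (gain_gap t2 p2 t1 p1)"
    using t1 t2 False by (intro gain_difference) auto
  also have "\<dots> \<le> ennreal (total_gap t1 p1 t2 p2)"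
    unfolding total_gap_def using gain_gap_nonneg[of t1 p1 t2 p2] by (intro ennreal_leI) simp
  finally show ?thesis by (simp add: power2_commute)
qed

lemma product_nn_integral:
  assumes [measurable]: "jointly_measurable g"
  shows "(\<integral>\<^sup>+z. g (fst z) (snd z) \<partial>(lborel \<Otimes>\<^sub>M \<Omega>)) = (\<integral>\<^sup>+s. (\<EE> \<omega>. g s \<omega>) \<partial>lborel)"
  by (subst nn_integral_fst[symmetric]) auto

lemma
  assumes u: "u \<in> controls \<Omega> F T ubar t" and t: "t \<in> {0..T}"
  shows gain_rate_integrable: "integrable (lborel \<Otimes>\<^sub>M \<Omega>) (\<lambda>z. gain t p (fst z) (snd z) * rate t u (fst z) (snd z))"
    and payoff_product: "payoff t p u = (\<integral>z. gain t p (fst z) (snd z) * rate t u (fst z) (snd z) \<partial>(lborel \<Otimes>\<^sub>M \<Omega>))"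
    and payoff_bound: "\<bar>payoff t p u\<bar> \<le> ubar * (T + T * price_bound p)"
proof -
  have tT: "t \<le> T" using t by simp
  note [measurable] = gain_measurable[OF t, of p] rate_measurable[OF u tT]
  have "(\<integral>\<^sup>+z. ennreal (norm (gain t p (fst z) (snd z) * rate t u (fst z) (snd z))) \<partial>(lborel \<Otimes>\<^sub>M \<Omega>)) =
    (\<integral>\<^sup>+s. (\<EE> \<omega>. ennreal (norm (gain t p s \<omega> * rate t u s \<omega>))) \<partial>lborel)"
    by (rule product_nn_integral) measurable
  also have "\<dots> \<le> (\<integral>\<^sup>+s. ennreal ubar * (indicator {0..T} s + (\<EE> \<omega>. ennreal ((gain t p s \<omega>)\<^sup>2))) \<partial>lborel)"
  proof (rule nn_integral_mono)
    fix s
    have "(\<EE> \<omega>. ennreal (norm (gain t p s \<omega> * rate t u s \<omega>))) \<le>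
      (\<EE> \<omega>. ennreal ubar * (indicator {0..T} s + ennreal ((gain t p s \<omega>)\<^sup>2)))"
    proof (rule nn_integral_mono)
      fix \<omega> assume \<omega>: "\<omega> \<in> space \<Omega>"
      have "\<bar>gain t p s \<omega>\<bar> \<le> indicator {0..T} s + (gain t p s \<omega>)\<^sup>2"
        using abs_le_weighted_square[of 1 "gain t p s \<omega>"] t by (cases "s \<in> {t..T}") (auto simp: gain_def)
      then have "norm (gain t p s \<omega> * rate t u s \<omega>) \<le> (indicator {0..T} s + (gain t p s \<omega>)\<^sup>2) * ubar"
        unfolding real_norm_def abs_mult using rate_bounds[OF u tT \<omega>, of s] by (intro mult_mono) auto
      then have "ennreal (norm (gain t p s \<omega> * rate t u s \<omega>)) \<le> ennreal (ubar * (indicator {0..T} s + (gain t p s \<omega>)\<^sup>2))"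
        by (intro ennreal_leI) (simp add: mult.commute)
      then show "ennreal (norm (gain t p s \<omega> * rate t u s \<omega>)) \<le> ennreal ubar * (indicator {0..T} s + ennreal ((gain t p s \<omega>)\<^sup>2))"
        using ubar by (simp add: ennreal_mult ennreal_indicator)
    qed
    also have "\<dots> = ennreal ubar * (indicator {0..T} s + (\<EE> \<omega>. ennreal ((gain t p s \<omega>)\<^sup>2)))"
      by (simp add: nn_integral_cmult nn_integral_add emeasure_space_1)
    finally show "(\<EE> \<omega>. ennreal (norm (gain t p s \<omega> * rate t u s \<omega>))) \<le> \<dots>" .
  qed
  also have "\<dots> = ennreal ubar * (ennreal T + (\<integral>\<^sup>+s. (\<EE> \<omega>. ennreal ((gain t p s \<omega>)\<^sup>2)) \<partial>lborel))"
    using T_nonneg by (simp add: nn_integral_cmult nn_integral_add)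
  also have "\<dots> \<le> ennreal ubar * (ennreal T + ennreal (T * price_bound p))"
    by (intro mult_left_mono add_mono gain_second_moment[OF t]) auto
  also have "\<dots> = ennreal (ubar * (T + T * price_bound p))"
    using ubar T_nonneg price_bound_nonneg by (simp add: ennreal_mult)
  finally have bound: "(\<integral>\<^sup>+z. ennreal (norm (gain t p (fst z) (snd z) * rate t u (fst z) (snd z))) \<partial>(lborel \<Otimes>\<^sub>M \<Omega>)) \<le> ennreal (ubar * (T + T * price_bound p))" .
  show int: "integrable (lborel \<Otimes>\<^sub>M \<Omega>) (\<lambda>z. gain t p (fst z) (snd z) * rate t u (fst z) (snd z))"
    by (rule integrableI_bounded) (use bound in \<open>auto intro: le_less_trans\<close>)
  interpret pair_sigma_finite lborel \<Omega> ..
  have "payoff t p u = expectation (\<lambda>\<omega>. LINT s|lborel. gain t p s \<omega> * rate t u s \<omega>)"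
    unfolding payoff_def set_lebesgue_integral_def
    by (intro Bochner_Integration.integral_cong refl) (auto simp: gain_def rate_def indicator_def)
  also have "\<dots> = (\<integral>z. gain t p (fst z) (snd z) * rate t u (fst z) (snd z) \<partial>(lborel \<Otimes>\<^sub>M \<Omega>))"
    using integral_snd[of "\<lambda>s \<omega>. gain t p s \<omega> * rate t u s \<omega>"] int by (simp add: case_prod_beta')
  finally show eq: "payoff t p u = (\<integral>z. gain t p (fst z) (snd z) * rate t u (fst z) (snd z) \<partial>(lborel \<Otimes>\<^sub>M \<Omega>))" .
  have "ennreal \<bar>payoff t p u\<bar> \<le> ennreal (ubar * (T + T * price_bound p))"
    unfolding eq using order_trans[OF integral_norm_bound_ennreal[OF int] bound] by simp
  then show "\<bar>payoff t p u\<bar> \<le> ubar * (T + T * price_bound p)"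
    using ubar T_nonneg price_bound_nonneg by (subst (asm) ennreal_le_iff) auto
qed

text \<open>The difference of the integrands is \<open>(g1 - g2) u1 + g2 (u1 - u2)\<close>.  The weight \<open>\<eta>\<close> trades the second moment
of the gain, which is only bounded, for the squares of the errors, which are small.\<close>

lemma payoff_difference:
  assumes u1: "u1 \<in> controls \<Omega> F T ubar t1" and u2: "u2 \<in> controls \<Omega> F T ubar t2"
    and t1: "t1 \<in> {0..T}" and t2: "t2 \<in> {0..T}" and \<eta>: "0 < \<eta>" and \<delta>: "0 \<le> \<delta>"
    and close: "AE \<omega> in \<Omega>. (LBINT s:{t2..T}. \<bar>(if t1 \<le> s then u1 s \<omega> else 0) - u2 s \<omega>\<bar>) \<le> \<delta>"
  shows "\<bar>payoff t1 p1 u1 - payoff t2 p2 u2\<bar> \<le>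
    ubar * (\<eta> * T + total_gap t1 p1 t2 p2 / \<eta>) + (\<eta> * (T * price_bound p2) + ubar / \<eta> * \<delta>)"
proof -
  have tT: "t1 \<le> T" "t2 \<le> T" using t1 t2 by auto
  note [measurable] = gain_measurable[OF t1, of p1] rate_measurable[OF u1 tT(1)] gain_measurable[OF t2, of p2] rate_measurable[OF u2 tT(2)]
  define \<rho> where "\<rho> s \<omega> = indicator {t2..T} s * \<bar>rate t1 u1 s \<omega> - rate t2 u2 s \<omega>\<bar>" for s \<omega>
  have [measurable]: "jointly_measurable \<rho>" unfolding \<rho>_def by measurable
  interpret pair_sigma_finite lborel \<Omega> ..
  have "(\<integral>\<^sup>+s. (\<EE> \<omega>. ennreal (\<rho> s \<omega>)) \<partial>lborel) = (\<EE> \<omega>. (\<integral>\<^sup>+s. ennreal (\<rho> s \<omega>) \<partial>lborel))"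
    by (rule Fubini'[symmetric]) measurable
  also have "\<dots> \<le> (\<EE> \<omega>. ennreal \<delta>)"
  proof (rule nn_integral_mono_AE, use close AE_space in eventually_elim)
    case (elim \<omega>)
    have w: "(\<lambda>s \<omega>. if t1 \<le> s then u1 s \<omega> else 0) \<in> controls \<Omega> F T ubar t2"
      using extend_control[OF u1] t1 t2 ubar by simp
    have int: "set_integrable lborel {t2..T} (\<lambda>s. \<bar>(if t1 \<le> s then u1 s \<omega> else 0) - u2 s \<omega>\<bar>)"
      using control_set_integrable[OF w tT(2)] control_set_integrable[OF u2 tT(2)] elim
      by (intro set_integrable_abs set_integral_diff) auto
    have "(\<integral>\<^sup>+s. ennreal (\<rho> s \<omega>) \<partial>lborel) = (\<integral>\<^sup>+s\<in>{t2..T}. ennreal \<bar>(if t1 \<le> s then u1 s \<omega> else 0) - u2 s \<omega>\<bar> \<partial>lborel)"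
      by (intro nn_integral_cong) (auto simp: \<rho>_def rate_def indicator_def)
    also have "\<dots> = ennreal (LBINT s:{t2..T}. \<bar>(if t1 \<le> s then u1 s \<omega> else 0) - u2 s \<omega>\<bar>)"
      by (rule nn_integral_eq_set_lebesgue_integral[OF int]) simp
    also have "\<dots> \<le> ennreal \<delta>" using elim by (intro ennreal_leI) simp
    finally show ?case .
  qed
  finally have E\<rho>: "(\<integral>\<^sup>+s. (\<EE> \<omega>. ennreal (\<rho> s \<omega>)) \<partial>lborel) \<le> ennreal \<delta>" by (simp add: emeasure_space_1)
  define g1 where "g1 = gain t1 p1"
  define g2 where "g2 = gain t2 p2"
  note [measurable] = gain_measurable[OF t1, of p1, folded g1_def] gain_measurable[OF t2, of p2, folded g2_def]
  define R where "R s \<omega> = ubar * (\<eta> * indicator {0..T} s + (g1 s \<omega> - g2 s \<omega>)\<^sup>2 / \<eta>) + (\<eta> * (g2 s \<omega>)\<^sup>2 + ubar / \<eta> * \<rho> s \<omega>)" for s \<omega>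
  have pointwise: "\<bar>g1 s \<omega> * rate t1 u1 s \<omega> - g2 s \<omega> * rate t2 u2 s \<omega>\<bar> \<le> R s \<omega>" if \<omega>: "\<omega> \<in> space \<Omega>" for s \<omega>
  proof -
    note b1 = rate_bounds[OF u1 tT(1) \<omega>, of s] and b2 = rate_bounds[OF u2 tT(2) \<omega>, of s]
    have "\<bar>(g1 s \<omega> - g2 s \<omega>) * rate t1 u1 s \<omega>\<bar> \<le> (\<eta> * indicator {0..T} s + (g1 s \<omega> - g2 s \<omega>)\<^sup>2 / \<eta>) * ubar"
      unfolding abs_mult
    proof (intro mult_mono)
      show "\<bar>g1 s \<omega> - g2 s \<omega>\<bar> \<le> \<eta> * indicator {0..T} s + (g1 s \<omega> - g2 s \<omega>)\<^sup>2 / \<eta>"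
        using abs_le_weighted_square[OF \<eta>, of "g1 s \<omega> - g2 s \<omega>"] t1 t2
        by (cases "s \<in> {0..T}") (auto simp: g1_def g2_def gain_def)
      then show "0 \<le> \<eta> * indicator {0..T} s + (g1 s \<omega> - g2 s \<omega>)\<^sup>2 / \<eta>" by linarith
    qed (use b1 in auto)
    moreover have "\<bar>g2 s \<omega> * (rate t1 u1 s \<omega> - rate t2 u2 s \<omega>)\<bar> \<le> \<eta> * (g2 s \<omega>)\<^sup>2 + ubar / \<eta> * \<rho> s \<omega>"
    proof (cases "s \<in> {t2..T}")
      case True
      have "(rate t1 u1 s \<omega> - rate t2 u2 s \<omega>)\<^sup>2 \<le> ubar * \<bar>rate t1 u1 s \<omega> - rate t2 u2 s \<omega>\<bar>"
        unfolding power2_eq_square abs_mult_self_eq[symmetric, of "rate t1 u1 s \<omega> - rate t2 u2 s \<omega>"]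
        using b1 b2 by (intro mult_right_mono) auto
      then have "(rate t1 u1 s \<omega> - rate t2 u2 s \<omega>)\<^sup>2 / \<eta> \<le> ubar / \<eta> * \<rho> s \<omega>"
        using \<eta> True by (simp add: \<rho>_def divide_right_mono)
      then show ?thesis
        using abs_mult_le_weighted_squares[OF \<eta>, of "g2 s \<omega>" "rate t1 u1 s \<omega> - rate t2 u2 s \<omega>"] by linarith
    qed (auto simp: g2_def gain_def \<rho>_def)
    moreover have "g1 s \<omega> * rate t1 u1 s \<omega> - g2 s \<omega> * rate t2 u2 s \<omega> =
      (g1 s \<omega> - g2 s \<omega>) * rate t1 u1 s \<omega> + g2 s \<omega> * (rate t1 u1 s \<omega> - rate t2 u2 s \<omega>)"
      by (simp add: algebra_simps)
    ultimately show ?thesis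
      unfolding R_def by (simp only: mult.commute[of _ ubar])
  qed
  note int1 = gain_rate_integrable[OF u1 t1, of p1, folded g1_def] and int2 = gain_rate_integrable[OF u2 t2, of p2, folded g2_def]
  let ?d = "\<lambda>z. g1 (fst z) (snd z) * rate t1 u1 (fst z) (snd z) - g2 (fst z) (snd z) * rate t2 u2 (fst z) (snd z)"
  have "payoff t1 p1 u1 - payoff t2 p2 u2 = (\<integral>z. ?d z \<partial>(lborel \<Otimes>\<^sub>M \<Omega>))"
    unfolding payoff_product[OF u1 t1, of p1, folded g1_def] payoff_product[OF u2 t2, of p2, folded g2_def]
    using int1 int2 by simp
  then have "ennreal \<bar>payoff t1 p1 u1 - payoff t2 p2 u2\<bar> \<le> (\<integral>\<^sup>+z. ennreal \<bar>?d z\<bar> \<partial>(lborel \<Otimes>\<^sub>M \<Omega>))"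
    using integral_norm_bound_ennreal[OF Bochner_Integration.integrable_diff[OF int1 int2]] by simp
  also have "\<dots> = (\<integral>\<^sup>+s. (\<EE> \<omega>. ennreal \<bar>g1 s \<omega> * rate t1 u1 s \<omega> - g2 s \<omega> * rate t2 u2 s \<omega>\<bar>) \<partial>lborel)"
    by (rule product_nn_integral) measurable
  also have "\<dots> \<le> (\<integral>\<^sup>+s. (\<EE> \<omega>. ennreal (R s \<omega>)) \<partial>lborel)"
    by (intro nn_integral_mono ennreal_leI pointwise)
  also have "\<dots> = (\<integral>\<^sup>+s. ennreal (ubar * \<eta>) * indicator {0..T} s + ennreal (ubar / \<eta>) * (\<EE> \<omega>. ennreal ((g1 s \<omega> - g2 s \<omega>)\<^sup>2))
     + ennreal \<eta> * (\<EE> \<omega>. ennreal ((g2 s \<omega>)\<^sup>2)) + ennreal (ubar / \<eta>) * (\<EE> \<omega>. ennreal (\<rho> s \<omega>)) \<partial>lborel)"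
  proof (rule nn_integral_cong)
    fix s
    have "ennreal (R s \<omega>) = ennreal (ubar * \<eta>) * indicator {0..T} s + ennreal (ubar / \<eta>) * ennreal ((g1 s \<omega> - g2 s \<omega>)\<^sup>2)
      + ennreal \<eta> * ennreal ((g2 s \<omega>)\<^sup>2) + ennreal (ubar / \<eta>) * ennreal (\<rho> s \<omega>)" for \<omega>
    proof -
      have \<rho>: "0 \<le> \<rho> s \<omega>" by (simp add: \<rho>_def)
      have "R s \<omega> = ubar * \<eta> * indicator {0..T} s + ubar / \<eta> * (g1 s \<omega> - g2 s \<omega>)\<^sup>2 + \<eta> * (g2 s \<omega>)\<^sup>2 + ubar / \<eta> * \<rho> s \<omega>"
        by (simp add: R_def algebra_simps)
      also have "ennreal \<dots> = ennreal (ubar * \<eta>) * ennreal (indicator {0..T} s) + ennreal (ubar / \<eta>) * ennreal ((g1 s \<omega> - g2 s \<omega>)\<^sup>2)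
        + ennreal \<eta> * ennreal ((g2 s \<omega>)\<^sup>2) + ennreal (ubar / \<eta>) * ennreal (\<rho> s \<omega>)"
        using ubar \<eta> \<rho> by (simp only: ennreal_plus[symmetric] ennreal_mult[symmetric] mult_nonneg_nonneg
            divide_nonneg_nonneg less_imp_le zero_le_power2 indicator_pos_le add_nonneg_nonneg)
      finally show ?thesis by (simp add: ennreal_indicator)
    qed
    then show "(\<EE> \<omega>. ennreal (R s \<omega>)) = ennreal (ubar * \<eta>) * indicator {0..T} s + ennreal (ubar / \<eta>) * (\<EE> \<omega>. ennreal ((g1 s \<omega> - g2 s \<omega>)\<^sup>2))
     + ennreal \<eta> * (\<EE> \<omega>. ennreal ((g2 s \<omega>)\<^sup>2)) + ennreal (ubar / \<eta>) * (\<EE> \<omega>. ennreal (\<rho> s \<omega>))"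
      by (simp add: nn_integral_add nn_integral_cmult emeasure_space_1)
  qed
  also have "\<dots> = ennreal (ubar * \<eta>) * ennreal T + ennreal (ubar / \<eta>) * (\<integral>\<^sup>+s. (\<EE> \<omega>. ennreal ((g1 s \<omega> - g2 s \<omega>)\<^sup>2)) \<partial>lborel)
    + ennreal \<eta> * (\<integral>\<^sup>+s. (\<EE> \<omega>. ennreal ((g2 s \<omega>)\<^sup>2)) \<partial>lborel) + ennreal (ubar / \<eta>) * (\<integral>\<^sup>+s. (\<EE> \<omega>. ennreal (\<rho> s \<omega>)) \<partial>lborel)"
    using T_nonneg by (simp add: nn_integral_add nn_integral_cmult nn_integral_cmult_indicator)
  also have "\<dots> \<le> ennreal (ubar * \<eta>) * ennreal T + ennreal (ubar / \<eta>) * ennreal (total_gap t1 p1 t2 p2)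
    + ennreal \<eta> * ennreal (T * price_bound p2) + ennreal (ubar / \<eta>) * ennreal \<delta>"
    unfolding g1_def g2_def
    by (intro add_mono mult_left_mono gain_difference_total[OF t1 t2] gain_second_moment[OF t2] E\<rho>) auto
  also have "\<dots> = ennreal (ubar * \<eta> * T + ubar / \<eta> * total_gap t1 p1 t2 p2 + \<eta> * (T * price_bound p2) + ubar / \<eta> * \<delta>)"
    using ubar \<eta> \<delta> T_nonneg price_bound_nonneg[of p2] gain_gap_nonneg[of t1 p1 t2 p2] gain_gap_nonneg[of t2 p2 t1 p1]
    by (simp only: ennreal_plus[symmetric] ennreal_mult[symmetric] mult_nonneg_nonneg
            divide_nonneg_nonneg less_imp_le add_nonneg_nonneg total_gap_def)
  finally have "\<bar>payoff t1 p1 u1 - payoff t2 p2 u2\<bar> \<le> ubar * \<eta> * T + ubar / \<eta> * total_gap t1 p1 t2 p2 + \<eta> * (T * price_bound p2) + ubar / \<eta> * \<delta>"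
  proof (subst (asm) ennreal_le_iff)
    show "0 \<le> ubar * \<eta> * T + ubar / \<eta> * total_gap t1 p1 t2 p2 + \<eta> * (T * price_bound p2) + ubar / \<eta> * \<delta>"
      using ubar \<eta> \<delta> T_nonneg price_bound_nonneg[of p2] gain_gap_nonneg[of t1 p1 t2 p2] gain_gap_nonneg[of t2 p2 t1 p1]
      by (intro add_nonneg_nonneg mult_nonneg_nonneg) (auto simp: total_gap_def)
  qed
  then show ?thesis by (simp add: algebra_simps)
qed

text \<open>For fixed \<open>\<eta>\<close> this is continuous, and on the diagonal it is a multiple of \<open>\<eta>\<close>.\<close>

definition modulus :: "real \<Rightarrow> real \<times> real \<times> real \<Rightarrow> real \<times> real \<times> real \<Rightarrow> real" where
  "modulus \<eta> q1 q2 = (case q1 of (t1, p1, z1) \<Rightarrow> case q2 of (t2, p2, z2) \<Rightarrow>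
    ubar * (\<eta> * T + total_gap t1 p1 t2 p2 / \<eta>) +
    (\<eta> * (T * (price_bound p1 + price_bound p2)) + ubar / \<eta> * (\<bar>z1 - z2\<bar> + ubar * \<bar>t1 - t2\<bar>)))"

lemma modulus_commute: "modulus \<eta> q1 q2 = modulus \<eta> q2 q1"
  by (auto simp: modulus_def total_gap_def abs_minus_commute add.commute split: prod.split)

abbreviation V where "V t p z \<equiv> swing_value \<Omega> F P T r K ubar m M t p z"

lemma value_eq: "V t p z = (SUP u\<in>admissible \<Omega> F T ubar m M t z. payoff t p u)"
  by (simp add: swing_value_def payoff_def)

lemma value_le:
  assumes q1: "(t1, p1, z1) \<in> swing_domain T ubar m M" and q2: "(t2, p2, z2) \<in> swing_domain T ubar m M" and \<eta>: "0 < \<eta>"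
  shows "V t1 p1 z1 \<le> V t2 p2 z2 + modulus \<eta> (t1, p1, z1) (t2, p2, z2)"
  unfolding value_eq
proof (rule cSUP_least)
  have t1: "t1 \<in> {0..T}" and t2: "t2 \<in> {0..T}" and z1: "z1 \<le> M" "m - ubar * (T - t1) \<le> z1"
    and z2: "z2 \<le> M" "m - ubar * (T - t2) \<le> z2"
    using q1 q2 by (auto simp: swing_domain_def)
  show "admissible \<Omega> F T ubar m M t1 z1 \<noteq> {}"
    using t1 z1 ubar mM by (intro admissible_nonempty) auto
  fix u assume u: "u \<in> admissible \<Omega> F T ubar m M t1 z1"
  define \<delta> where "\<delta> = \<bar>z1 - z2\<bar> + ubar * \<bar>t1 - t2\<bar>"
  have "\<exists>u'\<in>admissible \<Omega> F T ubar m M t2 z2.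
    AE \<omega> in \<Omega>. (LBINT s:{t2..T}. \<bar>(if t1 \<le> s then u s \<omega> else 0) - u' s \<omega>\<bar>) \<le> \<delta>"
    unfolding \<delta>_def using t1 t2 z2 ubar mM by (intro admissible_transfer[OF u]) auto
  then obtain u' where u': "u' \<in> admissible \<Omega> F T ubar m M t2 z2"
    and close: "AE \<omega> in \<Omega>. (LBINT s:{t2..T}. \<bar>(if t1 \<le> s then u s \<omega> else 0) - u' s \<omega>\<bar>) \<le> \<delta>" ..
  have c: "u \<in> controls \<Omega> F T ubar t1" "u' \<in> controls \<Omega> F T ubar t2"
    using u u' by (auto simp: admissible_def)
  have "\<bar>payoff t1 p1 u - payoff t2 p2 u'\<bar> \<le>
    ubar * (\<eta> * T + total_gap t1 p1 t2 p2 / \<eta>) + (\<eta> * (T * price_bound p2) + ubar / \<eta> * \<delta>)"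
    using ubar by (intro payoff_difference[OF c t1 t2 \<eta> _ close]) (simp add: \<delta>_def)
  also have "\<dots> \<le> modulus \<eta> (t1, p1, z1) (t2, p2, z2)"
    using \<eta> T_nonneg price_bound_nonneg[of p1] by (simp add: modulus_def \<delta>_def distrib_left)
  finally have "payoff t1 p1 u \<le> payoff t2 p2 u' + modulus \<eta> (t1, p1, z1) (t2, p2, z2)" by linarith
  moreover have "payoff t2 p2 u' \<le> (SUP u\<in>admissible \<Omega> F T ubar m M t2 z2. payoff t2 p2 u)"
  proof (rule cSUP_upper[OF u'])
    show "bdd_above (payoff t2 p2 ` admissible \<Omega> F T ubar m M t2 z2)"
    proof (rule bdd_aboveI2)
      fix v assume "v \<in> admissible \<Omega> F T ubar m M t2 z2"
      then have "\<bar>payoff t2 p2 v\<bar> \<le> ubar * (T + T * price_bound p2)"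
        by (intro payoff_bound[OF _ t2]) (simp add: admissible_def)
      then show "payoff t2 p2 v \<le> ubar * (T + T * price_bound p2)" by linarith
    qed
  qed
  ultimately show "payoff t1 p1 u \<le> (SUP u\<in>admissible \<Omega> F T ubar m M t2 z2. payoff t2 p2 u) + modulus \<eta> (t1, p1, z1) (t2, p2, z2)"
    by linarith
qed

lemma modulus_tendsto: "((\<lambda>q. modulus \<eta> q q0) \<longlongrightarrow> modulus \<eta> q0 q0) (at q0 within S)"
proof -
  have "modulus \<eta> q q' = ubar * (\<eta> * T + total_gap (fst q) (fst (snd q)) (fst q') (fst (snd q')) / \<eta>) +
    (\<eta> * (T * (price_bound (fst (snd q)) + price_bound (fst (snd q')))) + ubar / \<eta> * (\<bar>snd (snd q) - snd (snd q')\<bar> + ubar * \<bar>fst q - fst q'\<bar>))" for q q'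
    by (simp add: modulus_def split: prod.split)
  moreover have "((\<lambda>q. q) \<longlongrightarrow> q0) (at q0 within S)" by (rule tendsto_ident_at)
  ultimately show ?thesis
    unfolding total_gap_def gain_gap_def price_gap_def price_bound_def
    by (simp only: divide_inverse) (intro tendsto_intros)
qed

lemma modulus_diagonal: "modulus \<eta> (t, p, z) (t, p, z) = \<eta> * (ubar * T + T * (price_bound p + price_bound p))"
  by (simp add: modulus_def total_gap_def gain_gap_def price_gap_def algebra_simps)

theorem value_continuous:
  "continuous_on (swing_domain T ubar m M) (\<lambda>(t, p, z). V t p z)"
  unfolding continuous_on_def
proof
  fix q0 assume q0: "q0 \<in> swing_domain T ubar m M"
  obtain t0 p0 z0 where q0_eq: "q0 = (t0, p0, z0)" by (cases q0)
  let ?v = "\<lambda>(t, p, z). V t p z"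
  show "(?v \<longlongrightarrow> ?v q0) (at q0 within swing_domain T ubar m M)"
  proof (rule tendstoI)
    fix e :: real assume e: "0 < e"
    define c where "c = ubar * T + T * (price_bound p0 + price_bound p0)"
    have c: "0 \<le> c" using ubar T_nonneg price_bound_nonneg[of p0] by (simp add: c_def)
    define \<eta> where "\<eta> = e / (c + 1)"
    have \<eta>: "0 < \<eta>" using e c by (simp add: \<eta>_def)
    have "modulus \<eta> q0 q0 < e"
    proof -
      have "\<eta> * c < \<eta> * (c + 1)" using \<eta> by simp
      also have "\<eta> * (c + 1) = e" using c by (simp add: \<eta>_def)
      finally show ?thesis by (simp add: q0_eq modulus_diagonal c_def)
    qed
    from order_tendstoD(2)[OF modulus_tendsto this]
    have "\<forall>\<^sub>F q in at q0 within swing_domain T ubar m M. modulus \<eta> q q0 < e" .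
    moreover have "\<forall>\<^sub>F q in at q0 within swing_domain T ubar m M. q \<in> swing_domain T ubar m M"
      by (simp add: eventually_at_filter)
    ultimately show "\<forall>\<^sub>F q in at q0 within swing_domain T ubar m M. dist (?v q) (?v q0) < e"
    proof eventually_elim
      case (elim q)
      obtain t p z where q_eq: "q = (t, p, z)" by (cases q)
      have "V t p z \<le> V t0 p0 z0 + modulus \<eta> q q0" "V t0 p0 z0 \<le> V t p z + modulus \<eta> q0 q"
        using value_le[OF _ _ \<eta>] elim q0 unfolding q_eq q0_eq by auto
      then show ?case
        using elim(1) modulus_commute[of \<eta> q q0] by (simp add: q_eq q0_eq dist_real_def)
    qed
  qed
qed

end

theorem proposition4p3:
  fixes \<Omega> :: "'a measure" and F :: "real \<Rightarrow> 'a measure" and W :: "real \<Rightarrow> 'a \<Rightarrow> real"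
    and f \<sigma> :: "real \<Rightarrow> real \<Rightarrow> real" and P :: "real \<Rightarrow> real \<Rightarrow> real \<Rightarrow> 'a \<Rightarrow> real"
    and T r K ubar m M :: real
  assumes "T > 0" and "r \<ge> 0" and "K > 0" and "ubar > 0" and "m \<ge> 0" and "M \<ge> 0" and "m < M"
    and "filtered_prob_space \<Omega> F T"
    and "brownian_motion \<Omega> F T W"
    and "continuous_on ({0..T} \<times> UNIV) (\<lambda>(s, x). f s x)"
    and "continuous_on ({0..T} \<times> UNIV) (\<lambda>(s, x). \<sigma> s x)"
    and "\<exists>L. \<forall>s\<in>{0..T}. L-lipschitz_on UNIV (f s)"
    and "\<exists>L. \<forall>s\<in>{0..T}. L-lipschitz_on UNIV (\<sigma> s)"
    and "\<And>t p. t \<in> {0..T} \<Longrightarrow> strong_solution \<Omega> F W f \<sigma> t T p (P t p)"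
  shows "continuous_on (swing_domain T ubar m M)
           (\<lambda>(t, p, z). swing_value \<Omega> F P T r K ubar m M t p z)"
proof -
  have bounded_at_0: "\<exists>C. \<forall>s\<in>{0..T}. \<bar>g s 0\<bar> \<le> C"
    if "continuous_on ({0..T} \<times> UNIV) (\<lambda>(s, x). g s x)" for g :: "real \<Rightarrow> real \<Rightarrow> real"
  proof -
    have "continuous_on {0..T} (\<lambda>s. (case (s, 0) of (s, x) \<Rightarrow> g s x))"
      by (rule continuous_on_compose2[OF that]) (auto intro!: continuous_intros)
    then have "bounded ((\<lambda>s. g s 0) ` {0..T})"
      by (intro compact_imp_bounded compact_continuous_image) auto
    then show ?thesis by (auto simp: bounded_iff)
  qed
  obtain C1 C2 where C1: "\<forall>s\<in>{0..T}. \<bar>f s 0\<bar> \<le> C1" and C2: "\<forall>s\<in>{0..T}. \<bar>\<sigma> s 0\<bar> \<le> C2"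
    using bounded_at_0[OF assms(10)] bounded_at_0[OF assms(11)] by auto
  obtain L1 L2 where L1: "\<forall>s\<in>{0..T}. L1-lipschitz_on UNIV (f s)" and L2: "\<forall>s\<in>{0..T}. L2-lipschitz_on UNIV (\<sigma> s)"
    using assms(12,13) by auto
  define L where "L = max 1 (max L1 L2)"
  define \<alpha> where "\<alpha> = max C1 C2"
  have lip_f: "\<bar>f s x - f s y\<bar> \<le> L * \<bar>x - y\<bar>" if "s \<in> {0..T}" for s x y
  proof -
    have "\<bar>f s x - f s y\<bar> \<le> L1 * \<bar>x - y\<bar>" using L1 that by (auto simp: lipschitz_on_def dist_real_def)
    also have "\<dots> \<le> L * \<bar>x - y\<bar>" by (intro mult_right_mono) (auto simp: L_def)
    finally show ?thesis .
  qed
  have lip_\<sigma>: "\<bar>\<sigma> s x - \<sigma> s y\<bar> \<le> L * \<bar>x - y\<bar>" if "s \<in> {0..T}" for s x y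
  proof -
    have "\<bar>\<sigma> s x - \<sigma> s y\<bar> \<le> L2 * \<bar>x - y\<bar>" using L2 that by (auto simp: lipschitz_on_def dist_real_def)
    also have "\<dots> \<le> L * \<bar>x - y\<bar>" by (intro mult_right_mono) (auto simp: L_def)
    finally show ?thesis .
  qed
  interpret prob_space \<Omega> using assms(8) by (simp add: filtered_prob_space_def)
  interpret swing \<Omega> F W T f \<sigma> \<alpha> L P r K ubar m M
  proof
    show "\<bar>f s x\<bar> \<le> \<alpha> + L * \<bar>x\<bar>" if "s \<in> {0..T}" for s x
      using lip_f[OF that, of x 0] bspec[OF C1 that] by (auto simp: \<alpha>_def)
    show "\<bar>\<sigma> s x\<bar> \<le> \<alpha> + L * \<bar>x\<bar>" if "s \<in> {0..T}" for s x
      using lip_\<sigma>[OF that, of x 0] bspec[OF C2 that] by (auto simp: \<alpha>_def)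
  qed (use assms lip_f lip_\<sigma> in \<open>auto simp: L_def\<close>)
  show ?thesis by (rule value_continuous)
qed

end
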